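(* For a normed lattice $F$ the following conditions are equivalent: (i) $F$ is demicontinuous; (ii) $F$ embeds isometrically as an order dense sublattice of a monotonically complete Banach lattice; (iii) $F$ embeds isomorphically as a regular sublattice of a monotonically complete Banach lattice. Moreover, the monotonically complete Banach lattice which contains $F$ isomorphically as an order dense sublattice is unique up to an isomorphism.
   Context: A normed lattice is a real vector lattice with a lattice (solid) norm; norm completeness is not assumed. $P\uparrow f$ means that $P$ is upward directed with supremum $f$. $B_F$ is the closed unit ball of $F$. $F$ is demicontinuous if there is $r\ge1$ such that whenever $P\subset B_F\cap F_+$ and $f\in F$ satisfy $P\uparrow f$, then $\|f\|\le r$. $F$ is monotonically complete if every upward directed subset of $B_F\cap F_+$ has a supremum in $F$. A sublattice $E$ of a vector lattice $G$ is order dense if for every $0<g\in G$ there is $e\in E$ with $0<e\le g$; it is regular if whenever $P\subset E$ has infimum $0$ in $E$, it has infimum $0$ in $G$. Embeddings are injective linear lattice homomorphisms; an isomorphic embedding is one that is bounded and bounded below in norm; an isomorphism of normed lattices is a surjective isomorphic embedding. *)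

theory Defs
  imports "HOL-Analysis.Abstract_Metric_Spaces" "HOL-Algebra.Algebraic_Closure_Type"
begin

text \<open>
  Theorems about normed lattices quantify existentially over normed lattices, so these are
  carrier-based structures in the style of HOL-Algebra: real modules with an order and a norm.
  As for every \<open>module\<close> record, the fields \<open>mult\<close> and \<open>one\<close> of the underlying ring record carry
  no meaning.
\<close>

abbreviation real_ring :: "real ring"
  where "real_ring \<equiv> ring_of_type_algebra"

record 'a vector_lattice = "(real, 'a) module" +
  vle :: "'a \<Rightarrow> 'a \<Rightarrow> bool" (infixl \<open>\<preceq>\<index>\<close> 50)

record 'a normed_lattice = "'a vector_lattice" +
  vnorm :: "'a \<Rightarrow> real"

definition ord_of :: "('a, 'm) vector_lattice_scheme \<Rightarrow> 'a gorder"
  where "ord_of V = \<lparr>carrier = carrier V, eq = (=), le = vle V\<rparr>"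

locale vector_lattice = Module.module real_ring V + ord: Lattice.lattice "ord_of V"
  for V :: "('a, 'm) vector_lattice_scheme" (structure) +
  assumes add_mono:
      "\<lbrakk>x \<in> carrier V; y \<in> carrier V; z \<in> carrier V; x \<preceq> y\<rbrakk> \<Longrightarrow> x \<oplus> z \<preceq> y \<oplus> z"
    and smult_nonneg: "\<lbrakk>0 \<le> a; x \<in> carrier V; \<zero> \<preceq> x\<rbrakk> \<Longrightarrow> \<zero> \<preceq> a \<odot> x"

definition vabs :: "('a, 'm) vector_lattice_scheme \<Rightarrow> 'a \<Rightarrow> 'a"
  where "vabs V x = x \<squnion>\<^bsub>ord_of V\<^esub> (\<ominus>\<^bsub>V\<^esub> x)"

locale normed_lattice = vector_lattice V for V :: "('a, 'm) normed_lattice_scheme" (structure) +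
  assumes vnorm_eq_0_iff: "x \<in> carrier V \<Longrightarrow> vnorm V x = 0 \<longleftrightarrow> x = \<zero>"
    and vnorm_smult: "x \<in> carrier V \<Longrightarrow> vnorm V (a \<odot> x) = \<bar>a\<bar> * vnorm V x"
    and vnorm_triangle:
      "\<lbrakk>x \<in> carrier V; y \<in> carrier V\<rbrakk> \<Longrightarrow> vnorm V (x \<oplus> y) \<le> vnorm V x + vnorm V y"
    and vnorm_solid:
      "\<lbrakk>x \<in> carrier V; y \<in> carrier V; vabs V x \<preceq> vabs V y\<rbrakk> \<Longrightarrow> vnorm V x \<le> vnorm V y"

text \<open>
  Off the carrier the distance is set to \<open>0\<close>, because \<open>Metric_space\<close> requires nonnegativity and
  symmetry on the whole type.
\<close>

definition vdist :: "('a, 'm) normed_lattice_scheme \<Rightarrow> 'a \<Rightarrow> 'a \<Rightarrow> real"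
  where "vdist V x y =
    (if x \<in> carrier V \<and> y \<in> carrier V then vnorm V (x \<ominus>\<^bsub>V\<^esub> y) else 0)"

locale banach_lattice = normed_lattice +
  assumes complete: "Metric_space.mcomplete (carrier V) (vdist V)"

definition pos_unit_ball :: "('a, 'm) normed_lattice_scheme \<Rightarrow> 'a set"
  where "pos_unit_ball V = {x \<in> carrier V. vnorm V x \<le> 1 \<and> \<zero>\<^bsub>V\<^esub> \<preceq>\<^bsub>V\<^esub> x}"

text \<open>Directed sets are nonempty.\<close>

definition up_directed :: "('a, 'm) vector_lattice_scheme \<Rightarrow> 'a set \<Rightarrow> bool"
  where "up_directed V P \<longleftrightarrow>
    P \<noteq> {} \<and> (\<forall>x\<in>P. \<forall>y\<in>P. \<exists>z\<in>P. x \<preceq>\<^bsub>V\<^esub> z \<and> y \<preceq>\<^bsub>V\<^esub> z)"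

definition is_sup :: "('a, 'm) vector_lattice_scheme \<Rightarrow> 'a set \<Rightarrow> 'a \<Rightarrow> bool"
  where "is_sup V P f \<longleftrightarrow> least (ord_of V) f (Upper (ord_of V) P)"

definition increases_to :: "('a, 'm) vector_lattice_scheme \<Rightarrow> 'a set \<Rightarrow> 'a \<Rightarrow> bool"
  where "increases_to V P f \<longleftrightarrow> up_directed V P \<and> is_sup V P f"

definition demicontinuous :: "('a, 'm) normed_lattice_scheme \<Rightarrow> bool"
  where "demicontinuous F \<longleftrightarrow>
    (\<exists>r\<ge>1. \<forall>P f. P \<subseteq> pos_unit_ball F \<and> f \<in> carrier F \<and> increases_to F P f \<longrightarrow> vnorm F f \<le> r)"

definition monotonically_complete :: "('a, 'm) normed_lattice_scheme \<Rightarrow> bool"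
  where "monotonically_complete F \<longleftrightarrow>
    (\<forall>P. P \<subseteq> pos_unit_ball F \<and> up_directed F P \<longrightarrow> (\<exists>f\<in>carrier F. is_sup F P f))"

definition vector_sublattice :: "'a set \<Rightarrow> ('a, 'm) vector_lattice_scheme \<Rightarrow> bool"
  where "vector_sublattice E G \<longleftrightarrow> submodule E real_ring G \<and>
    (\<forall>x\<in>E. \<forall>y\<in>E. x \<squnion>\<^bsub>ord_of G\<^esub> y \<in> E \<and> x \<sqinter>\<^bsub>ord_of G\<^esub> y \<in> E)"

definition order_dense_sublattice :: "'a set \<Rightarrow> ('a, 'm) vector_lattice_scheme \<Rightarrow> bool"
  where "order_dense_sublattice E G \<longleftrightarrow> vector_sublattice E G \<and>
    (\<forall>g\<in>carrier G. \<zero>\<^bsub>G\<^esub> \<preceq>\<^bsub>G\<^esub> g \<and> g \<noteq> \<zero>\<^bsub>G\<^esub> \<longrightarrow>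
      (\<exists>e\<in>E. \<zero>\<^bsub>G\<^esub> \<preceq>\<^bsub>G\<^esub> e \<and> e \<noteq> \<zero>\<^bsub>G\<^esub> \<and> e \<preceq>\<^bsub>G\<^esub> g))"

text \<open>
  \<open>is_inf_in G E P f\<close>: \<open>f\<close> is the infimum of \<open>P\<close> in the subset \<open>E\<close> with the order of \<open>G\<close>.
  The condition \<open>P \<noteq> {}\<close> in regularity matters only for \<open>E = {\<zero>}\<close>, where the empty set has
  infimum \<open>\<zero>\<close>.
\<close>

definition is_inf_in :: "('a, 'm) vector_lattice_scheme \<Rightarrow> 'a set \<Rightarrow> 'a set \<Rightarrow> 'a \<Rightarrow> bool"
  where "is_inf_in G E P f \<longleftrightarrow>
    greatest ((ord_of G)\<lparr>carrier := E\<rparr>) f (Lower ((ord_of G)\<lparr>carrier := E\<rparr>) P)"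

definition regular_sublattice :: "'a set \<Rightarrow> ('a, 'm) vector_lattice_scheme \<Rightarrow> bool"
  where "regular_sublattice E G \<longleftrightarrow> vector_sublattice E G \<and>
    (\<forall>P. P \<subseteq> E \<and> P \<noteq> {} \<and> is_inf_in G E P \<zero>\<^bsub>G\<^esub> \<longrightarrow> is_inf_in G (carrier G) P \<zero>\<^bsub>G\<^esub>)"

definition lattice_embedding ::
    "('a, 'm) vector_lattice_scheme \<Rightarrow> ('b, 'n) vector_lattice_scheme \<Rightarrow> ('a \<Rightarrow> 'b) \<Rightarrow> bool"
  where "lattice_embedding F G T \<longleftrightarrow>
    T \<in> hom (add_monoid F) (add_monoid G) \<and>
    (\<forall>a. \<forall>x\<in>carrier F. T (a \<odot>\<^bsub>F\<^esub> x) = a \<odot>\<^bsub>G\<^esub> T x) \<and>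
    join_pres (ord_of F) (ord_of G) T \<and> meet_pres (ord_of F) (ord_of G) T \<and>
    inj_on T (carrier F)"

definition isometric_embedding ::
    "('a, 'm) normed_lattice_scheme \<Rightarrow> ('b, 'n) normed_lattice_scheme \<Rightarrow> ('a \<Rightarrow> 'b) \<Rightarrow> bool"
  where "isometric_embedding F G T \<longleftrightarrow>
    lattice_embedding F G T \<and> (\<forall>x\<in>carrier F. vnorm G (T x) = vnorm F x)"

definition isomorphic_embedding ::
    "('a, 'm) normed_lattice_scheme \<Rightarrow> ('b, 'n) normed_lattice_scheme \<Rightarrow> ('a \<Rightarrow> 'b) \<Rightarrow> bool"
  where "isomorphic_embedding F G T \<longleftrightarrow> lattice_embedding F G T \<and>
    (\<exists>C. \<forall>x\<in>carrier F. vnorm G (T x) \<le> C * vnorm F x) \<and>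
    (\<exists>c>0. \<forall>x\<in>carrier F. c * vnorm F x \<le> vnorm G (T x))"

definition normed_lattice_isomorphism ::
    "('a, 'm) normed_lattice_scheme \<Rightarrow> ('b, 'n) normed_lattice_scheme \<Rightarrow> ('a \<Rightarrow> 'b) \<Rightarrow> bool"
  where "normed_lattice_isomorphism F G T \<longleftrightarrow>
    isomorphic_embedding F G T \<and> T ` carrier F = carrier G"

definition mc_banach_lattice :: "('a, 'm) normed_lattice_scheme \<Rightarrow> bool"
  where "mc_banach_lattice G \<longleftrightarrow> banach_lattice G \<and> monotonically_complete G"

text \<open>
  HOL cannot quantify over types inside a formula, so the existential statements below carry the
  type \<open>'g\<close> of the elements of the containing lattice as a parameter. For \<open>F\<close> with elements in
  \<open>'a\<close>, the type \<open>'a set \<times> 'a set\<close> is always large enough for a monotonically complete \<open>G\<close>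
  containing \<open>F\<close> as an order dense sublattice: such a \<open>G\<close> is Dedekind complete, so \<open>g\<close> is
  determined by the sets of positive elements of \<open>F\<close> below the positive and below the negative
  part of \<open>g\<close>.
\<close>

definition embeds_isometrically_order_dense :: "'g itself \<Rightarrow> 'a normed_lattice \<Rightarrow> bool"
  where "embeds_isometrically_order_dense _ F \<longleftrightarrow>
    (\<exists>(G :: 'g normed_lattice) T. mc_banach_lattice G \<and>
      isometric_embedding F G T \<and> order_dense_sublattice (T ` carrier F) G)"

definition embeds_isomorphically_regular :: "'g itself \<Rightarrow> 'a normed_lattice \<Rightarrow> bool"
  where "embeds_isomorphically_regular _ F \<longleftrightarrow>
    (\<exists>(G :: 'g normed_lattice) T. mc_banach_lattice G \<and>
      isomorphic_embedding F G T \<and> regular_sublattice (T ` carrier F) G)"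

end

(*
  Inside a monotonically complete G, a positive element g is determined by the set of positive
  elements of F below g, and the sets that arise are exactly the norm bounded, order closed, lower
  sets of F_+ ("cuts"). This gives uniqueness. For existence, the cuts form a cone with an addition
  that is cancellative by the Archimedean property, and its differences form a vector lattice G in
  which every directed norm bounded subset of F_+ has a supremum; demicontinuity says exactly that the
  order closure of a directed bounded set is bounded, so that it is a cut. The norm
  inf {|f| + r c : |g| <= f + sup P, P a directed subset of F_+ bounded by c} extends the norm of F
  because |(|e| - f)^+| <= r c for e in F, again by demicontinuity. That monotone completeness
  implies both norm completeness and demicontinuity follows by summing suitable series.
*)

theory Submission
  imports Defs "HOL-Library.Lattice_Algebras"
begin

section \<open>Carrier-based vector lattices inside a type class\<close>

text \<open>The Archimedean property comes from the norm alone, since multiples of a nonzero element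
  are unbounded in norm. It is the engine behind the differences and the cancellation of cuts and
  behind the recovery of an element from an order dense sublattice: in each case an excess such as
  \<open>pprt (f - u)\<close> could otherwise be added any number of times. The main obstacle is
  that elements do not split inside F: an element of F below x + y need not be a sum of elements of
  F below x and below y. Hence sums of cuts have to be closed up, and the comparison of two
  completions is at first only superadditive; additivity is won from the superadditivity of its
  inverse. Lattice operations are not followed through the constructions: a linear map that
  preserves and reflects positivity and has order dense image respects them. Carriers are moved into
  a type of a class so that positive parts, infima and sums obey the ordinary laws of lattice
  ordered groups.\<close>

class real_vector_lattice = ordered_real_vector + lattice_ab_group_add_abs

lemma ord_of_simps [simp]:
  "carrier (ord_of V) = carrier V" "eq (ord_of V) = (=)" "le (ord_of V) = vle V"
  by (simp_all add: ord_of_def)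

lemma real_ring_simps [simp]:
  "carrier real_ring = UNIV" "\<zero>\<^bsub>real_ring\<^esub> = 0" "\<one>\<^bsub>real_ring\<^esub> = 1"
  "x \<oplus>\<^bsub>real_ring\<^esub> y = x + y" "x \<otimes>\<^bsub>real_ring\<^esub> y = x * y"
  by (simp_all add: ring_of_type_algebra_def)

abbreviation vjoin :: "('a, 'm) vector_lattice_scheme \<Rightarrow> 'a \<Rightarrow> 'a \<Rightarrow> 'a"
  where "vjoin V x y \<equiv> x \<squnion>\<^bsub>ord_of V\<^esub> y"

abbreviation vmeet :: "('a, 'm) vector_lattice_scheme \<Rightarrow> 'a \<Rightarrow> 'a \<Rightarrow> 'a"
  where "vmeet V x y \<equiv> x \<sqinter>\<^bsub>ord_of V\<^esub> y"

context vector_lattice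
begin

lemma vle_refl: "x \<in> carrier V \<Longrightarrow> x \<preceq> x"
  using ord.le_refl by simp

lemma vle_antisym: "\<lbrakk>x \<preceq> y; y \<preceq> x; x \<in> carrier V; y \<in> carrier V\<rbrakk> \<Longrightarrow> x = y"
  using ord.le_antisym by simp

lemma vle_trans:
  "\<lbrakk>x \<preceq> y; y \<preceq> z; x \<in> carrier V; y \<in> carrier V; z \<in> carrier V\<rbrakk> \<Longrightarrow> x \<preceq> z"
  using ord.le_trans by simp

lemma vjoin_closed: "\<lbrakk>x \<in> carrier V; y \<in> carrier V\<rbrakk> \<Longrightarrow> vjoin V x y \<in> carrier V"
  using ord.join_closed by simp

lemma vmeet_closed: "\<lbrakk>x \<in> carrier V; y \<in> carrier V\<rbrakk> \<Longrightarrow> vmeet V x y \<in> carrier V"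
  using ord.meet_closed by simp

lemma vjoin_upper:
  assumes "x \<in> carrier V" "y \<in> carrier V"
  shows "x \<preceq> vjoin V x y" "y \<preceq> vjoin V x y"
  using ord.join_left ord.join_right assms by simp_all

lemma vmeet_lower:
  assumes "x \<in> carrier V" "y \<in> carrier V"
  shows "vmeet V x y \<preceq> x" "vmeet V x y \<preceq> y"
  using ord.meet_left ord.meet_right assms by simp_all

lemma vjoin_least:
  "\<lbrakk>x \<preceq> z; y \<preceq> z; x \<in> carrier V; y \<in> carrier V; z \<in> carrier V\<rbrakk> \<Longrightarrow> vjoin V x y \<preceq> z"
  using ord.join_le by simp

lemma vmeet_greatest:
  "\<lbrakk>z \<preceq> x; z \<preceq> y; x \<in> carrier V; y \<in> carrier V; z \<in> carrier V\<rbrakk> \<Longrightarrow> z \<preceq> vmeet V x y"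
  using ord.meet_le by simp

lemma vsmult_closed: "x \<in> carrier V \<Longrightarrow> a \<odot> x \<in> carrier V"
  using smult_closed by simp

lemma nonneg_diff_iff:
  assumes "x \<in> carrier V" "y \<in> carrier V"
  shows "\<zero> \<preceq> y \<ominus> x \<longleftrightarrow> x \<preceq> y"
proof
  assume "\<zero> \<preceq> y \<ominus> x"
  from add_mono[OF _ _ assms(1) this] assms show "x \<preceq> y"
    by (simp add: M.minus_eq M.a_assoc M.l_neg)
next
  assume "x \<preceq> y"
  from add_mono[OF assms _ this, of "\<ominus> x"] assms show "\<zero> \<preceq> y \<ominus> x"
    by (simp add: M.minus_eq M.r_neg)
qed

lemma smult_minus: "x \<in> carrier V \<Longrightarrow> a \<odot> (\<ominus> x) = \<ominus> (a \<odot> x)"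
  using smult_r_minus by simp

lemma smult_mono_right:
  assumes "x \<in> carrier V" "y \<in> carrier V" "x \<preceq> y" "0 \<le> a"
  shows "a \<odot> x \<preceq> a \<odot> y"
proof -
  have "\<zero> \<preceq> a \<odot> (y \<ominus> x)"
    using assms by (intro smult_nonneg) (simp_all add: nonneg_diff_iff)
  then have "\<zero> \<preceq> a \<odot> y \<ominus> a \<odot> x"
    using assms smult_r_distr[of a y "\<ominus> x"] by (simp add: M.minus_eq smult_minus)
  then show ?thesis
    using assms by (simp add: nonneg_diff_iff vsmult_closed)
qed

lemma smult_mono_left:
  assumes "x \<in> carrier V" "\<zero> \<preceq> x" "a \<le> b"
  shows "a \<odot> x \<preceq> b \<odot> x"
proof -
  have "\<zero> \<preceq> (b - a) \<odot> x"
    using assms by (intro smult_nonneg) simp_all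
  from add_mono[OF _ _ _ this, of "a \<odot> x"] assms show ?thesis
    using smult_l_distr[of "b - a" a x] by (simp add: vsmult_closed)
qed

end

text \<open>
  A vector lattice given by a carrier is represented inside a type of class
  \<open>real_vector_lattice\<close>: the elements of the type \<open>'a lattice_section\<close> choose one element from
  every vector lattice over \<open>'a\<close>, so the type is the product of all these lattices, and
  \<open>V\<close> is one of its factors.
\<close>

typedef 'a lattice_section =
  "{s :: 'a normed_lattice \<Rightarrow> 'a. \<forall>V. if vector_lattice V then s V \<in> carrier V else s V = undefined}"
proof -
  have "\<exists>x. if vector_lattice V then x \<in> carrier V else x = undefined" for V :: "'a normed_lattice"
  proof (cases "vector_lattice V")
    case True
    then interpret vector_lattice V .
    show ?thesis using M.zero_closed True by auto
  qed auto
  then have "\<exists>s. \<forall>V :: 'a normed_lattice. if vector_lattice V then s V \<in> carrier V else s V = undefined"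
    by (intro choice allI)
  then show ?thesis by blast
qed

setup_lifting type_definition_lattice_section

instantiation lattice_section :: (type) real_vector_lattice
begin

lift_definition zero_lattice_section :: "'a lattice_section"
  is "\<lambda>V. if vector_lattice V then \<zero>\<^bsub>V\<^esub> else undefined"
  by (auto dest: vector_lattice.axioms Module.module.axioms abelian_group.a_comm_group
    simp: module_def abelian_group.axioms abelian_monoid.zero_closed)

lift_definition plus_lattice_section ::
    "'a lattice_section \<Rightarrow> 'a lattice_section \<Rightarrow> 'a lattice_section"
  is "\<lambda>s t V. if vector_lattice V then s V \<oplus>\<^bsub>V\<^esub> t V else undefined"
  by (metis abelian_group.axioms(1) abelian_monoid.a_closed Module.module.axioms(2) vector_lattice.axioms(1))

lift_definition uminus_lattice_section :: "'a lattice_section \<Rightarrow> 'a lattice_section"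
  is "\<lambda>s V. if vector_lattice V then \<ominus>\<^bsub>V\<^esub> s V else undefined"
  by (metis abelian_group.a_inv_closed Module.module.axioms(2) vector_lattice.axioms(1))

lift_definition minus_lattice_section ::
    "'a lattice_section \<Rightarrow> 'a lattice_section \<Rightarrow> 'a lattice_section"
  is "\<lambda>s t V. if vector_lattice V then s V \<ominus>\<^bsub>V\<^esub> t V else undefined"
  by (metis abelian_group.minus_closed Module.module.axioms(2) vector_lattice.axioms(1))

lift_definition scaleR_lattice_section :: "real \<Rightarrow> 'a lattice_section \<Rightarrow> 'a lattice_section"
  is "\<lambda>a s V. if vector_lattice V then a \<odot>\<^bsub>V\<^esub> s V else undefined"
  by (metis vector_lattice.vsmult_closed)

lift_definition sup_lattice_section ::
    "'a lattice_section \<Rightarrow> 'a lattice_section \<Rightarrow> 'a lattice_section"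
  is "\<lambda>s t V. if vector_lattice V then vjoin V (s V) (t V) else undefined"
  by (metis vector_lattice.vjoin_closed)

lift_definition inf_lattice_section ::
    "'a lattice_section \<Rightarrow> 'a lattice_section \<Rightarrow> 'a lattice_section"
  is "\<lambda>s t V. if vector_lattice V then vmeet V (s V) (t V) else undefined"
  by (metis vector_lattice.vmeet_closed)

lift_definition less_eq_lattice_section :: "'a lattice_section \<Rightarrow> 'a lattice_section \<Rightarrow> bool"
  is "\<lambda>s t. \<forall>V. vector_lattice V \<longrightarrow> s V \<preceq>\<^bsub>V\<^esub> t V" .

definition less_lattice_section :: "'a lattice_section \<Rightarrow> 'a lattice_section \<Rightarrow> bool"
  where "less_lattice_section s t \<longleftrightarrow> s \<le> t \<and> \<not> t \<le> s"

definition abs_lattice_section :: "'a lattice_section \<Rightarrow> 'a lattice_section"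
  where "abs_lattice_section s = sup s (- s)"

lemma section_eqI:
  assumes "\<And>V. vector_lattice V \<Longrightarrow> Rep_lattice_section s V = Rep_lattice_section t V"
  shows "s = t"
  using assms by transfer (metis ext)

lemma section_closed: "vector_lattice V \<Longrightarrow> Rep_lattice_section s V \<in> carrier V"
  using Rep_lattice_section[of s] by auto

lemmas section_rep = zero_lattice_section.rep_eq plus_lattice_section.rep_eq
  uminus_lattice_section.rep_eq minus_lattice_section.rep_eq scaleR_lattice_section.rep_eq
  sup_lattice_section.rep_eq inf_lattice_section.rep_eq

instance
proof
  fix s t u :: "'a lattice_section" and a b :: real
  note [simp] = section_rep section_closed
  let ?R = Rep_lattice_section
  have V: "Module.module real_ring V" "abelian_group V" if "vector_lattice V"
      for V :: "'a normed_lattice"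
    using that by (auto dest: vector_lattice.axioms Module.module.axioms)
  show "s + t + u = s + (t + u)"
    by (rule section_eqI)
      (simp add: V abelian_group.axioms abelian_monoid.a_assoc)
  show "s + t = t + s"
    by (rule section_eqI)
      (simp add: V abelian_group.axioms abelian_monoid.a_comm)
  show "0 + s = s"
    by (rule section_eqI)
      (simp add: V abelian_group.axioms abelian_monoid.l_zero)
  show "- s + s = 0"
    by (rule section_eqI) (simp add: V abelian_group.l_neg)
  show "s - t = s + - t"
    by (rule section_eqI) (simp add: V abelian_group.minus_eq)
  show "a *\<^sub>R (s + t) = a *\<^sub>R s + a *\<^sub>R t"
  proof (rule section_eqI)
    fix V :: "'a normed_lattice" assume "vector_lattice V"
    then show "?R (a *\<^sub>R (s + t)) V = ?R (a *\<^sub>R s + a *\<^sub>R t) V"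
      using module.smult_r_distr[OF V(1), of V a "?R s V" "?R t V"] by simp
  qed
  show "(a + b) *\<^sub>R s = a *\<^sub>R s + b *\<^sub>R s"
  proof (rule section_eqI)
    fix V :: "'a normed_lattice" assume "vector_lattice V"
    then show "?R ((a + b) *\<^sub>R s) V = ?R (a *\<^sub>R s + b *\<^sub>R s) V"
      using module.smult_l_distr[OF V(1), of V a b "?R s V"] by simp
  qed
  show "a *\<^sub>R b *\<^sub>R s = (a * b) *\<^sub>R s"
  proof (rule section_eqI)
    fix V :: "'a normed_lattice" assume "vector_lattice V"
    then show "?R (a *\<^sub>R b *\<^sub>R s) V = ?R ((a * b) *\<^sub>R s) V"
      using module.smult_assoc1[OF V(1), of V a b "?R s V"] by simp
  qed
  show "1 *\<^sub>R s = s"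
  proof (rule section_eqI)
    fix V :: "'a normed_lattice" assume "vector_lattice V"
    then show "?R (1 *\<^sub>R s) V = ?R s V"
      using module.smult_one[OF V(1), of V "?R s V"] by simp
  qed
  show "s < t \<longleftrightarrow> s \<le> t \<and> \<not> t \<le> s"
    by (rule less_lattice_section_def)
  show "\<bar>s\<bar> = sup s (- s)"
    by (rule abs_lattice_section_def)
  show "s \<le> s"
    by (simp add: less_eq_lattice_section.rep_eq vector_lattice.vle_refl)
  show "s \<le> u" if "s \<le> t" "t \<le> u"
    using that unfolding less_eq_lattice_section.rep_eq
    by (meson section_closed vector_lattice.vle_trans)
  show "s = t" if "s \<le> t" "t \<le> s"
    using that unfolding less_eq_lattice_section.rep_eq
    by (intro section_eqI) (meson section_closed vector_lattice.vle_antisym)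
  show "inf s t \<le> s" "inf s t \<le> t" "s \<le> sup s t" "t \<le> sup s t"
    by (simp_all add: less_eq_lattice_section.rep_eq vector_lattice.vmeet_lower
      vector_lattice.vjoin_upper)
  show "s \<le> inf t u" if "s \<le> t" "s \<le> u"
    using that by (simp add: less_eq_lattice_section.rep_eq vector_lattice.vmeet_greatest)
  show "sup t u \<le> s" if "t \<le> s" "u \<le> s"
    using that by (simp add: less_eq_lattice_section.rep_eq vector_lattice.vjoin_least)
  show "u + s \<le> u + t" if "s \<le> t"
    unfolding less_eq_lattice_section.rep_eq
  proof (intro allI impI)
    fix V :: "'a normed_lattice" assume v: "vector_lattice V"
    then interpret vector_lattice V .
    show "?R (u + s) V \<preceq>\<^bsub>V\<^esub> ?R (u + t) V"
      using that v add_mono[of "?R s V" "?R t V" "?R u V"]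
      by (simp add: less_eq_lattice_section.rep_eq M.a_comm)
  qed
  show "a *\<^sub>R s \<le> a *\<^sub>R t" if "s \<le> t" "0 \<le> a"
    using that by (simp add: less_eq_lattice_section.rep_eq vector_lattice.smult_mono_right)
  show "a *\<^sub>R s \<le> b *\<^sub>R s" if "a \<le> b" "0 \<le> s"
    using that by (simp add: less_eq_lattice_section.rep_eq vector_lattice.smult_mono_left)
qed

end

section \<open>Monotonically complete norms\<close>

definition directed :: "'v::ord set \<Rightarrow> bool"
  where "directed P \<longleftrightarrow> P \<noteq> {} \<and> (\<forall>x\<in>P. \<forall>y\<in>P. \<exists>z\<in>P. x \<le> z \<and> y \<le> z)"

definition lub_in :: "'v::ord set \<Rightarrow> 'v set \<Rightarrow> 'v \<Rightarrow> bool"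
  where "lub_in E P f \<longleftrightarrow> f \<in> E \<and> (\<forall>p\<in>P. p \<le> f) \<and> (\<forall>u\<in>E. (\<forall>p\<in>P. p \<le> u) \<longrightarrow> f \<le> u)"

definition glb_in :: "'v::ord set \<Rightarrow> 'v set \<Rightarrow> 'v \<Rightarrow> bool"
  where "glb_in E P f \<longleftrightarrow> f \<in> E \<and> (\<forall>p\<in>P. f \<le> p) \<and> (\<forall>u\<in>E. (\<forall>p\<in>P. u \<le> p) \<longrightarrow> u \<le> f)"

definition positive_ball :: "'v::{zero,ord} set \<Rightarrow> ('v \<Rightarrow> real) \<Rightarrow> 'v set"
  where "positive_ball E N = {x \<in> E. 0 \<le> x \<and> N x \<le> 1}"

definition demicontinuous_on :: "'v::{zero,ord} set \<Rightarrow> ('v \<Rightarrow> real) \<Rightarrow> bool"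
  where "demicontinuous_on E N \<longleftrightarrow>
    (\<exists>r\<ge>1. \<forall>P f. P \<subseteq> positive_ball E N \<and> directed P \<and> lub_in E P f \<longrightarrow> N f \<le> r)"

definition monotonically_complete_on :: "'v::{zero,ord} set \<Rightarrow> ('v \<Rightarrow> real) \<Rightarrow> bool"
  where "monotonically_complete_on E N \<longleftrightarrow>
    (\<forall>P. P \<subseteq> positive_ball E N \<and> directed P \<longrightarrow> (\<exists>f. lub_in E P f))"

lemma lub_in_unique:
  fixes f g :: "'v::order"
  shows "lub_in E P f \<Longrightarrow> lub_in E P g \<Longrightarrow> f = g"
  unfolding lub_in_def by (meson order.antisym)

locale linear_sublattice =
  fixes E :: "'v::real_vector_lattice set"
  assumes zero_mem [simp]: "0 \<in> E"
    and add_mem [simp]: "x \<in> E \<Longrightarrow> y \<in> E \<Longrightarrow> x + y \<in> E"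
    and scaleR_mem [simp]: "x \<in> E \<Longrightarrow> a *\<^sub>R x \<in> E"
    and sup_mem [simp]: "x \<in> E \<Longrightarrow> y \<in> E \<Longrightarrow> sup x y \<in> E"
begin

lemma uminus_mem [simp]: "x \<in> E \<Longrightarrow> - x \<in> E"
  using scaleR_mem[of x "- 1"] by simp

lemma diff_mem [simp]: "x \<in> E \<Longrightarrow> y \<in> E \<Longrightarrow> x - y \<in> E"
  using add_mem[of x "- y"] by simp

lemma inf_mem [simp]: "x \<in> E \<Longrightarrow> y \<in> E \<Longrightarrow> inf x y \<in> E"
  by (simp add: inf_eq_neg_sup del: neg_sup_eq_inf)

lemma abs_mem [simp]: "x \<in> E \<Longrightarrow> \<bar>x\<bar> \<in> E"
  by (simp add: abs_lattice)

lemma pprt_mem [simp]: "x \<in> E \<Longrightarrow> pprt x \<in> E"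
  by (simp add: pprt_def)

lemma nprt_mem [simp]: "x \<in> E \<Longrightarrow> nprt x \<in> E"
  by (simp add: nprt_def)

lemma sum_mem: "(\<And>i. i \<in> I \<Longrightarrow> f i \<in> E) \<Longrightarrow> sum f I \<in> E"
  by (induction I rule: infinite_finite_induct) auto

lemma lub_in_scaleR:
  assumes "lub_in E P f" "0 < a"
  shows "lub_in E ((*\<^sub>R) a ` P) (a *\<^sub>R f)"
  unfolding lub_in_def
proof (intro conjI ballI impI)
  show "a *\<^sub>R f \<in> E" using assms by (simp add: lub_in_def)
  show "p \<le> a *\<^sub>R f" if "p \<in> (*\<^sub>R) a ` P" for p
    using that assms by (auto simp: lub_in_def intro!: scaleR_left_mono)
  fix u assume u: "u \<in> E" "\<forall>p\<in>(*\<^sub>R) a ` P. p \<le> u"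
  have "p \<le> inverse a *\<^sub>R u" if "p \<in> P" for p
    using u(2) that assms(2) by (simp add: pos_le_divideR_eq)
  then have "f \<le> inverse a *\<^sub>R u"
    using assms(1) u(1) by (simp add: lub_in_def)
  then show "a *\<^sub>R f \<le> u"
    using assms(2) by (simp add: pos_le_divideR_eq)
qed

end

lemma directed_scaleR:
  fixes P :: "'v::ordered_real_vector set"
  assumes "directed P" "0 \<le> a"
  shows "directed ((*\<^sub>R) a ` P)"
  using assms unfolding directed_def
  by (auto) (meson scaleR_left_mono)

locale normed_sublattice = linear_sublattice E for E :: "'v::real_vector_lattice set" +
  fixes N :: "'v \<Rightarrow> real"
  assumes norm_eq_0: "x \<in> E \<Longrightarrow> N x = 0 \<longleftrightarrow> x = 0"
    and norm_scaleR: "x \<in> E \<Longrightarrow> N (a *\<^sub>R x) = \<bar>a\<bar> * N x"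
    and norm_add: "x \<in> E \<Longrightarrow> y \<in> E \<Longrightarrow> N (x + y) \<le> N x + N y"
    and norm_solid: "x \<in> E \<Longrightarrow> y \<in> E \<Longrightarrow> \<bar>x\<bar> \<le> \<bar>y\<bar> \<Longrightarrow> N x \<le> N y"
begin

lemma norm_0 [simp]: "N 0 = 0"
  using norm_eq_0[of 0] by simp

lemma norm_minus: "x \<in> E \<Longrightarrow> N (- x) = N x"
  using norm_scaleR[of x "- 1"] by simp

lemma norm_nonneg: "x \<in> E \<Longrightarrow> 0 \<le> N x"
  using norm_add[of x "- x"] by (simp add: norm_minus)

lemma norm_mono: "\<lbrakk>0 \<le> x; x \<le> y; x \<in> E; y \<in> E\<rbrakk> \<Longrightarrow> N x \<le> N y"
  by (rule norm_solid) (auto intro: order_trans)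

lemma norm_abs: "x \<in> E \<Longrightarrow> N \<bar>x\<bar> = N x"
  by (rule antisym; rule norm_solid) auto

lemma norm_sum: "(\<And>i. i \<in> I \<Longrightarrow> f i \<in> E) \<Longrightarrow> N (sum f I) \<le> (\<Sum>i\<in>I. N (f i))"
proof (induction I rule: infinite_finite_induct)
  case (insert i I)
  then have "N (f i + sum f I) \<le> N (f i) + N (sum f I)"
    by (intro norm_add sum_mem) auto
  with insert show ?case by force
qed auto

text \<open>The norm of \<open>n *\<^sub>R w\<close> is \<open>n\<close> times that of
  \<open>w\<close>, so a common bound forces \<open>N w = 0\<close>. In the applications the
  multiples lie below a fixed element or inside one cut.\<close>

lemma archimedean:
  assumes "0 \<le> w" "w \<in> E" "\<And>n::nat. n *\<^sub>R w \<in> E \<Longrightarrow> N (n *\<^sub>R w) \<le> b"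
  shows "w = 0"
proof (rule ccontr)
  assume "w \<noteq> 0"
  then have "N w > 0" using norm_nonneg[of w] norm_eq_0[of w] assms by simp
  then obtain n :: nat where "b < n * N w"
    using reals_Archimedean3 by blast
  moreover have "n * N w \<le> b" using assms(3)[of n] assms(2) by (simp add: norm_scaleR)
  ultimately show False by simp
qed

text \<open>Homogeneity turns the condition on the unit ball into an estimate that is linear in the
  norm bound \<open>c\<close>. For \<open>c = 0\<close>, where division by \<open>c\<close> is
  impossible, \<open>P\<close> contains only zero.\<close>

lemma demicontinuous_onE:
  assumes "demicontinuous_on E N"
  obtains r where "1 \<le> r"
    "\<And>P f c. \<lbrakk>P \<subseteq> E; \<And>p. p \<in> P \<Longrightarrow> 0 \<le> p \<and> N p \<le> c; directed P; lub_in E P f\<rbrakk> \<Longrightarrow> N f \<le> r * c"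
proof -
  obtain r where r: "1 \<le> r"
    "\<And>P f. \<lbrakk>P \<subseteq> positive_ball E N; directed P; lub_in E P f\<rbrakk> \<Longrightarrow> N f \<le> r"
    using assms by (auto simp: demicontinuous_on_def)
  show ?thesis
  proof (rule that[OF r(1)])
    fix P f c
    assume P: "P \<subseteq> E" "\<And>p. p \<in> P \<Longrightarrow> 0 \<le> p \<and> N p \<le> c" "directed P" "lub_in E P f"
    from P(3) obtain q where q: "q \<in> P" by (auto simp: directed_def)
    then have "0 \<le> c" using P(1,2)[of ] norm_nonneg[of q] by force
    then consider "c = 0" | "c > 0" by force
    then show "N f \<le> r * c"
    proof cases
      case 1
      have "p = 0" if "p \<in> P" for p
        using P(1,2) that norm_nonneg[of p] norm_eq_0[of p] 1 by force
      then have "f = 0"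
        using P(4) q unfolding lub_in_def by (metis order.antisym order.refl zero_mem)
      then show ?thesis using 1 by simp
    next
      case 2
      have "N (inverse c *\<^sub>R f) \<le> r"
      proof (rule r(2))
        show "(*\<^sub>R) (inverse c) ` P \<subseteq> positive_ball E N"
          using P(1,2) 2 by (auto simp: positive_ball_def norm_scaleR scaleR_nonneg_nonneg
              field_simps subset_iff)
      qed (use P 2 in \<open>auto intro: directed_scaleR lub_in_scaleR\<close>)
      then show ?thesis using 2 P(4)
        by (simp add: norm_scaleR lub_in_def field_simps)
    qed
  qed
qed

lemma monotonically_complete_onE:
  assumes "monotonically_complete_on E N" "P \<subseteq> E" "\<And>p. p \<in> P \<Longrightarrow> 0 \<le> p \<and> N p \<le> c" "directed P"
  obtains f where "lub_in E P f"
proof -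
  \<comment> \<open>Scaling into the unit ball needs a divisor that is positive as well as at least
    \<open>c\<close>.\<close>
  define d where "d = max 1 c"
  have d: "d > 0" "c \<le> d" by (auto simp: d_def)
  have "(*\<^sub>R) (inverse d) ` P \<subseteq> positive_ball E N"
    using assms(2,3) d by (force simp: positive_ball_def norm_scaleR scaleR_nonneg_nonneg
      field_simps subset_iff)
  moreover have "directed ((*\<^sub>R) (inverse d) ` P)"
    using assms(4) d by (simp add: directed_scaleR)
  ultimately obtain f where "lub_in E ((*\<^sub>R) (inverse d) ` P) f"
    using assms(1) unfolding monotonically_complete_on_def by blast
  from lub_in_scaleR[OF this d(1)] d(1) have "lub_in E P (d *\<^sub>R f)"
    by (simp add: image_image)
  then show ?thesis by (rule that)
qed

text \<open>
  Amemiya's argument: if the suprema of directed subsets \<open>P k\<close> of the unit ball were unbounded in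
  norm, all of them would lie below multiples of the supremum of the sums
  \<open>\<Sum>k<n. 2\<^sup>-\<^sup>k\<^sup>-\<^sup>1 p k\<close> with \<open>p k \<in> P k\<close>.
\<close>

lemma monotonically_complete_imp_demicontinuous:
  assumes "monotonically_complete_on E N"
  shows "demicontinuous_on E N"
proof (rule ccontr)
  assume "\<not> demicontinuous_on E N"
  \<comment> \<open>The summand 1 makes the threshold admissible as a constant \<open>r\<close>. The
    term \<open>k * 2 ^ k\<close> outgrows the factor \<open>2 ^ Suc k\<close> that is lost when
    elements of \<open>P k\<close> are bounded by the weighted series.\<close>
  then have "\<exists>P f. P \<subseteq> positive_ball E N \<and> directed P \<and> lub_in E P f \<and> \<not> N f \<le> 1 + real k * 2 ^ k"
    for k :: nat
  proof -
    have "1 \<le> 1 + real k * 2 ^ k" by simp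
    with \<open>\<not> demicontinuous_on E N\<close> show ?thesis unfolding demicontinuous_on_def by blast
  qed
  then obtain P f where P: "\<And>k. P k \<subseteq> positive_ball E N" "\<And>k. directed (P k)"
    "\<And>k. lub_in E (P k) (f k)" "\<And>k::nat. N (f k) > 1 + real k * 2 ^ k"
    unfolding not_le by metis
  define t where "t = (\<lambda>(n::nat) p. \<Sum>k<n. (1/2) ^ Suc k *\<^sub>R (p k :: 'v))"
  define Q where "Q = {t n p | n p. \<forall>k. p k \<in> P k}"
  have mem: "p k \<in> E" "0 \<le> p k" "N (p k) \<le> 1" if "\<forall>k. p k \<in> P k" for p k
    using that P(1) by (auto simp: positive_ball_def)
  have t_mem: "t n p \<in> E" if "\<forall>k. p k \<in> P k" for n p
    using mem[OF that] by (auto simp: t_def intro!: sum_mem)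
  have t_mono: "t m p \<le> t n q" if "m \<le> n" "\<forall>k. p k \<in> P k" "\<forall>k. q k \<in> P k" "\<And>k. p k \<le> q k"
    for m n p q
  proof -
    have "t m p \<le> t m q"
      unfolding t_def by (intro sum_mono scaleR_left_mono that) auto
    also have "\<dots> \<le> t n q"
      unfolding t_def using that mem(2)[OF that(3)]
      by (intro sum_mono2) (auto intro!: scaleR_nonneg_nonneg)
    finally show ?thesis .
  qed
  have "N x \<le> 1" if x: "x \<in> Q" for x
  proof -
    obtain n p where np: "x = t n p" "\<forall>k. p k \<in> P k" using x by (auto simp: Q_def)
    have "N (t n p) \<le> (\<Sum>k<n. N ((1/2) ^ Suc k *\<^sub>R p k))"
      unfolding t_def using mem[OF np(2)] by (intro norm_sum) auto
    also have "\<dots> \<le> (\<Sum>k<n. (1/2) ^ Suc k)"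
      using mem[OF np(2)] by (intro sum_mono) (auto simp: norm_scaleR)
    also have "\<dots> = 1 - (1/2) ^ n"
      by (induction n) auto
    also have "\<dots> \<le> 1" by simp
    finally show ?thesis using np by simp
  qed
  then have 1: "Q \<subseteq> positive_ball E N"
    using t_mem mem(2) by (auto simp: Q_def positive_ball_def t_def
      intro!: sum_nonneg scaleR_nonneg_nonneg)
  have nonempty: "\<exists>p. p \<in> P k" for k
    using P(2)[of k] unfolding directed_def by blast
  have 2: "directed Q"
    unfolding directed_def
  proof (intro conjI ballI)
    show "Q \<noteq> {}" unfolding Q_def using nonempty by simp metis
    fix x y assume "x \<in> Q" "y \<in> Q"
    then obtain m p n q where *: "x = t m p" "\<forall>k. p k \<in> P k" "y = t n q" "\<forall>k. q k \<in> P k"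
      by (auto simp: Q_def)
    have "\<exists>z. z \<in> P k \<and> p k \<le> z \<and> q k \<le> z" for k
      using *(2,4) P(2)[of k] unfolding directed_def by blast
    then obtain s where s: "\<And>k. s k \<in> P k \<and> p k \<le> s k \<and> q k \<le> s k" by metis
    show "\<exists>z\<in>Q. x \<le> z \<and> y \<le> z"
    proof (intro bexI conjI)
      show "t (max m n) s \<in> Q" using s by (auto simp: Q_def)
      show "x \<le> t (max m n) s" "y \<le> t (max m n) s"
        unfolding * by (rule t_mono; use s * in auto)+
    qed
  qed
  obtain g where g: "lub_in E Q g"
    using assms 1 2 unfolding monotonically_complete_on_def by blast
  have "k < 2 * N g" for k :: nat
  proof -
    obtain q where q: "\<forall>k. q k \<in> P k"
      using nonempty by metis
    have "p \<le> (2 ^ Suc k) *\<^sub>R g" if p: "p \<in> P k" for p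
    proof -
      \<comment> \<open>Only the entry at \<open>k\<close> of a selection is replaced by
        \<open>p\<close>; the partial sum that ends at \<open>k\<close> then contains the term with
        \<open>p\<close>, and its other terms are nonnegative.\<close>
      define q' where "q' = q(k := p)"
      have q': "\<forall>k. q' k \<in> P k" using q p by (auto simp: q'_def)
      have "(1/2) ^ Suc k *\<^sub>R q' k \<le> t (Suc k) q'"
        unfolding t_def using mem[OF q']
        unfolding sum.lessThan_Suc by (intro add_increasing sum_nonneg) (auto intro!: scaleR_nonneg_nonneg)
      also have "\<dots> \<le> g"
        using g q' by (auto simp: lub_in_def Q_def)
      finally have "2 ^ Suc k *\<^sub>R (1/2) ^ Suc k *\<^sub>R p \<le> 2 ^ Suc k *\<^sub>R g"
        by (intro scaleR_left_mono) (auto simp: q'_def)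
      then show ?thesis by (simp add: field_simps)
    qed
    then have "f k \<le> (2 ^ Suc k) *\<^sub>R g"
      using P(3)[of k] g by (auto simp: lub_in_def)
    moreover have "0 \<le> f k" "f k \<in> E"
      using P(3)[of k] mem[OF q, of k] q by (auto simp: lub_in_def intro: order_trans)
    ultimately have "N (f k) \<le> 2 ^ Suc k * N g"
      using norm_mono[of "f k" "(2 ^ Suc k) *\<^sub>R g"] g by (simp add: lub_in_def norm_scaleR)
    moreover have "2 ^ k * real k < N (f k)"
      using P(4)[of k] by (simp add: mult.commute)
    moreover have "2 ^ Suc k * N g = 2 ^ k * (2 * N g)" by simp
    ultimately have "2 ^ k * real k < 2 ^ k * (2 * N g)"
      by (metis order_less_le_trans)
    then show ?thesis by simp
  qed
  moreover obtain k :: nat where "2 * N g < k" using reals_Archimedean2 by blast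
  ultimately show False by (meson less_asym)
qed

text \<open>The weights give a rate: a term of index at least \<open>n\<close> is at most
  \<open>(1/2) ^ n\<close> times its weighted version, so the tail from \<open>n\<close> on lies
  below \<open>(1/2) ^ n *\<^sub>R t\<close>. With this regulator the order limit supplied by
  monotone completeness is also a norm limit.\<close>

lemma weighted_series_converges:
  assumes mc: "monotonically_complete_on E N"
    and b: "\<And>k. b k \<in> E" "\<And>k. 0 \<le> b k" and t: "t \<in> E" "\<And>n. (\<Sum>k<n. 2 ^ k *\<^sub>R b k) \<le> t"
  obtains s where "s \<in> E" "\<And>n. (\<Sum>k<n. b k) \<le> s" "\<And>n. s - (\<Sum>k<n. b k) \<le> (1/2) ^ n *\<^sub>R t"
proof -
  define S where "S n = (\<Sum>k<n. b k)" for n :: nat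
  have S: "S n \<in> E" "0 \<le> S n" for n
    using b by (auto simp: S_def intro: sum_mem sum_nonneg)
  have mono: "S m \<le> S n" if "m \<le> n" for m n
    unfolding S_def using that b by (intro sum_mono2) auto
  have tail: "S m \<le> S n + (1/2) ^ n *\<^sub>R t" for m n
  proof (cases "m \<le> n")
    case True
    have "0 \<le> t" using t(2)[of 0] by simp
    then show ?thesis using mono[OF True] by (simp add: add_increasing2 scaleR_nonneg_nonneg)
  next
    case False
    have "S m = S n + (\<Sum>k\<in>{n..<m}. b k)"
      using False by (simp add: S_def lessThan_atLeast0 sum.atLeastLessThan_concat)
    also have "(\<Sum>k\<in>{n..<m}. b k) \<le> (\<Sum>k\<in>{n..<m}. (1/2) ^ n *\<^sub>R 2 ^ k *\<^sub>R b k)"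
    proof (rule sum_mono)
      fix k assume "k \<in> {n..<m}"
      then have "(1::real) \<le> (1/2) ^ n * 2 ^ k"
        by (simp add: power_divide field_simps)
      from scaleR_right_mono[OF this b(2)[of k]] show "b k \<le> (1/2) ^ n *\<^sub>R 2 ^ k *\<^sub>R b k" by simp
    qed
    also have "\<dots> \<le> (\<Sum>k<m. (1/2) ^ n *\<^sub>R 2 ^ k *\<^sub>R b k)"
      using b by (intro sum_mono2) (auto intro!: scaleR_nonneg_nonneg)
    also have "\<dots> = (1/2) ^ n *\<^sub>R (\<Sum>k<m. 2 ^ k *\<^sub>R b k)"
      by (simp add: scaleR_sum_right)
    also have "\<dots> \<le> (1/2) ^ n *\<^sub>R t"
      by (intro scaleR_left_mono t) simp
    finally show ?thesis by simp
  qed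
  have "directed (range S)"
    unfolding directed_def using mono by (auto) (meson nat_le_linear max.cobounded1 max.cobounded2)
  moreover have "0 \<le> p \<and> N p \<le> N t" if "p \<in> range S" for p
    using that S tail[of _ 0] t(1) by (auto intro!: norm_mono simp: S_def)
  ultimately obtain s where "lub_in E (range S) s"
    using monotonically_complete_onE[OF mc] S by (metis image_subsetI)
  then show ?thesis
    using that[of s] tail S t(1) by (auto simp: lub_in_def S_def algebra_simps)
qed

text \<open>Only increasing sums have suprema, so the increments \<open>y k\<close> of a fast
  subsequence are split into positive and negative parts. Increments of norm below
  \<open>(1/4) ^ k\<close> keep the sums of \<open>2 ^ k *\<^sub>R \<bar>y k\<bar>\<close> bounded;
  their supremum \<open>t\<close> serves as regulator for both series, and the limit is assembled
  from the two sums.\<close>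

lemma monotonically_complete_imp_complete:
  fixes x :: "nat \<Rightarrow> 'v"
  assumes mc: "monotonically_complete_on E N"
    and x: "\<And>n. x n \<in> E" "\<And>e. e > 0 \<Longrightarrow> \<exists>M. \<forall>m\<ge>M. \<forall>n\<ge>M. N (x m - x n) < e"
  obtains l where "l \<in> E" "\<And>e. e > 0 \<Longrightarrow> \<exists>M. \<forall>n\<ge>M. N (x n - l) < (e::real)"
proof -
  have "\<exists>M. \<forall>m\<ge>M. \<forall>n\<ge>M. N (x m - x n) < (1/4) ^ k" for k :: nat
    by (rule x(2)) simp
  then obtain M where M: "\<And>k m n. M k \<le> m \<Longrightarrow> M k \<le> n \<Longrightarrow> N (x m - x n) < (1/4) ^ k"
    by metis
  \<comment> \<open>Summing the thresholds gives indices that are nondecreasing and still at least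
    \<open>M k\<close>.\<close>
  define i where "i k = (\<Sum>j\<le>k. M j)" for k :: nat
  have i: "M k \<le> i k" "i k \<le> i (Suc k)" for k
    by (auto simp: i_def intro: member_le_sum)
  define y where "y k = x (i (Suc k)) - x (i k)" for k
  have y: "y k \<in> E" "N (y k) < (1/4) ^ k" for k
    using x(1) M[of k "i (Suc k)" "i k"] i[of k] by (auto simp: y_def)
  define T where "T n = (\<Sum>k<n. 2 ^ k *\<^sub>R \<bar>y k\<bar>)" for n :: nat
  have T: "T n \<in> E" "0 \<le> T n" for n
    using y by (auto simp: T_def intro!: sum_mem sum_nonneg scaleR_nonneg_nonneg)
  have "N (T n) \<le> 2" for n
  proof -
    have "N (T n) \<le> (\<Sum>k<n. N (2 ^ k *\<^sub>R \<bar>y k\<bar>))"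
      unfolding T_def using y by (intro norm_sum) auto
    also have "\<dots> \<le> (\<Sum>k<n. (1/2) ^ k)"
    proof (rule sum_mono)
      fix k assume "k \<in> {..<n}"
      have "2 ^ k * N (y k) \<le> 2 ^ k * (1/4) ^ k"
        using y(2)[of k] by (intro mult_left_mono) auto
      also have "\<dots> = (1/2) ^ k" by (simp flip: power_mult_distrib)
      finally show "N (2 ^ k *\<^sub>R \<bar>y k\<bar>) \<le> (1/2) ^ k" using y by (simp add: norm_scaleR norm_abs)
    qed
    also have "\<dots> = 2 - 2 * (1/2) ^ n"
      by (induction n) auto
    also have "\<dots> \<le> 2" by simp
    finally show ?thesis .
  qed
  then have "0 \<le> p \<and> N p \<le> 2" if "p \<in> range T" for p
    using that T by auto
  moreover have "T m \<le> T n" if "m \<le> n" for m n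
    unfolding T_def using that by (intro sum_mono2) (auto intro!: scaleR_nonneg_nonneg)
  then have "directed (range T)"
    unfolding directed_def by (auto) (meson nat_le_linear)
  ultimately obtain t where "lub_in E (range T) t"
    using monotonically_complete_onE[OF mc] T by (metis image_subsetI)
  then have t: "t \<in> E" "\<And>n. T n \<le> t"
    by (auto simp: lub_in_def)
  have part: "\<exists>s\<in>E. \<forall>n. \<bar>s - (\<Sum>k<n. h (y k))\<bar> \<le> (1/2) ^ n *\<^sub>R t"
    if h: "\<And>v. v \<in> E \<Longrightarrow> h v \<in> E" "\<And>v. 0 \<le> h v" "\<And>v. h v \<le> \<bar>v\<bar>" for h :: "'v \<Rightarrow> 'v"
  proof -
    have "(\<Sum>k<n. 2 ^ k *\<^sub>R h (y k)) \<le> t" for n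
    proof -
      have "(\<Sum>k<n. 2 ^ k *\<^sub>R h (y k)) \<le> T n"
        unfolding T_def by (intro sum_mono scaleR_left_mono h) auto
      then show ?thesis using t(2) order_trans by blast
    qed
    then obtain s where "s \<in> E" "\<And>n. (\<Sum>k<n. h (y k)) \<le> s"
        "\<And>n. s - (\<Sum>k<n. h (y k)) \<le> (1/2) ^ n *\<^sub>R t"
      using weighted_series_converges[OF mc, of "\<lambda>k. h (y k)" t] h y t by metis
    then show ?thesis by (metis abs_of_nonneg diff_ge_0_iff_ge)
  qed
  obtain p where p: "p \<in> E" "\<And>n. \<bar>p - (\<Sum>k<n. pprt (y k))\<bar> \<le> (1/2) ^ n *\<^sub>R t"
    using part[of pprt] by (metis abs_prts zero_le_pprt diff_ge_0_iff_ge nprt_le_zero pprt_mem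
      add_increasing2 neg_0_le_iff_le diff_conv_add_uminus order_refl)
  have neg: "- nprt v \<le> \<bar>v\<bar>" "0 \<le> - nprt v" for v :: 'v
    by (simp_all add: abs_prts)
  obtain q where q: "q \<in> E" "\<And>n. \<bar>q - (\<Sum>k<n. - nprt (y k))\<bar> \<le> (1/2) ^ n *\<^sub>R t"
    using part[of "\<lambda>v. - nprt v"] neg by (metis nprt_mem uminus_mem)
  define l where "l = x (i 0) + p - q"
  have l: "l \<in> E" using x p q by (simp add: l_def)
  have sub: "N (x (i n) - l) \<le> 2 * (1/2) ^ n * N t" for n
  proof -
    have "(\<Sum>k<n. pprt (y k)) - (\<Sum>k<n. - nprt (y k)) = (\<Sum>k<n. y k)"
      by (simp add: sum_negf flip: sum.distrib prts)
    also have "\<dots> = x (i n) - x (i 0)"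
      unfolding y_def by (rule sum_lessThan_telescope)
    finally have "l - x (i n) = (p - (\<Sum>k<n. pprt (y k))) - (q - (\<Sum>k<n. - nprt (y k)))"
      by (simp add: l_def algebra_simps)
    then have "\<bar>l - x (i n)\<bar> \<le> \<bar>p - (\<Sum>k<n. pprt (y k))\<bar> + \<bar>q - (\<Sum>k<n. - nprt (y k))\<bar>"
      by (metis abs_triangle_ineq4)
    also have "\<dots> \<le> (1/2) ^ n *\<^sub>R t + (1/2) ^ n *\<^sub>R t"
      by (intro add_mono p q)
    also have "\<dots> = (2 * (1/2) ^ n) *\<^sub>R t" by (simp add: scaleR_2 flip: scaleR_scaleR)
    finally have "\<bar>x (i n) - l\<bar> \<le> \<bar>(2 * (1/2) ^ n) *\<^sub>R t\<bar>"
      by (simp add: abs_minus_commute) (metis abs_ge_self order_trans)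
    then show ?thesis
      using norm_solid[of "x (i n) - l" "(2 * (1/2) ^ n) *\<^sub>R t"] x l t by (simp add: norm_scaleR)
  qed
  have "\<exists>M. \<forall>n\<ge>M. N (x n - l) < e" if "e > 0" for e :: real
  proof -
    have "(\<lambda>n. 2 * (1/2) ^ n * N t + (1/4) ^ n) \<longlonglongrightarrow> 2 * 0 * N t + 0"
      by (intro tendsto_intros LIMSEQ_power_zero) auto
    then have "\<forall>\<^sub>F n in sequentially. 2 * (1/2) ^ n * N t + (1/4) ^ n < e"
      using that by (auto dest: order_tendstoD)
    then obtain k where k: "2 * (1/2) ^ k * N t + (1/4) ^ k < e"
      by (auto simp: eventually_sequentially)
    have "N (x n - l) < e" if "n \<ge> M k" for n
    proof -
      have "N (x n - l) \<le> N (x n - x (i k)) + N (x (i k) - l)"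
        using norm_add[of "x n - x (i k)" "x (i k) - l"] x l by simp
      also have "\<dots> < (1/4) ^ k + 2 * (1/2) ^ k * N t"
        by (intro add_less_le_mono M sub that i)
      finally show ?thesis using k by simp
    qed
    then show ?thesis by blast
  qed
  then show ?thesis using that l by blast
qed

end

section \<open>Embeddings of vector lattices\<close>

declare neg_inf_eq_sup [simp del] neg_sup_eq_inf [simp del]
  diff_inf_eq_sup [simp del] diff_sup_eq_inf [simp del]

lemma pprt_diff: "pprt (a - b) = a - inf a (b::'v::lattice_ab_group_add)"
  by (simp add: pprt_def add_sup_distrib_left sup_commute diff_inf_eq_sup)

lemma inf_pprt_nprt: "inf (pprt x) (- nprt x) = (0::'v::lattice_ab_group_add)"
  using pprt_diff[of "pprt x" "- nprt x"] by (simp flip: prts)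

lemma sup_eq_add_pprt: "sup x y = y + pprt (x - (y::'v::lattice_ab_group_add))"
  by (simp add: pprt_def add_sup_distrib_left)

text \<open>Infinite distributivity of infima over suprema. It comes from
  \<open>v + p = inf v p + sup v p\<close>, where \<open>sup v p\<close> may be replaced by
  \<open>sup v z\<close>, which no longer depends on \<open>p\<close>.\<close>

lemma inf_lub_le:
  fixes P :: "'v::real_vector_lattice set"
  assumes "linear_sublattice E" "lub_in E P z" "v \<in> E" "u \<in> E" "\<And>p. p \<in> P \<Longrightarrow> inf v p \<le> u"
  shows "inf v z \<le> u"
proof -
  interpret linear_sublattice E by fact
  have z: "z \<in> E" "\<And>p. p \<in> P \<Longrightarrow> p \<le> z"
    using assms(2) by (auto simp: lub_in_def)
  have "p \<le> u + sup v z - v" if "p \<in> P" for p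
  proof -
    have "v + p \<le> u + sup v z"
      unfolding add_eq_inf_sup[of v p] using assms(5)[OF that] z(2)[OF that]
      by (subst add.commute) (intro add_mono sup_mono order_refl)
    then show ?thesis by (simp add: algebra_simps)
  qed
  then have "z \<le> u + sup v z - v"
    using assms z unfolding lub_in_def by simp
  then have "v + z - sup v z \<le> u" by (simp add: algebra_simps)
  then show ?thesis by (simp add: add_eq_inf_sup[of v z])
qed

definition embedding_on ::
    "'v::real_vector_lattice set \<Rightarrow> 'w::real_vector_lattice set \<Rightarrow> ('v \<Rightarrow> 'w) \<Rightarrow> bool"
  where "embedding_on E Y J \<longleftrightarrow>
    (\<forall>x\<in>E. J x \<in> Y) \<and> (\<forall>x\<in>E. \<forall>y\<in>E. J (x + y) = J x + J y) \<and>
    (\<forall>a. \<forall>x\<in>E. J (a *\<^sub>R x) = a *\<^sub>R J x) \<and>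
    (\<forall>x\<in>E. \<forall>y\<in>E. J (sup x y) = sup (J x) (J y)) \<and>
    (\<forall>x\<in>E. \<forall>y\<in>E. J (inf x y) = inf (J x) (J y)) \<and> inj_on J E"

definition order_dense_in :: "'v::{zero,ord} set \<Rightarrow> 'v set \<Rightarrow> bool"
  where "order_dense_in E Y \<longleftrightarrow> (\<forall>y\<in>Y. 0 < y \<longrightarrow> (\<exists>e\<in>E. 0 < e \<and> e \<le> y))"

definition regular_in :: "'v::{zero,ord} set \<Rightarrow> 'v set \<Rightarrow> bool"
  where "regular_in E Y \<longleftrightarrow> (\<forall>P. P \<subseteq> E \<and> P \<noteq> {} \<and> glb_in E P 0 \<longrightarrow> glb_in Y P 0)"

locale embedding = linear_sublattice E + Y: linear_sublattice Y
  for E :: "'v::real_vector_lattice set" and Y :: "'w::real_vector_lattice set" +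
  fixes J :: "'v \<Rightarrow> 'w"
  assumes embedding_on: "embedding_on E Y J"
begin

lemma emb_mem [simp]: "x \<in> E \<Longrightarrow> J x \<in> Y"
  and emb_add: "x \<in> E \<Longrightarrow> y \<in> E \<Longrightarrow> J (x + y) = J x + J y"
  and emb_scaleR: "x \<in> E \<Longrightarrow> J (a *\<^sub>R x) = a *\<^sub>R J x"
  and emb_sup: "x \<in> E \<Longrightarrow> y \<in> E \<Longrightarrow> J (sup x y) = sup (J x) (J y)"
  and emb_inf: "x \<in> E \<Longrightarrow> y \<in> E \<Longrightarrow> J (inf x y) = inf (J x) (J y)"
  and emb_inj: "inj_on J E"
  using embedding_on by (auto simp: embedding_on_def)

lemma emb_0 [simp]: "J 0 = 0"
  using emb_scaleR[of 0 0] by simp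

lemma emb_minus: "x \<in> E \<Longrightarrow> J (- x) = - J x"
  using emb_scaleR[of x "- 1"] by simp

lemma emb_diff: "x \<in> E \<Longrightarrow> y \<in> E \<Longrightarrow> J (x - y) = J x - J y"
  using emb_add[of x "- y"] by (simp add: emb_minus)

lemma emb_le_iff: "x \<in> E \<Longrightarrow> y \<in> E \<Longrightarrow> J x \<le> J y \<longleftrightarrow> x \<le> y"
  using emb_inj by (simp add: le_iff_sup inj_on_eq_iff flip: emb_sup)

lemma emb_nonneg_iff: "x \<in> E \<Longrightarrow> 0 \<le> J x \<longleftrightarrow> 0 \<le> x"
  using emb_le_iff[of 0 x] by simp

lemma emb_abs: "x \<in> E \<Longrightarrow> J \<bar>x\<bar> = \<bar>J x\<bar>"
  by (simp add: abs_lattice emb_sup emb_minus)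

text \<open>Regularity speaks only of infima equal to zero, so \<open>P\<close> is reflected: the
  elements \<open>f - p\<close> have infimum zero in \<open>E\<close>, and an upper bound
  \<open>u\<close> of the image of \<open>P\<close> becomes the lower bound \<open>J f - u\<close>
  of the reflected set.\<close>

lemma regular_lub:
  assumes "regular_in (J ` E) Y" "P \<subseteq> E" "P \<noteq> {}" "lub_in E P f"
  shows "lub_in Y (J ` P) (J f)"
proof -
  have f: "f \<in> E" "\<And>p. p \<in> P \<Longrightarrow> p \<le> f"
    "\<And>u. u \<in> E \<Longrightarrow> (\<And>p. p \<in> P \<Longrightarrow> p \<le> u) \<Longrightarrow> f \<le> u"
    using assms(4) by (auto simp: lub_in_def)
  let ?D = "(\<lambda>p. J (f - p)) ` P"
  have "glb_in (J ` E) ?D 0"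
    unfolding glb_in_def
  proof (intro conjI ballI impI)
    show "0 \<in> J ` E" using emb_0 zero_mem by (metis imageI)
    show "0 \<le> p" if "p \<in> ?D" for p
      using that f assms(2) by (auto simp: emb_nonneg_iff subset_iff)
    fix u assume "u \<in> J ` E" and u: "\<forall>p\<in>?D. u \<le> p"
    then obtain e where e: "e \<in> E" "u = J e" by auto
    have "f \<le> f - e"
    proof (rule f(3))
      show "p \<le> f - e" if "p \<in> P" for p
      proof -
        have "J e \<le> J (f - p)" using that u e by auto
        then have "e \<le> f - p"
          using that e f assms(2) by (simp add: emb_le_iff subset_iff)
        then show ?thesis by (simp add: algebra_simps)
      qed
    qed (use e f in auto)
    then have "e \<le> 0" by simp
    then show "u \<le> 0" using e emb_le_iff[of e 0] by simp
  qed
  moreover have "?D \<subseteq> J ` E" using assms(2) f by auto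
  ultimately have g: "glb_in Y ?D 0"
    using assms(1,3) unfolding regular_in_def by blast
  show ?thesis
    unfolding lub_in_def
  proof (intro conjI ballI impI)
    show "J f \<in> Y" using f by simp
    show "p \<le> J f" if "p \<in> J ` P" for p
      using that f assms(2) by (auto simp: emb_le_iff subset_iff)
    fix u assume u: "u \<in> Y" "\<forall>p\<in>J ` P. p \<le> u"
    have "J f - u \<le> p" if "p \<in> ?D" for p
      using that u f assms(2) by (auto simp: emb_diff subset_iff)
    moreover have "J f - u \<in> Y" using u f by simp
    ultimately have "J f - u \<le> 0"
      using g unfolding glb_in_def by blast
    then show "J f \<le> u" by simp
  qed
qed

end

text \<open>A lower bound \<open>u\<close> of \<open>P\<close> that is not below zero has a nonzero
  positive part, which still bounds \<open>P\<close> from below. An element of \<open>E\<close>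
  under this part contradicts the infimum taken in \<open>E\<close>.\<close>

lemma order_dense_imp_regular:
  fixes Y :: "'v::real_vector_lattice set"
  assumes "linear_sublattice Y" "E \<subseteq> Y" "order_dense_in E Y"
  shows "regular_in E Y"
  unfolding regular_in_def
proof (intro allI impI, elim conjE)
  interpret linear_sublattice Y by fact
  fix P assume P: "P \<subseteq> E" "P \<noteq> {}" "glb_in E P 0"
  then have nn: "0 \<le> p" if "p \<in> P" for p using that by (auto simp: glb_in_def)
  have "u \<le> 0" if u: "u \<in> Y" "\<forall>p\<in>P. u \<le> p" for u
  proof (rule ccontr)
    assume "\<not> u \<le> 0"
    then have "0 < pprt u" by (auto simp: order.strict_iff_order le_zero_iff_zero_pprt)
    moreover have "pprt u \<in> Y" using u by simp
    ultimately obtain e where e: "e \<in> E" "0 < e" "e \<le> pprt u"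
      using assms(3) unfolding order_dense_in_def by blast
    have "e \<le> p" if "p \<in> P" for p
    proof -
      have "pprt u \<le> p" unfolding pprt_def using u nn that by simp
      with e(3) show ?thesis by (rule order_trans)
    qed
    then have "e \<le> 0" using P e by (auto simp: glb_in_def)
    then show False using e by simp
  qed
  then show "glb_in Y P 0" using nn by (auto simp: glb_in_def)
qed

text \<open>A directed set in the unit ball of \<open>E\<close> is moved to \<open>Y\<close>, where
  regularity preserves its supremum, and the estimate valid in \<open>Y\<close> is pulled back. The
  distortion of the embedding turns the constant \<open>r\<close> of \<open>Y\<close> into
  \<open>r * C' / c\<close>.\<close>

lemma regular_imp_demicontinuous_on:
  assumes "normed_sublattice E N" "normed_sublattice Y M" "embedding_on E Y J"
    and "regular_in (J ` E) Y" "monotonically_complete_on Y M"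
    and C: "\<And>x. x \<in> E \<Longrightarrow> M (J x) \<le> C * N x" and c: "0 < c" "\<And>x. x \<in> E \<Longrightarrow> c * N x \<le> M (J x)"
  shows "demicontinuous_on E N"
proof -
  interpret E: normed_sublattice E N by fact
  interpret Y: normed_sublattice Y M by fact
  interpret embedding E Y J by unfold_locales fact
  have "demicontinuous_on Y M"
    using assms by (intro Y.monotonically_complete_imp_demicontinuous)
  then obtain r where r: "1 \<le> r" "\<And>P f c. \<lbrakk>P \<subseteq> Y; \<And>p. p \<in> P \<Longrightarrow> 0 \<le> p \<and> M p \<le> c;
      directed P; lub_in Y P f\<rbrakk> \<Longrightarrow> M f \<le> r * c"
    by (rule Y.demicontinuous_onE) blast
  \<comment> \<open>A negative \<open>C\<close> is possible when \<open>E\<close> is the zero space;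
    the products below need a nonnegative factor.\<close>
  define C' where "C' = max 0 C"
  have C': "M (J x) \<le> C'" if "x \<in> E" "N x \<le> 1" for x
  proof -
    have "M (J x) \<le> C' * N x"
      using C[OF that(1)] E.norm_nonneg[OF that(1)] mult_right_mono[of C C' "N x"]
      by (simp add: C'_def)
    also have "\<dots> \<le> C' * 1"
      using that by (intro mult_left_mono) (auto simp: C'_def)
    finally show ?thesis by simp
  qed
  show ?thesis
    unfolding demicontinuous_on_def
  proof (intro exI[of _ "max 1 (r * C' / c)"] conjI allI impI; (elim conjE)?)
    fix P f assume P: "P \<subseteq> positive_ball E N" "directed P" "lub_in E P f"
    have PE: "P \<subseteq> E" "P \<noteq> {}" "\<And>p. p \<in> P \<Longrightarrow> 0 \<le> p \<and> N p \<le> 1"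
      using P by (auto simp: positive_ball_def directed_def)
    have f: "f \<in> E" using P by (simp add: lub_in_def)
    have "M (J f) \<le> r * C'"
    proof (rule r(2))
      show "lub_in Y (J ` P) (J f)" using regular_lub assms PE P by blast
      show "directed (J ` P)"
        using P(2) PE(1) unfolding directed_def by (simp add: emb_le_iff subset_iff)
    qed (use PE C' in \<open>auto simp: emb_nonneg_iff subset_iff\<close>)
    then have "c * N f \<le> r * C'" using c(2)[OF f] by linarith
    then have "N f \<le> r * C' / c" using c(1) by (simp add: field_simps)
    then show "N f \<le> max 1 (r * C' / c)" by simp
  qed simp
qed

text \<open>The lattice operations reduce to positive parts, hence to disjointness of the images of
  \<open>pprt x\<close> and \<open>- nprt x\<close>. A nonzero infimum of these would have some
  \<open>S e\<close> with \<open>0 < S e\<close> under it, and reflecting positivity gives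
  \<open>e \<le> inf (pprt x) (- nprt x) = 0\<close>.\<close>

lemma embedding_on_if_nonneg_iff:
  fixes S :: "'v::real_vector_lattice \<Rightarrow> 'w::real_vector_lattice"
  assumes "linear_sublattice E" "linear_sublattice Y"
    and S: "\<And>x. x \<in> E \<Longrightarrow> S x \<in> Y" "\<And>x y. x \<in> E \<Longrightarrow> y \<in> E \<Longrightarrow> S (x + y) = S x + S y"
      "\<And>a x. x \<in> E \<Longrightarrow> S (a *\<^sub>R x) = a *\<^sub>R S x" "\<And>x. x \<in> E \<Longrightarrow> 0 \<le> S x \<longleftrightarrow> 0 \<le> x"
    and dense: "order_dense_in (S ` E) Y"
  shows "embedding_on E Y S"
proof -
  interpret linear_sublattice E by fact
  interpret Y: linear_sublattice Y by fact
  have neg: "S (- x) = - S x" if "x \<in> E" for x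
    using S(3)[of x "- 1"] that by simp
  have diff: "S (x - y) = S x - S y" if "x \<in> E" "y \<in> E" for x y
    using S(2)[of x "- y"] neg that by simp
  have le: "S x \<le> S y \<longleftrightarrow> x \<le> y" if "x \<in> E" "y \<in> E" for x y
    using S(4)[of "y - x"] diff that by simp
  have disj: "inf (S (pprt x)) (S (- nprt x)) = 0" if x: "x \<in> E" for x
  proof (rule ccontr)
    let ?w = "inf (S (pprt x)) (S (- nprt x))"
    assume "?w \<noteq> 0"
    moreover have "0 \<le> ?w" "?w \<in> Y" using S(1,4) x by simp_all
    ultimately have "0 < ?w" by (metis order.not_eq_order_implies_strict)
    then obtain e where e: "e \<in> E" "0 < S e" "S e \<le> ?w"
      using dense \<open>?w \<in> Y\<close> unfolding order_dense_in_def by blast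
    then have "e \<le> pprt x" "e \<le> - nprt x"
      using x by (auto simp flip: le)
    then have "e \<le> 0" by (metis inf_pprt_nprt le_inf_iff)
    then have "S e \<le> S 0" using e le by simp
    moreover have "S 0 = 0" using S(3)[of 0 0] by simp
    ultimately show False using e(2) by simp
  qed
  have pprt: "S (pprt x) = pprt (S x)" if x: "x \<in> E" for x
  proof -
    have "S x = S (pprt x) - S (- nprt x)"
      using diff[of "pprt x" "- nprt x"] prts[of x] x by simp
    then show ?thesis using pprt_diff[of "S (pprt x)" "S (- nprt x)"] disj[OF x] by simp
  qed
  have sup: "S (sup x y) = sup (S x) (S y)" if "x \<in> E" "y \<in> E" for x y
    using that by (simp add: sup_eq_add_pprt S(2) pprt diff)
  have inf: "S (inf x y) = inf (S x) (S y)" if "x \<in> E" "y \<in> E" for x y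
    using that by (simp add: inf_eq_neg_sup neg sup)
  have "inj_on S E"
    by (rule inj_onI) (metis le order.antisym order.refl)
  then show ?thesis using S sup inf by (auto simp: embedding_on_def)
qed

definition linear_extension ::
    "('v::lattice_ab_group_add \<Rightarrow> 'w::ab_group_add) \<Rightarrow> 'v \<Rightarrow> 'w"
  where "linear_extension s x = s (pprt x) - s (- nprt x)"

text \<open>This is Kantorovich's extension of an additive, positively homogeneous map from the
  positive cone. Linearity flows from the last claim: the value does not depend on how an element is
  written as a difference of positive ones.\<close>

lemma linear_extension:
  fixes s :: "'v::real_vector_lattice \<Rightarrow> 'w::real_vector_lattice"
  assumes "linear_sublattice E" "linear_sublattice Y"
    and s: "\<And>x. x \<in> E \<Longrightarrow> 0 \<le> x \<Longrightarrow> s x \<in> Y"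
      "\<And>x y. \<lbrakk>x \<in> E; y \<in> E; 0 \<le> x; 0 \<le> y\<rbrakk> \<Longrightarrow> s (x + y) = s x + s y"
      "\<And>a x. x \<in> E \<Longrightarrow> 0 \<le> x \<Longrightarrow> 0 \<le> a \<Longrightarrow> s (a *\<^sub>R x) = a *\<^sub>R s x"
  shows "x \<in> E \<Longrightarrow> linear_extension s x \<in> Y"
    and "\<lbrakk>x \<in> E; y \<in> E\<rbrakk> \<Longrightarrow> linear_extension s (x + y) = linear_extension s x + linear_extension s y"
    and "x \<in> E \<Longrightarrow> linear_extension s (a *\<^sub>R x) = a *\<^sub>R linear_extension s x"
    and "\<lbrakk>x \<in> E; 0 \<le> x\<rbrakk> \<Longrightarrow> linear_extension s x = s x"
    and "\<lbrakk>x \<in> E; y \<in> E; 0 \<le> x; 0 \<le> y\<rbrakk> \<Longrightarrow> linear_extension s (x - y) = s x - s y"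
proof -
  interpret linear_sublattice E by fact
  interpret Y: linear_sublattice Y by fact
  let ?S = "linear_extension s"
  have [simp]: "0 \<le> - nprt x" for x :: 'v by simp
  show mem: "?S x \<in> Y" if "x \<in> E" for x
    using that s(1) by (simp add: linear_extension_def)
  have s0: "s 0 = 0" using s(2)[of 0 0] by simp
  show "?S x = s x" if "x \<in> E" "0 \<le> x" for x
    using that s0 by (simp add: linear_extension_def)
  show diff: "?S (x - y) = s x - s y" if "x \<in> E" "y \<in> E" "0 \<le> x" "0 \<le> y" for x y
  proof -
    \<comment> \<open>Written without subtraction, the comparison of the two decompositions stays in
      the positive cone, where \<open>s\<close> is additive.\<close>
    have "pprt (x - y) + y = x + (- nprt (x - y))"
      using prts[of "x - y"] by (simp add: algebra_simps)
    then have "s (pprt (x - y)) + s y = s x + s (- nprt (x - y))"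
      using that by (simp flip: s(2))
    then show ?thesis by (simp add: linear_extension_def algebra_simps)
  qed
  define n :: "'v \<Rightarrow> 'v" where "n x = - nprt x" for x
  have n: "0 \<le> n x" "x \<in> E \<Longrightarrow> n x \<in> E" for x by (simp_all add: n_def)
  have rep: "pprt x - n x = x" for x by (simp add: n_def flip: prts)
  have S_eq: "?S x = s (pprt x) - s (n x)" for x by (simp add: linear_extension_def n_def)
  show "?S (x + y) = ?S x + ?S y" if "x \<in> E" "y \<in> E" for x y
  proof -
    have "?S (x + y) = ?S ((pprt x + pprt y) - (n x + n y))"
      using rep[of x] rep[of y] by (simp add: algebra_simps)
    also have "\<dots> = s (pprt x + pprt y) - s (n x + n y)"
      using that n by (intro diff) simp_all
    also have "\<dots> = ?S x + ?S y"
      using that n by (simp add: s(2) S_eq)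
    finally show ?thesis .
  qed
  show "?S (a *\<^sub>R x) = a *\<^sub>R ?S x" if "x \<in> E" for a x
  proof (cases "0 \<le> a")
    case True
    have "?S (a *\<^sub>R x) = ?S (a *\<^sub>R pprt x - a *\<^sub>R n x)"
      using rep[of x] by (simp flip: scaleR_diff_right)
    also have "\<dots> = s (a *\<^sub>R pprt x) - s (a *\<^sub>R n x)"
      using that n True by (intro diff) (simp_all add: scaleR_nonneg_nonneg)
    also have "\<dots> = a *\<^sub>R ?S x"
      using that n True by (simp add: s(3) S_eq scaleR_diff_right)
    finally show ?thesis .
  next
    case False
    then have a: "0 \<le> - a" by simp
    have "?S (a *\<^sub>R x) = ?S ((- a) *\<^sub>R n x - (- a) *\<^sub>R pprt x)"
      using rep[of x] by (simp flip: scaleR_diff_right)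
    also have "\<dots> = s ((- a) *\<^sub>R n x) - s ((- a) *\<^sub>R pprt x)"
      using that n a by (intro diff scaleR_mem scaleR_nonneg_nonneg) simp_all
    also have "\<dots> = (- a) *\<^sub>R s (n x) - (- a) *\<^sub>R s (pprt x)"
      using that n a by (simp only: s(3) pprt_mem zero_le_pprt)
    also have "\<dots> = a *\<^sub>R ?S x"
      by (simp add: S_eq scaleR_diff_right)
    finally show ?thesis .
  qed
qed

context normed_sublattice
begin

text \<open>If an upper bound \<open>u\<close> missed \<open>y\<close>, some nonzero positive
  \<open>e\<close> in \<open>D\<close> would lie under \<open>pprt (y - u)\<close>. All multiples of
  \<open>e\<close> would then lie below \<open>y\<close>, against the Archimedean property.\<close>

lemma lub_of_order_dense:
  assumes "linear_sublattice D" "D \<subseteq> E" "order_dense_in D E" and y: "y \<in> E" "0 \<le> y"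
  shows "lub_in E {e \<in> D. 0 \<le> e \<and> e \<le> y} y"
  unfolding lub_in_def
proof (intro conjI ballI impI)
  interpret D: linear_sublattice D by fact
  fix u assume u: "u \<in> E" "\<forall>p\<in>{e \<in> D. 0 \<le> e \<and> e \<le> y}. p \<le> u"
  show "y \<le> u"
  proof (rule ccontr)
    assume "\<not> y \<le> u"
    then have "\<not> y - u \<le> 0" by simp
    then have "0 < pprt (y - u)" by (auto simp: order.strict_iff_order le_zero_iff_zero_pprt)
    moreover have "pprt (y - u) \<in> E" using u y by simp
    ultimately obtain e where e: "e \<in> D" "0 < e" "e \<le> pprt (y - u)"
      using assms(3) unfolding order_dense_in_def by blast
    \<comment> \<open>A multiple of \<open>e\<close> below \<open>y\<close> is one of the elements
      bounded by \<open>u\<close>, hence lies below \<open>inf y u\<close>. Since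
      \<open>inf y u + pprt (y - u) = y\<close>, there is room for one more
      \<open>e\<close>.\<close>
    have "n *\<^sub>R e \<le> y" for n :: nat
    proof (induction n)
      case (Suc n)
      then have "n *\<^sub>R e \<le> u"
        using u e by (simp add: scaleR_nonneg_nonneg)
      with Suc have "n *\<^sub>R e \<le> inf y u" by simp
      then have "n *\<^sub>R e + e \<le> inf y u + pprt (y - u)"
        using e by (intro add_mono)
      then show ?case by (simp add: pprt_diff algebra_simps)
    qed (use y in simp)
    then have "e = 0"
      using e assms(2) y
      by (intro archimedean[of e "N y"]) (auto intro!: norm_mono scaleR_nonneg_nonneg)
    then show False using e by simp
  qed
qed (use y in auto)

end

section \<open>Uniqueness of the completion\<close>

text \<open>The two completions are compared through \<open>E\<close> alone; the constants measure
  the distortion of the two embeddings. The data are symmetric, so every fact about the comparison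
  map holds for the opposite one as well.\<close>

locale dense_completions =
  E: normed_sublattice E N + Y1: normed_sublattice Y1 M1 + Y2: normed_sublattice Y2 M2 +
  J1: embedding E Y1 J1 + J2: embedding E Y2 J2
  for E :: "'v::real_vector_lattice set" and N
    and Y1 :: "'w::real_vector_lattice set" and M1 J1
    and Y2 :: "'u::real_vector_lattice set" and M2 J2 +
  fixes c1 C1 c2 C2 :: real
  assumes mc1: "monotonically_complete_on Y1 M1" and mc2: "monotonically_complete_on Y2 M2"
    and dense1: "order_dense_in (J1 ` E) Y1" and dense2: "order_dense_in (J2 ` E) Y2"
    and c1: "0 < c1" "\<And>x. x \<in> E \<Longrightarrow> c1 * N x \<le> M1 (J1 x)"
    and C1: "0 \<le> C1" "\<And>x. x \<in> E \<Longrightarrow> M1 (J1 x) \<le> C1 * N x"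
    and c2: "0 < c2" "\<And>x. x \<in> E \<Longrightarrow> c2 * N x \<le> M2 (J2 x)"
    and C2: "0 \<le> C2" "\<And>x. x \<in> E \<Longrightarrow> M2 (J2 x) \<le> C2 * N x"
begin

lemma swap: "dense_completions E N Y2 M2 J2 Y1 M1 J1 c2 C2 c1 C1"
  by unfold_locales (fact mc1 mc2 dense1 dense2 c1 C1 c2 C2)+

definition below :: "'w \<Rightarrow> 'v set"
  where "below y = {f \<in> E. 0 \<le> f \<and> J1 f \<le> y}"

text \<open>The choice is meaningful for positive \<open>y\<close> in \<open>Y1\<close>. That the
  supremum exists needs norm bounds and is therefore proved together with them in
  \<open>transfer_pos_bounded\<close>.\<close>

definition transfer_pos :: "'w \<Rightarrow> 'u"
  where "transfer_pos y = (SOME z. lub_in Y2 (J2 ` below y) z)"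

lemma lub_below:
  assumes "y \<in> Y1" "0 \<le> y"
  shows "lub_in Y1 (J1 ` below y) y"
proof -
  have "linear_sublattice (J1 ` E)"
  proof
    show "0 \<in> J1 ` E" by (metis J1.emb_0 E.zero_mem imageI)
    show "x + z \<in> J1 ` E" if "x \<in> J1 ` E" "z \<in> J1 ` E" for x z
      using that by (auto simp flip: J1.emb_add)
    show "a *\<^sub>R x \<in> J1 ` E" if "x \<in> J1 ` E" for a x
      using that by (auto simp flip: J1.emb_scaleR)
    show "sup x z \<in> J1 ` E" if "x \<in> J1 ` E" "z \<in> J1 ` E" for x z
      using that by (auto simp flip: J1.emb_sup)
  qed
  moreover have "J1 ` E \<subseteq> Y1" by auto
  ultimately have "lub_in Y1 {e \<in> J1 ` E. 0 \<le> e \<and> e \<le> y} y"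
    using dense1 assms by (rule Y1.lub_of_order_dense)
  also have "{e \<in> J1 ` E. 0 \<le> e \<and> e \<le> y} = J1 ` below y"
    by (auto simp: below_def J1.emb_nonneg_iff)
  finally show ?thesis .
qed

lemma below_mono: "\<lbrakk>x \<le> y\<rbrakk> \<Longrightarrow> below x \<subseteq> below y"
  by (auto simp: below_def intro: order_trans)

lemma zero_below: "0 \<le> y \<Longrightarrow> 0 \<in> below y"
  by (simp add: below_def)

text \<open>Elements of \<open>E\<close> below \<open>y\<close> have norm at most
  \<open>M1 y / c1\<close>, so their images in \<open>Y2\<close> are bounded by
  \<open>C2 / c1 * M1 y\<close>. Monotone completeness of \<open>Y2\<close> supplies the supremum,
  and the demicontinuity of \<open>Y2\<close> that it implies controls the norm at the price of the
  factor \<open>r\<close>.\<close>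

lemma transfer_pos_bounded:
  obtains K where "0 \<le> K"
    "\<And>y. y \<in> Y1 \<Longrightarrow> 0 \<le> y \<Longrightarrow>
      lub_in Y2 (J2 ` below y) (transfer_pos y) \<and> M2 (transfer_pos y) \<le> K * M1 y"
proof -
  obtain r where r: "1 \<le> r" "\<And>P f c. \<lbrakk>P \<subseteq> Y2; \<And>p. p \<in> P \<Longrightarrow> 0 \<le> p \<and> M2 p \<le> c;
      directed P; lub_in Y2 P f\<rbrakk> \<Longrightarrow> M2 f \<le> r * c"
    using Y2.monotonically_complete_imp_demicontinuous[OF mc2]
    by (rule Y2.demicontinuous_onE) blast
  show ?thesis
  proof (rule that[of "r * (C2 / c1)"], goal_cases)
    case 1
    then show ?case using r c1 C2 by simp
  next
    case (2 y)
    have dir: "directed (J2 ` below y)"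
      unfolding directed_def
    proof (intro conjI ballI)
      show "J2 ` below y \<noteq> {}" using zero_below 2 by auto
      fix s t assume "s \<in> J2 ` below y" "t \<in> J2 ` below y"
      then obtain f g where *: "f \<in> below y" "g \<in> below y" "s = J2 f" "t = J2 g" by auto
      then have "sup f g \<in> below y" by (auto simp: below_def J1.emb_sup le_supI1)
      then show "\<exists>z\<in>J2 ` below y. s \<le> z \<and> t \<le> z"
        using * by (intro bexI[of _ "J2 (sup f g)"]) (auto simp: below_def J2.emb_le_iff)
    qed
    have bd: "0 \<le> p \<and> M2 p \<le> C2 / c1 * M1 y" if p: "p \<in> J2 ` below y" for p
    proof -
      obtain f where f: "f \<in> E" "0 \<le> f" "J1 f \<le> y" "p = J2 f"
        using p by (auto simp: below_def)
      have "c1 * N f \<le> M1 (J1 f)" by (rule c1) fact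
      also have "\<dots> \<le> M1 y" using f 2 by (intro Y1.norm_mono) (auto simp: J1.emb_nonneg_iff)
      finally have "N f \<le> M1 y / c1" using c1(1) by (simp add: field_simps)
      then have "C2 * N f \<le> C2 * (M1 y / c1)" using C2(1) by (rule mult_left_mono)
      then show ?thesis using f C2(2)[OF f(1)] by (simp add: J2.emb_nonneg_iff)
    qed
    have sub: "J2 ` below y \<subseteq> Y2" by (auto simp: below_def)
    obtain z where "lub_in Y2 (J2 ` below y) z"
      using Y2.monotonically_complete_onE[OF mc2 sub bd dir] .
    then have lub: "lub_in Y2 (J2 ` below y) (transfer_pos y)"
      unfolding transfer_pos_def by (rule someI)
    have "M2 (transfer_pos y) \<le> r * (C2 / c1 * M1 y)"
      by (rule r(2)[OF sub bd dir lub])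
    then show ?case using lub by (simp add: algebra_simps)
  qed
qed

lemma lub_transfer_pos:
  assumes "y \<in> Y1" "0 \<le> y"
  shows "lub_in Y2 (J2 ` below y) (transfer_pos y)"
  using transfer_pos_bounded assms by metis

lemma transfer_pos_mem: "\<lbrakk>y \<in> Y1; 0 \<le> y\<rbrakk> \<Longrightarrow> transfer_pos y \<in> Y2"
  using lub_transfer_pos by (auto simp: lub_in_def)

lemma transfer_pos_nonneg: "\<lbrakk>y \<in> Y1; 0 \<le> y\<rbrakk> \<Longrightarrow> 0 \<le> transfer_pos y"
  using lub_transfer_pos[of y] zero_below[of y] unfolding lub_in_def
  by (metis J2.emb_0 imageI)

lemma transfer_pos_mono:
  "\<lbrakk>x \<in> Y1; y \<in> Y1; 0 \<le> x; x \<le> y\<rbrakk> \<Longrightarrow> transfer_pos x \<le> transfer_pos y"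
  using lub_transfer_pos[of x] lub_transfer_pos[of y] below_mono[of x y] unfolding lub_in_def
  by (meson image_mono order_trans subsetD)

text \<open>No new elements of \<open>E\<close> appear under the transferred point. By
  distributivity in \<open>Y2\<close>, \<open>J2 f \<le> transfer_pos y\<close> makes
  \<open>f\<close> the supremum in \<open>E\<close> of the elements \<open>inf f a\<close> with
  \<open>a\<close> in \<open>below y\<close>; regularity carries this supremum to \<open>Y1\<close>,
  where \<open>y\<close> bounds all these elements.\<close>

lemma le_transfer_pos_iff:
  assumes y: "y \<in> Y1" "0 \<le> y" and f: "f \<in> E" "0 \<le> f"
  shows "J2 f \<le> transfer_pos y \<longleftrightarrow> J1 f \<le> y"
proof
  assume "J1 f \<le> y"
  then show "J2 f \<le> transfer_pos y"
    using lub_transfer_pos[OF y] f by (auto simp: lub_in_def below_def)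
next
  assume le: "J2 f \<le> transfer_pos y"
  let ?P = "inf f ` below y"
  have "lub_in E ?P f"
    unfolding lub_in_def
  proof (intro conjI ballI impI)
    fix u assume u: "u \<in> E" "\<forall>p\<in>?P. p \<le> u"
    have "inf (J2 f) (transfer_pos y) \<le> J2 u"
    proof (rule inf_lub_le[OF _ lub_transfer_pos[OF y]])
      fix p assume "p \<in> J2 ` below y"
      then obtain a where a: "a \<in> below y" "p = J2 a" by auto
      then have "a \<in> E" by (simp add: below_def)
      then show "inf (J2 f) p \<le> J2 u"
        using a u f by (simp add: J2.emb_le_iff flip: J2.emb_inf)
    qed (use u f in \<open>auto intro: Y2.linear_sublattice_axioms\<close>)
    then show "f \<le> u" using le u f by (simp add: inf_absorb1 J2.emb_le_iff)
  qed (use f in auto)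
  moreover have "regular_in (J1 ` E) Y1"
    by (rule order_dense_imp_regular[OF Y1.linear_sublattice_axioms _ dense1]) auto
  moreover have "?P \<subseteq> E" "?P \<noteq> {}" using f zero_below[OF y(2)] by (auto simp: below_def)
  ultimately have "lub_in Y1 (J1 ` ?P) (J1 f)"
    by (intro J1.regular_lub)
  moreover have "p \<le> y" if p: "p \<in> J1 ` ?P" for p
  proof -
    obtain a where a: "a \<in> below y" "p = J1 (inf f a)" using p by blast
    then have "a \<in> E" "J1 a \<le> y" by (auto simp: below_def)
    then show ?thesis using a f by (simp add: J1.emb_inf le_infI2)
  qed
  ultimately show "J1 f \<le> y" using y by (auto simp: lub_in_def)
qed

lemma transfer_pos_embedding:
  assumes "f \<in> E" "0 \<le> f"
  shows "transfer_pos (J1 f) = J2 f"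
proof (rule lub_in_unique[OF lub_transfer_pos])
  show "lub_in Y2 (J2 ` below (J1 f)) (J2 f)"
    using assms by (auto simp: lub_in_def below_def J1.emb_le_iff J2.emb_le_iff)
qed (use assms in \<open>simp_all add: J1.emb_nonneg_iff\<close>)

end

context dense_completions
begin

interpretation swap: dense_completions E N Y2 M2 J2 Y1 M1 J1 c2 C2 c1 C1
  by (rule swap)

text \<open>A point and its transfer have the same elements of \<open>E\<close> below them, and
  \<open>y\<close> is the supremum of that set in \<open>Y1\<close>.\<close>

lemma transfer_pos_inverse:
  assumes "y \<in> Y1" "0 \<le> y"
  shows "swap.transfer_pos (transfer_pos y) = y"
proof -
  have "swap.below (transfer_pos y) = below y"
    using le_transfer_pos_iff[OF assms] by (auto simp: swap.below_def below_def)
  moreover have "lub_in Y1 (J1 ` swap.below (transfer_pos y)) (swap.transfer_pos (transfer_pos y))"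
    using assms by (intro swap.lub_transfer_pos transfer_pos_mem transfer_pos_nonneg)
  ultimately have "lub_in Y1 (J1 ` below y) (swap.transfer_pos (transfer_pos y))"
    by simp
  then show ?thesis using lub_below[OF assms] by (rule lub_in_unique)
qed

text \<open>Only this inequality is direct: sums of elements below \<open>x\<close> and below
  \<open>y\<close> lie below \<open>x + y\<close>, whereas an element of \<open>E\<close> below
  \<open>x + y\<close> need not split inside \<open>E\<close>. The two suprema are reached by fixing
  one summand at a time.\<close>

lemma transfer_pos_superadditive:
  assumes "x \<in> Y1" "y \<in> Y1" "0 \<le> x" "0 \<le> y"
  shows "transfer_pos x + transfer_pos y \<le> transfer_pos (x + y)"
proof -
  let ?z = "transfer_pos (x + y)"
  have z: "?z \<in> Y2" using assms by (simp add: transfer_pos_mem)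
  have le: "J2 f + J2 g \<le> ?z" if "f \<in> below x" "g \<in> below y" for f g
  proof -
    have "J2 (f + g) \<le> ?z"
      using that assms by (subst le_transfer_pos_iff) (auto simp: below_def J1.emb_add add_mono)
    then show ?thesis using that by (simp add: J2.emb_add below_def)
  qed
  have "transfer_pos x \<le> ?z - J2 g" if g: "g \<in> below y" for g
  proof -
    have "?z - J2 g \<in> Y2" using z g by (simp add: below_def)
    moreover have "\<forall>p\<in>J2 ` below x. p \<le> ?z - J2 g"
      using le[OF _ g] by (auto simp: le_diff_eq)
    ultimately show ?thesis
      using lub_transfer_pos[of x] assms(1,3) unfolding lub_in_def by blast
  qed
  then have "J2 g \<le> ?z - transfer_pos x" if "g \<in> below y" for g
    using that by (metis add.commute le_diff_eq)
  then have "transfer_pos y \<le> ?z - transfer_pos x"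
    using lub_transfer_pos[of y] assms z transfer_pos_mem[of x] by (auto simp: lub_in_def)
  then show ?thesis by (simp add: algebra_simps)
qed

end

context dense_completions
begin

interpretation swap: dense_completions E N Y2 M2 J2 Y1 M1 J1 c2 C2 c1 C1
  by (rule swap)

lemma transfer_pos_inverse':
  "z \<in> Y2 \<Longrightarrow> 0 \<le> z \<Longrightarrow> transfer_pos (swap.transfer_pos z) = z"
  by (rule swap.transfer_pos_inverse)

text \<open>The missing inequality is superadditivity of the inverse map at the transfers of
  \<open>x\<close> and \<open>y\<close>, read after applying the monotone map
  \<open>transfer_pos\<close> to it.\<close>

lemma transfer_pos_add:
  assumes "x \<in> Y1" "y \<in> Y1" "0 \<le> x" "0 \<le> y"
  shows "transfer_pos (x + y) = transfer_pos x + transfer_pos y"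
proof (rule order.antisym)
  let ?x = "transfer_pos x" and ?y = "transfer_pos y"
  have *: "?x \<in> Y2" "?y \<in> Y2" "0 \<le> ?x" "0 \<le> ?y"
    using assms by (simp_all add: transfer_pos_mem transfer_pos_nonneg)
  have "x + y \<le> swap.transfer_pos (?x + ?y)"
    using swap.transfer_pos_superadditive[OF *] assms by (simp add: transfer_pos_inverse)
  then have "transfer_pos (x + y) \<le> transfer_pos (swap.transfer_pos (?x + ?y))"
    using assms * by (intro transfer_pos_mono swap.transfer_pos_mem) auto
  then show "transfer_pos (x + y) \<le> ?x + ?y"
    using * by (simp add: transfer_pos_inverse')
qed (rule transfer_pos_superadditive[OF assms])

lemma transfer_pos_scaleR:
  assumes "y \<in> Y1" "0 \<le> y" "0 \<le> a"
  shows "transfer_pos (a *\<^sub>R y) = a *\<^sub>R transfer_pos y"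
proof (cases "a = 0")
  case True
  then show ?thesis using transfer_pos_embedding[of 0] by simp
next
  case False
  with assms have a: "0 < a" by simp
  have eq: "below (a *\<^sub>R y) = (*\<^sub>R) a ` below y"
  proof (intro equalityI subsetI)
    fix f assume f: "f \<in> below (a *\<^sub>R y)"
    then have "inverse a *\<^sub>R f \<in> below y"
      using a by (auto simp: below_def J1.emb_scaleR scaleR_nonneg_nonneg
        pos_divideR_le_eq)
    then show "f \<in> (*\<^sub>R) a ` below y"
      using a by (intro image_eqI[of _ _ "inverse a *\<^sub>R f"]) auto
  qed (use a in \<open>auto simp: below_def J1.emb_scaleR scaleR_nonneg_nonneg scaleR_left_mono\<close>)
  have "lub_in Y2 ((*\<^sub>R) a ` J2 ` below y) (a *\<^sub>R transfer_pos y)"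
    using assms a by (intro Y2.lub_in_scaleR lub_transfer_pos)
  also have "(*\<^sub>R) a ` J2 ` below y = J2 ` below (a *\<^sub>R y)"
    unfolding eq image_image by (intro image_cong) (auto simp: below_def J2.emb_scaleR)
  finally show ?thesis
    using assms by (intro lub_in_unique[OF lub_transfer_pos]) (auto simp: scaleR_nonneg_nonneg)
qed

lemma transfer_pos_le_iff:
  assumes "x \<in> Y1" "y \<in> Y1" "0 \<le> x" "0 \<le> y"
  shows "transfer_pos x \<le> transfer_pos y \<longleftrightarrow> x \<le> y"
  using assms transfer_pos_mono[of x y]
    swap.transfer_pos_mono[of "transfer_pos x" "transfer_pos y"]
  by (auto simp: transfer_pos_mem transfer_pos_nonneg transfer_pos_inverse)

definition transfer_map :: "'w \<Rightarrow> 'u"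
  where "transfer_map = linear_extension transfer_pos"

lemmas transfer_map_props = linear_extension[OF Y1.linear_sublattice_axioms
  Y2.linear_sublattice_axioms transfer_pos_mem transfer_pos_add transfer_pos_scaleR,
  folded transfer_map_def]

lemma transfer_map_nonneg_iff:
  assumes "x \<in> Y1" shows "0 \<le> transfer_map x \<longleftrightarrow> 0 \<le> x"
proof -
  have "0 \<le> transfer_map x \<longleftrightarrow> - nprt x \<le> pprt x"
    using transfer_pos_le_iff[of "- nprt x" "pprt x"] assms
    by (simp add: transfer_map_def linear_extension_def)
  also have "\<dots> \<longleftrightarrow> 0 \<le> x"
    unfolding diff_ge_0_iff_ge[of "pprt x" "- nprt x", symmetric] by (simp flip: prts)
  finally show ?thesis .
qed

lemma transfer_map_embedding:
  assumes "f \<in> E" shows "transfer_map (J1 f) = J2 f"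
proof -
  have "transfer_map (J1 f) = transfer_map (J1 (pprt f) - J1 (- nprt f))"
    using assms prts[of f] by (simp flip: J1.emb_diff)
  also have "\<dots> = transfer_pos (J1 (pprt f)) - transfer_pos (J1 (- nprt f))"
    using assms by (intro transfer_map_props) (simp_all add: J1.emb_nonneg_iff)
  also have "\<dots> = J2 (pprt f - (- nprt f))"
    using assms by (simp add: transfer_pos_embedding J2.emb_diff[of "pprt f" "- nprt f"]
      del: diff_minus_eq_add)
  finally show ?thesis using prts[of f] by simp
qed

lemma transfer_map_surj: "transfer_map ` Y1 = Y2"
proof (intro equalityI subsetI)
  fix z assume z: "z \<in> Y2"
  let ?p = "swap.transfer_pos (pprt z)" and ?n = "swap.transfer_pos (- nprt z)"
  have *: "?p \<in> Y1" "?n \<in> Y1" "0 \<le> ?p" "0 \<le> ?n"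
    using z by (simp_all add: swap.transfer_pos_mem swap.transfer_pos_nonneg)
  have "transfer_map (?p - ?n) = transfer_pos ?p - transfer_pos ?n"
    using * by (intro transfer_map_props)
  also have "\<dots> = z"
    using z prts[of z] transfer_pos_inverse'[of "- nprt z"] by (simp add: transfer_pos_inverse')
  finally show "z \<in> transfer_map ` Y1" using * by (metis Y1.diff_mem imageI)
qed (auto intro: transfer_map_props(1))

lemma transfer_map_embedding_on: "embedding_on Y1 Y2 transfer_map"
proof (rule embedding_on_if_nonneg_iff)
  show "order_dense_in (transfer_map ` Y1) Y2"
    unfolding transfer_map_surj by (auto simp: order_dense_in_def)
qed (simp_all add: transfer_map_nonneg_iff transfer_map_props(1,2,3) Y1.linear_sublattice_axioms
    Y2.linear_sublattice_axioms)

lemma transfer_map_bounded: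
  obtains K where "0 \<le> K" "\<And>y. y \<in> Y1 \<Longrightarrow> M2 (transfer_map y) \<le> K * M1 y"
proof -
  obtain K where K: "0 \<le> K" "\<And>y. y \<in> Y1 \<Longrightarrow> 0 \<le> y \<Longrightarrow> M2 (transfer_pos y) \<le> K * M1 y"
    using transfer_pos_bounded by metis
  show ?thesis
  proof (rule that)
    fix y assume y: "y \<in> Y1"
    interpret S: embedding Y1 Y2 transfer_map
      by unfold_locales (rule transfer_map_embedding_on)
    have "M2 (transfer_map y) = M2 (transfer_map \<bar>y\<bar>)"
      using y by (simp add: S.emb_abs Y2.norm_abs)
    also have "\<dots> \<le> K * M1 \<bar>y\<bar>"
      using K(2)[of "\<bar>y\<bar>"] y transfer_map_props(4)[of "\<bar>y\<bar>"] by simp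
    finally show "M2 (transfer_map y) \<le> K * M1 y"
      using y by (simp add: Y1.norm_abs)
  qed fact
qed

end

context dense_completions
begin

interpretation swap: dense_completions E N Y2 M2 J2 Y1 M1 J1 c2 C2 c1 C1
  by (rule swap)

lemma transfer_map_inverse:
  assumes y: "y \<in> Y1" shows "swap.transfer_map (transfer_map y) = y"
proof -
  have "swap.transfer_map (transfer_map y) =
      swap.transfer_pos (transfer_pos (pprt y)) - swap.transfer_pos (transfer_pos (- nprt y))"
    unfolding transfer_map_def linear_extension_def using y
    by (intro swap.transfer_map_props) (simp_all add: transfer_pos_mem transfer_pos_nonneg)
  also have "\<dots> = y"
    using y prts[of y] transfer_pos_inverse[of "- nprt y"] by (simp add: transfer_pos_inverse)
  finally show ?thesis .
qed

text \<open>The inverse is the comparison map in the other direction, so its upper estimate is a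
  lower estimate here. \<open>K + 1\<close> is positive also when \<open>K = 0\<close>.\<close>

lemma transfer_map_bounded_below:
  obtains c where "0 < c" "\<And>y. y \<in> Y1 \<Longrightarrow> c * M1 y \<le> M2 (transfer_map y)"
proof -
  obtain K where K: "0 \<le> K" "\<And>z. z \<in> Y2 \<Longrightarrow> M1 (swap.transfer_map z) \<le> K * M2 z"
    by (rule swap.transfer_map_bounded) blast
  show ?thesis
  proof (rule that[of "inverse (K + 1)"])
    fix y assume y: "y \<in> Y1"
    have S: "transfer_map y \<in> Y2" using y transfer_map_surj by auto
    have "M1 y \<le> K * M2 (transfer_map y)"
      using K(2)[OF S] y by (simp add: transfer_map_inverse)
    also have "\<dots> \<le> (K + 1) * M2 (transfer_map y)"
      using Y2.norm_nonneg[OF S] by (simp add: algebra_simps)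
    finally show "inverse (K + 1) * M1 y \<le> M2 (transfer_map y)"
      using K(1) by (simp add: field_simps)
  qed (use K in simp)
qed

end

section \<open>The cone of cuts\<close>

text \<open>The axioms describe the positive cone of a vector lattice from within.
  \<open>cone_add_le\<close> contains cancellation, and \<open>cone_diff\<close> says that the order
  arises from addition. \<open>cone_join\<close> carries a translation by \<open>d\<close> because
  that is how a supremum of formal differences is tested against an upper bound.\<close>

locale cancellative_cone =
  fixes C :: "'c set" and add :: "'c \<Rightarrow> 'c \<Rightarrow> 'c" (infixl \<open>[+]\<close> 65) and zero :: 'c
    and smul :: "real \<Rightarrow> 'c \<Rightarrow> 'c" and le :: "'c \<Rightarrow> 'c \<Rightarrow> bool" (infix \<open>[\<le>]\<close> 50)
  assumes cone_add_closed: "\<lbrakk>a \<in> C; b \<in> C\<rbrakk> \<Longrightarrow> a [+] b \<in> C"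
    and cone_zero_closed: "zero \<in> C"
    and cone_smul_closed: "\<lbrakk>0 \<le> s; a \<in> C\<rbrakk> \<Longrightarrow> smul s a \<in> C"
    and cone_comm: "\<lbrakk>a \<in> C; b \<in> C\<rbrakk> \<Longrightarrow> a [+] b = b [+] a"
    and cone_assoc: "\<lbrakk>a \<in> C; b \<in> C; c \<in> C\<rbrakk> \<Longrightarrow> a [+] b [+] c = a [+] (b [+] c)"
    and cone_zero: "a \<in> C \<Longrightarrow> zero [+] a = a"
    and cone_refl: "a \<in> C \<Longrightarrow> a [\<le>] a"
    and cone_antisym: "\<lbrakk>a [\<le>] b; b [\<le>] a; a \<in> C; b \<in> C\<rbrakk> \<Longrightarrow> a = b"
    and cone_trans: "\<lbrakk>a [\<le>] b; b [\<le>] c; a \<in> C; b \<in> C; c \<in> C\<rbrakk> \<Longrightarrow> a [\<le>] c"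
    and cone_add_le: "\<lbrakk>a \<in> C; b \<in> C; c \<in> C\<rbrakk> \<Longrightarrow> a [+] c [\<le>] b [+] c \<longleftrightarrow> a [\<le>] b"
    and cone_zero_le: "a \<in> C \<Longrightarrow> zero [\<le>] a"
    and cone_smul_add: "\<lbrakk>0 \<le> s; a \<in> C; b \<in> C\<rbrakk> \<Longrightarrow> smul s (a [+] b) = smul s a [+] smul s b"
    and cone_add_smul: "\<lbrakk>0 \<le> s; 0 \<le> t; a \<in> C\<rbrakk> \<Longrightarrow> smul (s + t) a = smul s a [+] smul t a"
    and cone_smul_smul: "\<lbrakk>0 \<le> s; 0 \<le> t; a \<in> C\<rbrakk> \<Longrightarrow> smul s (smul t a) = smul (s * t) a"
    and cone_one_smul: "a \<in> C \<Longrightarrow> smul 1 a = a"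
    and cone_diff: "\<lbrakk>a [\<le>] b; a \<in> C; b \<in> C\<rbrakk> \<Longrightarrow> \<exists>d\<in>C. b = a [+] d"
    and cone_join: "\<lbrakk>a \<in> C; b \<in> C\<rbrakk> \<Longrightarrow>
      \<exists>j\<in>C. \<forall>d\<in>C. \<forall>g\<in>C. j [+] d [\<le>] g \<longleftrightarrow> a [+] d [\<le>] g \<and> b [+] d [\<le>] g"

lemma scaleR_inf:
  fixes x y :: "'v::real_vector_lattice"
  assumes "0 < a" shows "a *\<^sub>R inf x y = inf (a *\<^sub>R x) (a *\<^sub>R y)"
proof (rule order.antisym)
  have "inverse a *\<^sub>R inf (a *\<^sub>R x) (a *\<^sub>R y) \<le> inf x y"
    using assms by (simp add: pos_divideR_le_eq)
  from scaleR_left_mono[OF this, of a] show "inf (a *\<^sub>R x) (a *\<^sub>R y) \<le> a *\<^sub>R inf x y"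
    using assms by simp
qed (use assms in \<open>simp add: scaleR_left_mono\<close>)

context normed_sublattice
begin

text \<open>
  \<open>ocl P\<close> consists of the positive elements \<open>f\<close> with \<open>f = sup {inf f p | p. p \<in> P}\<close>, and a cut is
  the trace on \<open>E\<close> of a principal order interval \<open>{f. 0 \<le> f \<le> g}\<close> of the completion.
\<close>

definition ocl :: "'v set \<Rightarrow> 'v set"
  where "ocl P = {f \<in> E. 0 \<le> f \<and> (\<forall>u\<in>E. (\<forall>p\<in>P. inf f p \<le> u) \<longrightarrow> f \<le> u)}"

definition cuts :: "'v set set"
  where "cuts = {A. A \<noteq> {} \<and> A \<subseteq> {x \<in> E. 0 \<le> x} \<and> ocl A \<subseteq> A \<and> (\<exists>b. \<forall>a\<in>A. N a \<le> b)}"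

text \<open>A sum of two cuts need not be order closed. Closing it up corresponds to adding the
  suprema of the two cuts in the completion.\<close>

definition cut_add :: "'v set \<Rightarrow> 'v set \<Rightarrow> 'v set"
  where "cut_add A B = ocl {a + b | a b. a \<in> A \<and> b \<in> B}"

definition cut_scale :: "real \<Rightarrow> 'v set \<Rightarrow> 'v set"
  where "cut_scale a A = (*\<^sub>R) a ` A"

definition principal_cut :: "'v \<Rightarrow> 'v set"
  where "principal_cut f = {h \<in> E. 0 \<le> h \<and> h \<le> f}"

lemma oclI:
  "\<lbrakk>f \<in> E; 0 \<le> f; \<And>u. u \<in> E \<Longrightarrow> (\<And>p. p \<in> P \<Longrightarrow> inf f p \<le> u) \<Longrightarrow> f \<le> u\<rbrakk> \<Longrightarrow> f \<in> ocl P"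
  by (simp add: ocl_def)

lemma oclD:
  "\<lbrakk>f \<in> ocl P; u \<in> E; \<And>p. p \<in> P \<Longrightarrow> inf f p \<le> u\<rbrakk> \<Longrightarrow> f \<le> u"
  by (simp add: ocl_def)

lemma ocl_mem: "f \<in> ocl P \<Longrightarrow> f \<in> E" and ocl_nonneg: "f \<in> ocl P \<Longrightarrow> 0 \<le> f"
  by (simp_all add: ocl_def)

lemma ocl_superset: "P \<subseteq> {x \<in> E. 0 \<le> x} \<Longrightarrow> P \<subseteq> ocl P"
  by (force simp: ocl_def)

lemma ocl_mono: "P \<subseteq> Q \<Longrightarrow> ocl P \<subseteq> ocl Q"
  by (auto simp: ocl_def)

lemma ocl_lub: "f \<in> ocl P \<Longrightarrow> lub_in E (inf f ` P) f"
  by (auto simp: lub_in_def ocl_def)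

text \<open>Since \<open>f\<close> is the supremum of the elements \<open>inf f p\<close>,
  distributivity reaches \<open>g = inf g f\<close> through the elements
  \<open>inf g (inf f p)\<close>, each of which is below \<open>inf g p\<close>.\<close>

lemma ocl_down:
  assumes "f \<in> ocl P" "g \<in> E" "0 \<le> g" "g \<le> f"
  shows "g \<in> ocl P"
proof (rule oclI)
  fix u assume u: "u \<in> E" "\<And>p. p \<in> P \<Longrightarrow> inf g p \<le> u"
  have "inf g f \<le> u"
  proof (rule inf_lub_le[OF linear_sublattice_axioms ocl_lub[OF assms(1)]])
    fix q assume "q \<in> inf f ` P"
    then obtain p where p: "p \<in> P" "q = inf f p" by blast
    have "inf g q \<le> inf g p" unfolding p by (simp add: le_infI2)
    then show "inf g q \<le> u" using u(2)[OF p(1)] by (rule order_trans)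
  qed (use assms u in auto)
  then show "g \<le> u" using assms by (simp add: inf_absorb1)
qed (use assms in auto)

text \<open>Distributivity passes a bound on all \<open>inf f p\<close> to \<open>inf f q\<close>
  for every \<open>q\<close> in the first closure; membership of \<open>f\<close> in the second
  closure then passes it to \<open>f\<close>.\<close>

lemma ocl_idem: "ocl (ocl P) \<subseteq> ocl P"
proof
  fix f assume f: "f \<in> ocl (ocl P)"
  show "f \<in> ocl P"
  proof (rule oclI)
    fix u assume u: "u \<in> E" "\<And>p. p \<in> P \<Longrightarrow> inf f p \<le> u"
    show "f \<le> u"
    proof (rule oclD[OF f u(1)])
      fix q assume q: "q \<in> ocl P"
      show "inf f q \<le> u"
      proof (rule inf_lub_le[OF linear_sublattice_axioms ocl_lub[OF q]])
        fix s assume "s \<in> inf q ` P"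
        then obtain p where p: "p \<in> P" "s = inf q p" by blast
        have "inf f s \<le> inf f p" unfolding p by (simp add: le_infI2)
        then show "inf f s \<le> u" using u(2)[OF p(1)] by (rule order_trans)
      qed (use u ocl_mem[OF f] in auto)
    qed
  qed (use f in \<open>auto simp: ocl_mem ocl_nonneg\<close>)
qed

text \<open>Translation commutes with infima:
  \<open>inf (f + q) (p + q) = inf f p + q\<close>.\<close>

lemma ocl_add:
  assumes "f \<in> ocl P" "q \<in> E" "0 \<le> q" "\<And>p. p \<in> P \<Longrightarrow> p + q \<in> R"
  shows "f + q \<in> ocl R"
proof (rule oclI)
  fix u assume u: "u \<in> E" "\<And>r. r \<in> R \<Longrightarrow> inf (f + q) r \<le> u"
  have "f \<le> u - q"
  proof (rule oclD[OF assms(1)])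
    fix p assume "p \<in> P"
    then have "inf (f + q) (p + q) \<le> u" by (intro u assms)
    then show "inf f p \<le> u - q" by (simp add: le_diff_eq add_inf_distrib_right)
  qed (use u assms in auto)
  then show "f + q \<le> u" by (simp add: le_diff_eq)
qed (use assms in \<open>auto simp: ocl_mem ocl_nonneg\<close>)

lemma ocl_scaleR_subset:
  assumes "0 < a" shows "ocl ((*\<^sub>R) a ` P) \<subseteq> (*\<^sub>R) a ` ocl P"
proof
  fix f assume f: "f \<in> ocl ((*\<^sub>R) a ` P)"
  have "inverse a *\<^sub>R f \<in> ocl P"
  proof (rule oclI)
    fix u assume u: "u \<in> E" "\<And>p. p \<in> P \<Longrightarrow> inf (inverse a *\<^sub>R f) p \<le> u"
    have "f \<le> a *\<^sub>R u"
    proof (rule oclD[OF f])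
      fix q assume "q \<in> (*\<^sub>R) a ` P"
      then obtain p where p: "p \<in> P" "q = a *\<^sub>R p" by blast
      have "a *\<^sub>R inf (inverse a *\<^sub>R f) p \<le> a *\<^sub>R u"
        using u p assms by (intro scaleR_left_mono) auto
      then show "inf f q \<le> a *\<^sub>R u" using assms p by (simp add: scaleR_inf)
    qed (use u in simp)
    then show "inverse a *\<^sub>R f \<le> u" using assms by (simp add: pos_divideR_le_eq)
  qed (use f assms in \<open>auto simp: ocl_mem ocl_nonneg scaleR_nonneg_nonneg\<close>)
  then show "f \<in> (*\<^sub>R) a ` ocl P"
    using assms by (intro image_eqI[of _ _ "inverse a *\<^sub>R f"]) auto
qed

text \<open>The reverse inclusion is the one already known, taken for \<open>inverse a\<close> and
  the scaled set.\<close>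

lemma ocl_scaleR:
  assumes "0 < a" shows "ocl ((*\<^sub>R) a ` P) = (*\<^sub>R) a ` ocl P"
proof
  have "ocl ((*\<^sub>R) (inverse a) ` (*\<^sub>R) a ` P) \<subseteq> (*\<^sub>R) (inverse a) ` ocl ((*\<^sub>R) a ` P)"
    using assms by (intro ocl_scaleR_subset) simp
  then have "ocl P \<subseteq> (*\<^sub>R) (inverse a) ` ocl ((*\<^sub>R) a ` P)"
    using assms by (simp add: image_image)
  then have "(*\<^sub>R) a ` ocl P \<subseteq> (*\<^sub>R) a ` (*\<^sub>R) (inverse a) ` ocl ((*\<^sub>R) a ` P)"
    by (rule image_mono)
  then show "(*\<^sub>R) a ` ocl P \<subseteq> ocl ((*\<^sub>R) a ` P)"
    using assms by (simp add: image_image)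
qed (rule ocl_scaleR_subset[OF assms])

section \<open>Closure properties of cuts and their addition\<close>

lemma cutsI:
  "\<lbrakk>A \<noteq> {}; \<And>a. a \<in> A \<Longrightarrow> a \<in> E \<and> 0 \<le> a; \<And>a. a \<in> ocl A \<Longrightarrow> a \<in> A; \<And>a. a \<in> A \<Longrightarrow> N a \<le> b\<rbrakk>
    \<Longrightarrow> A \<in> cuts"
  unfolding cuts_def by blast

lemma cut_mem: "A \<in> cuts \<Longrightarrow> a \<in> A \<Longrightarrow> a \<in> E"
  and cut_nonneg: "A \<in> cuts \<Longrightarrow> a \<in> A \<Longrightarrow> 0 \<le> a"
  and ocl_cut_subset: "A \<in> cuts \<Longrightarrow> ocl A \<subseteq> A"
  and cut_nonempty: "A \<in> cuts \<Longrightarrow> A \<noteq> {}"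
  by (auto simp: cuts_def)

lemma cut_bounded: assumes "A \<in> cuts" obtains b where "\<And>a. a \<in> A \<Longrightarrow> N a \<le> b"
  using assms by (auto simp: cuts_def)

lemma ocl_cut: "A \<in> cuts \<Longrightarrow> ocl A = A"
  by (intro equalityI ocl_cut_subset ocl_superset) (auto simp: cuts_def)

lemma ocl_subset_cut: "P \<subseteq> A \<Longrightarrow> A \<in> cuts \<Longrightarrow> ocl P \<subseteq> A"
  using ocl_mono[of P A] ocl_cut_subset by blast

lemma cut_down: "\<lbrakk>A \<in> cuts; a \<in> A; b \<in> E; 0 \<le> b; b \<le> a\<rbrakk> \<Longrightarrow> b \<in> A"
  using ocl_down[of a A b] ocl_cut[of A] by simp

lemma zero_in_cut: "A \<in> cuts \<Longrightarrow> 0 \<in> A"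
  by (metis cut_down cut_nonempty cut_nonneg ex_in_conv order_refl zero_mem)

text \<open>Both \<open>a\<close> and \<open>b\<close> occur among the elements
  \<open>inf (sup a b) p\<close>, so \<open>sup a b\<close> is in the order closure. Cuts are thus
  directed, which allows two members to be replaced by a common larger one.\<close>

lemma cut_sup:
  assumes "A \<in> cuts" "a \<in> A" "b \<in> A" shows "sup a b \<in> A"
proof -
  note ab = cut_mem[OF assms(1,2)] cut_mem[OF assms(1,3)]
    cut_nonneg[OF assms(1,2)] cut_nonneg[OF assms(1,3)]
  have "sup a b \<in> ocl A"
  proof (rule oclI)
    fix u assume u: "\<And>p. p \<in> A \<Longrightarrow> inf (sup a b) p \<le> u"
    from u[OF assms(2)] u[OF assms(3)] show "sup a b \<le> u"
      by (simp add: inf_absorb2)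
  qed (use ab in \<open>auto intro: le_supI1\<close>)
  then show ?thesis using ocl_cut assms by simp
qed

lemma principal_cut: "f \<in> E \<Longrightarrow> 0 \<le> f \<Longrightarrow> principal_cut f \<in> cuts"
proof (rule cutsI[where b = "N f"])
  assume f: "f \<in> E" "0 \<le> f"
  show "principal_cut f \<noteq> {}" using f by (auto simp: principal_cut_def)
  show "a \<in> principal_cut f" if "a \<in> ocl (principal_cut f)" for a
    using that f oclD[OF that f(1)] by (auto simp: principal_cut_def ocl_mem ocl_nonneg le_infI2)
  show "N a \<le> N f" if "a \<in> principal_cut f" for a
    using that f by (auto simp: principal_cut_def intro: norm_mono)
qed (auto simp: principal_cut_def)

lemma principal_cut_0: "principal_cut 0 = {0}"
  by (auto simp: principal_cut_def)

lemma zero_cut: "{0} \<in> cuts"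
  using principal_cut[of 0] by (simp add: principal_cut_0)

lemma principal_cut_subset_iff:
  "\<lbrakk>f \<in> E; 0 \<le> f; A \<in> cuts\<rbrakk> \<Longrightarrow> principal_cut f \<subseteq> A \<longleftrightarrow> f \<in> A"
  using cut_down[of A f] by (auto simp: principal_cut_def)

lemma cut_add_commute: "cut_add A B = cut_add B A"
  unfolding cut_add_def by (rule arg_cong[of _ _ ocl]) (metis add.commute)

lemma cut_addI: "\<lbrakk>A \<in> cuts; B \<in> cuts; a \<in> A; b \<in> B\<rbrakk> \<Longrightarrow> a + b \<in> cut_add A B"
  unfolding cut_add_def
  by (rule subsetD[OF ocl_superset]) (auto simp: cut_mem cut_nonneg)

lemma cut_add_subset:
  "\<lbrakk>D \<in> cuts; \<And>a b. a \<in> A \<Longrightarrow> b \<in> B \<Longrightarrow> a + b \<in> D\<rbrakk> \<Longrightarrow> cut_add A B \<subseteq> D"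
  unfolding cut_add_def by (rule ocl_subset_cut) auto

text \<open>The inner closure is absorbed by the outer one. What remains treats the three cuts
  alike, and associativity follows.\<close>

lemma cut_add_add:
  assumes "A \<in> cuts" "B \<in> cuts" "D \<in> cuts"
  shows "cut_add (cut_add A B) D = ocl {a + b + d | a b d. a \<in> A \<and> b \<in> B \<and> d \<in> D}"
    (is "_ = ocl ?R")
proof
  have "x + d \<in> ocl ?R" if "x \<in> cut_add A B" "d \<in> D" for x d
    using that assms unfolding cut_add_def
    by (rule_tac ocl_add) (auto simp: cut_mem cut_nonneg)
  then have "{x + d | x d. x \<in> cut_add A B \<and> d \<in> D} \<subseteq> ocl ?R" by auto
  from ocl_mono[OF this] show "cut_add (cut_add A B) D \<subseteq> ocl ?R"
    unfolding cut_add_def[of _ D] using ocl_idem by blast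
  show "ocl ?R \<subseteq> cut_add (cut_add A B) D"
    unfolding cut_add_def[of _ D] using assms by (intro ocl_mono) (auto intro: cut_addI)
qed

lemma cut_add_assoc:
  assumes "A \<in> cuts" "B \<in> cuts" "D \<in> cuts"
  shows "cut_add (cut_add A B) D = cut_add A (cut_add B D)"
proof -
  have "cut_add A (cut_add B D) = ocl {b + d + a | b d a. b \<in> B \<and> d \<in> D \<and> a \<in> A}"
    using assms by (simp add: cut_add_commute[of A] cut_add_add)
  also have "{b + d + a | b d a. b \<in> B \<and> d \<in> D \<and> a \<in> A} = {a + b + d | a b d. a \<in> A \<and> b \<in> B \<and> d \<in> D}"
    by (auto simp: add.commute add.left_commute add.assoc) (metis add.commute add.left_commute)+
  finally show ?thesis using assms by (simp add: cut_add_add)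
qed

lemma cut_add_zero: "A \<in> cuts \<Longrightarrow> cut_add {0} A = A"
  by (simp add: cut_add_def ocl_cut)

text \<open>
  The difference of two cuts: for \<open>f \<in> B\<close> and an upper bound \<open>v \<le> f\<close> of \<open>{inf f a | a. a \<in> A}\<close>,
  the element \<open>f - v\<close> is in the difference because \<open>f - v + a \<le> sup f a\<close>, and by the Archimedean
  property \<open>0\<close> is the infimum of the elements \<open>v - inf f a\<close>.
\<close>

lemma cut_add_diff:
  assumes A: "A \<in> cuts" and B: "B \<in> cuts" and "A \<subseteq> B"
  obtains D where "D \<in> cuts" "B = cut_add A D"
proof -
  \<comment> \<open>The largest possible difference is taken. It inherits order closedness from
    \<open>B\<close>, and also the norm bound, because zero belongs to \<open>A\<close>.\<close>
  define D where "D = {d \<in> E. 0 \<le> d \<and> (\<forall>a\<in>A. a + d \<in> B)}"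
  obtain b where b: "\<And>a. a \<in> B \<Longrightarrow> N a \<le> b" using cut_bounded[OF B] by blast
  have D: "D \<in> cuts"
  proof (rule cutsI[where b = b])
    have "0 \<in> D" using assms by (auto simp: D_def)
    then show "D \<noteq> {}" by auto
    show "f \<in> D" if f: "f \<in> ocl D" for f
    proof -
      have "a + f \<in> B" if a: "a \<in> A" for a
      proof -
        have "f + a \<in> ocl B"
          using f by (rule ocl_add) (use a A in \<open>auto simp: D_def cut_mem cut_nonneg add.commute\<close>)
        then show ?thesis using B by (simp add: ocl_cut add.commute)
      qed
      then show ?thesis using f by (auto simp: D_def ocl_mem ocl_nonneg)
    qed
    show "N d \<le> b" if d: "d \<in> D" for d
      using d b zero_in_cut[OF A] by (force simp: D_def)
  qed (auto simp: D_def)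
  have "f \<in> cut_add A D" if f: "f \<in> B" for f
    unfolding cut_add_def
  proof (rule oclI)
    have fE: "f \<in> E" "0 \<le> f" using f B by (auto simp: cut_mem cut_nonneg)
    then show "f \<in> E" "0 \<le> f" .
    fix u assume u: "u \<in> E" "\<And>p. p \<in> {a + d |a d. a \<in> A \<and> d \<in> D} \<Longrightarrow> inf f p \<le> u"
    \<comment> \<open>\<open>w\<close> is the amount by which \<open>f\<close> fails to be below
      \<open>u\<close>. The set \<open>U\<close> of bounds contains \<open>f\<close> and turns out
      to be stable under subtraction of \<open>w\<close>; since zero is in \<open>A\<close>, each
      \<open>f - n *\<^sub>R w\<close> is nonnegative, which leaves only
      \<open>w = 0\<close>.\<close>
    define w where "w = pprt (f - u)"
    define U where "U = {v \<in> E. v \<le> f \<and> (\<forall>a\<in>A. inf f a \<le> v)}"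
    have step: "v - w \<in> U" if v: "v \<in> U" for v
    proof -
      have vE: "v \<in> E" "v \<le> f" "\<And>a. a \<in> A \<Longrightarrow> inf f a \<le> v" using v by (auto simp: U_def)
      have "f - v \<in> D"
        unfolding D_def
      proof (safe)
        fix a assume a: "a \<in> A"
        have aE: "a \<in> E" "0 \<le> a" "a \<in> B" using A a assms(3) by (auto simp: cut_mem cut_nonneg)
        have "a + (f - v) \<le> a + (f - inf f a)" using vE(3)[OF a] by simp
        also have "\<dots> = sup f a" using add_eq_inf_sup[of f a] by (simp add: algebra_simps)
        finally have "a + (f - v) \<le> sup f a" .
        moreover have "a + (f - v) \<in> E" "0 \<le> a + (f - v)" using vE(1,2) fE aE by simp_all
        ultimately show "a + (f - v) \<in> B" using cut_down[OF B cut_sup[OF B f aE(3)]] by blast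
      qed (use vE(1,2) fE in simp_all)
      have "w \<le> v - inf f a" if a: "a \<in> A" for a
      proof -
        have aE: "a \<in> E" "0 \<le> a" using A a by (auto simp: cut_mem cut_nonneg)
        \<comment> \<open>With \<open>inf f a\<close> in place of \<open>a\<close>, the sum with
          \<open>f - v\<close> does not exceed \<open>f\<close>, so the infimum with
          \<open>f\<close> disappears from the bound by \<open>u\<close>.\<close>
        have "inf f a \<in> A" using a aE fE by (intro cut_down[OF A a]) auto
        with \<open>f - v \<in> D\<close> have "inf f (inf f a + (f - v)) \<le> u" by (intro u) blast
        moreover have "inf f a + (f - v) \<le> f" using vE(3)[OF a] by (simp add: algebra_simps)
        ultimately have "inf f a + (f - v) \<le> u" by (simp add: inf_absorb2)
        then have "f - u \<le> v - inf f a" by (simp add: algebra_simps)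
        then show ?thesis using vE(3)[OF a] by (simp add: w_def pprt_def)
      qed
      then have "inf f a \<le> v - w" if "a \<in> A" for a
        using that by (metis add.commute le_diff_eq)
      moreover have "v - w \<le> v" by (simp add: w_def)
      moreover have "v - w \<in> E" using vE(1) fE u(1) by (simp add: w_def)
      ultimately show ?thesis
        using order_trans[OF \<open>v - w \<le> v\<close> vE(2)] by (simp add: U_def)
    qed
    have "f - n *\<^sub>R w \<in> U" for n :: nat
    proof (induction n)
      case 0
      show ?case using fE by (simp add: U_def)
    next
      case (Suc n)
      from step[OF Suc] show ?case by (simp add: algebra_simps)
    qed
    then have "inf f 0 \<le> f - n *\<^sub>R w" for n :: nat
      using zero_in_cut[OF A] unfolding U_def by blast
    then have "n *\<^sub>R w \<le> f" for n :: nat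
      using fE by (simp add: inf_absorb2)
    moreover have "0 \<le> w" "w \<in> E" using fE u by (simp_all add: w_def)
    ultimately have "w = 0"
      using fE by (intro archimedean[of w "N f"]) (auto intro!: norm_mono scaleR_nonneg_nonneg)
    then show "f \<le> u" by (simp add: w_def flip: le_zero_iff_zero_pprt)
  qed
  moreover have "cut_add A D \<subseteq> B"
    using B by (rule cut_add_subset) (simp add: D_def)
  ultimately have "B = cut_add A D" by blast
  with D show ?thesis by (rule that)
qed

text \<open>If \<open>a\<close> were outside \<open>B\<close>, some \<open>u\<close> above all
  \<open>inf a b\<close> would leave a nonzero excess \<open>w\<close>. The inclusion of the sums
  then allows every member of \<open>D\<close> to be increased by \<open>w\<close>, so
  \<open>D\<close> would contain all multiples of \<open>w\<close>, which a norm bounded set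
  cannot.\<close>

lemma cut_add_cancel:
  assumes A: "A \<in> cuts" and B: "B \<in> cuts" and D: "D \<in> cuts"
    and le: "cut_add A D \<subseteq> cut_add B D"
  shows "A \<subseteq> B"
proof
  fix a assume a: "a \<in> A"
  then have aE: "a \<in> E" "0 \<le> a" using A by (auto simp: cut_mem cut_nonneg)
  have "a \<in> ocl B"
  proof (rule oclI)
    fix u assume u: "u \<in> E" "\<And>b. b \<in> B \<Longrightarrow> inf a b \<le> u"
    define w where "w = pprt (a - u)"
    have w: "w \<in> E" "0 \<le> w" using aE u by (simp_all add: w_def)
    have step: "d + w \<in> D" if d: "d \<in> D" for d
    proof -
      have dE: "d \<in> E" "0 \<le> d" using d D by (auto simp: cut_mem cut_nonneg)
      have ad: "a + d \<in> ocl {b + d | b d. b \<in> B \<and> d \<in> D}"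
        using le cut_addI[OF A D a d] by (auto simp: cut_add_def)
      have "d + w \<in> ocl D"
      proof (rule oclI)
        fix v assume v: "v \<in> E" "\<And>e. e \<in> D \<Longrightarrow> inf (d + w) e \<le> v"
        have "a + d \<le> v + a - w"
        proof (rule oclD[OF ad])
          fix p assume "p \<in> {b + d | b d. b \<in> B \<and> d \<in> D}"
          then obtain b d' where p: "p = b + d'" "b \<in> B" "d' \<in> D" by blast
          \<comment> \<open>One member of \<open>D\<close> above both \<open>d\<close> and
            \<open>d'\<close> replaces them, so that it can be taken out of the infimum of
            \<open>a + d\<close> and \<open>b + d'\<close>.\<close>
          define e where "e = sup d d'"
          have e: "e \<in> D" using D d p by (auto simp: e_def intro: cut_sup)
          have "inf (a + d) p \<le> inf (a + e) (b + e)"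
            unfolding p e_def by (intro inf_mono add_left_mono) auto
          also have "\<dots> = inf a b + e" by (simp add: add_inf_distrib_right)
          \<comment> \<open>Here \<open>a - w = inf a u\<close>, and \<open>inf a b\<close> is below
            both \<open>a\<close> and \<open>u\<close>.\<close>
          also have "\<dots> \<le> (a - w) + e"
            using u(2)[OF p(2)] by (simp add: w_def pprt_diff)
          finally have "inf (a + d) p \<le> inf (a + d) ((a - w) + e)" by simp
          also have "\<dots> = (a - w) + inf (d + w) e"
            by (simp add: add_inf_distrib_left algebra_simps)
          also have "\<dots> \<le> (a - w) + v" using v(2)[OF e] by (rule add_left_mono)
          finally show "inf (a + d) p \<le> v + a - w" by (simp add: algebra_simps)
        qed (use aE v w in auto)
        then show "d + w \<le> v" by (simp add: algebra_simps)
      qed (use dE w in auto)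
      then show ?thesis using D by (simp add: ocl_cut)
    qed
    obtain b where b: "\<And>d. d \<in> D \<Longrightarrow> N d \<le> b" using cut_bounded[OF D] by blast
    have "n *\<^sub>R w \<in> D" for n :: nat
    proof (induction n)
      case 0
      show ?case using zero_in_cut[OF D] by simp
    next
      case (Suc n)
      from step[OF Suc] show ?case by (simp add: algebra_simps)
    qed
    then have "w = 0" using w b by (intro archimedean[of w b]) auto
    then show "a \<le> u" by (simp add: w_def flip: le_zero_iff_zero_pprt)
  qed (use aE in auto)
  then show "a \<in> B" using B by (simp add: ocl_cut)
qed

section \<open>Scalar multiples of cuts and principal cuts\<close>

lemma cut_scale_0: "A \<in> cuts \<Longrightarrow> cut_scale 0 A = {0}"
  using cut_nonempty[of A] by (auto simp: cut_scale_def)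

lemma cut_scale_closed:
  assumes A: "A \<in> cuts" and a: "0 \<le> a" shows "cut_scale a A \<in> cuts"
proof (cases "a = 0")
  case True
  then show ?thesis using A by (simp add: cut_scale_0 zero_cut)
next
  case False
  then have "0 < a" using a by simp
  obtain b where b: "\<And>x. x \<in> A \<Longrightarrow> N x \<le> b" using cut_bounded[OF A] by blast
  show ?thesis
  proof (rule cutsI[where b = "a * b"])
    show "x \<in> cut_scale a A" if "x \<in> ocl (cut_scale a A)" for x
      using that ocl_scaleR[OF \<open>0 < a\<close>] A by (simp add: cut_scale_def ocl_cut)
  qed (use A a b in \<open>auto simp: cut_scale_def cut_mem cut_nonneg scaleR_nonneg_nonneg
      norm_scaleR cut_nonempty intro!: mult_left_mono\<close>)
qed

lemma cut_scale_add:
  assumes A: "A \<in> cuts" and B: "B \<in> cuts" and a: "0 \<le> a"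
  shows "cut_scale a (cut_add A B) = cut_add (cut_scale a A) (cut_scale a B)"
proof (cases "a = 0")
  case True
  have "cut_add A B \<noteq> {}"
    using cut_addI[OF A B zero_in_cut zero_in_cut] A B by auto
  then have "cut_scale a (cut_add A B) = {0}" using True by (auto simp: cut_scale_def)
  then show ?thesis using True A B by (simp add: cut_scale_0 cut_add_zero zero_cut)
next
  case False
  then have "0 < a" using a by simp
  have "{x + y |x y. x \<in> (*\<^sub>R) a ` A \<and> y \<in> (*\<^sub>R) a ` B} = (*\<^sub>R) a ` {x + y |x y. x \<in> A \<and> y \<in> B}"
    by (auto simp: image_iff) (metis scaleR_add_right)+
  then show ?thesis
    by (simp add: cut_scale_def cut_add_def ocl_scaleR[OF \<open>0 < a\<close>])
qed

text \<open>The two summands of \<open>cut_add\<close> may come from different members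
  \<open>f\<close> and \<open>g\<close> of \<open>A\<close>; both are replaced by
  \<open>sup f g\<close>, which is again in \<open>A\<close>.\<close>

lemma cut_add_scale:
  assumes A: "A \<in> cuts" and a: "0 \<le> a" "0 \<le> b"
  shows "cut_scale (a + b) A = cut_add (cut_scale a A) (cut_scale b A)"
proof
  show "cut_add (cut_scale a A) (cut_scale b A) \<subseteq> cut_scale (a + b) A"
  proof (rule cut_add_subset)
    show C: "cut_scale (a + b) A \<in> cuts" using A a by (simp add: cut_scale_closed)
    fix x y assume "x \<in> cut_scale a A" "y \<in> cut_scale b A"
    then obtain f g where fg: "x = a *\<^sub>R f" "y = b *\<^sub>R g" "f \<in> A" "g \<in> A"
      by (auto simp: cut_scale_def)
    have fg': "f \<in> E" "0 \<le> f" "g \<in> E" "0 \<le> g" using fg A by (auto simp: cut_mem cut_nonneg)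
    show "x + y \<in> cut_scale (a + b) A"
    proof (rule cut_down[OF C])
      show "(a + b) *\<^sub>R sup f g \<in> cut_scale (a + b) A"
        unfolding cut_scale_def by (intro imageI cut_sup[OF A fg(3,4)])
      show "x + y \<le> (a + b) *\<^sub>R sup f g"
        unfolding fg scaleR_add_left using a by (intro add_mono scaleR_left_mono) auto
    qed (use fg fg' a in \<open>auto simp: scaleR_nonneg_nonneg\<close>)
  qed
  show "cut_scale (a + b) A \<subseteq> cut_add (cut_scale a A) (cut_scale b A)"
  proof
    fix x assume "x \<in> cut_scale (a + b) A"
    then obtain f where "f \<in> A" "x = a *\<^sub>R f + b *\<^sub>R f"
      by (auto simp: cut_scale_def scaleR_add_left)
    then show "x \<in> cut_add (cut_scale a A) (cut_scale b A)"
      using A a cut_scale_closed by (auto simp: cut_scale_def intro!: cut_addI)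
  qed
qed

text \<open>No splitting of \<open>h\<close> is required: \<open>f + g\<close> is itself one of the
  sums, so \<open>h = inf h (f + g)\<close> is in the closure.\<close>

lemma principal_cut_add:
  assumes "f \<in> E" "0 \<le> f" "g \<in> E" "0 \<le> g"
  shows "cut_add (principal_cut f) (principal_cut g) = principal_cut (f + g)"
proof
  show "cut_add (principal_cut f) (principal_cut g) \<subseteq> principal_cut (f + g)"
    using assms by (intro cut_add_subset principal_cut) (auto simp: principal_cut_def add_mono)
  show "principal_cut (f + g) \<subseteq> cut_add (principal_cut f) (principal_cut g)"
  proof
    fix h assume h: "h \<in> principal_cut (f + g)"
    show "h \<in> cut_add (principal_cut f) (principal_cut g)"
      unfolding cut_add_def
    proof (rule oclI)
      fix u assume u: "\<And>p. p \<in> {a + b |a b. a \<in> principal_cut f \<and> b \<in> principal_cut g} \<Longrightarrow> inf h p \<le> u"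
      have "inf h (f + g) \<le> u"
        using assms by (intro u) (auto simp: principal_cut_def)
      then show "h \<le> u" using h by (simp add: principal_cut_def inf_absorb1)
    qed (use h in \<open>auto simp: principal_cut_def\<close>)
  qed
qed

lemma principal_cut_scale:
  assumes "f \<in> E" "0 \<le> f" "0 \<le> a"
  shows "cut_scale a (principal_cut f) = principal_cut (a *\<^sub>R f)"
proof (cases "a = 0")
  case True
  then show ?thesis using cut_scale_0[OF principal_cut] assms by (simp add: principal_cut_0)
next
  case False
  then have a: "0 < a" using assms by simp
  show ?thesis
  proof (intro equalityI subsetI)
    fix h assume "h \<in> principal_cut (a *\<^sub>R f)"
    then show "h \<in> cut_scale a (principal_cut f)"
      using a unfolding cut_scale_def
      by (intro image_eqI[of _ _ "inverse a *\<^sub>R h"])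
        (auto simp: principal_cut_def scaleR_nonneg_nonneg pos_divideR_le_eq)
  qed (use a in \<open>auto simp: cut_scale_def principal_cut_def scaleR_nonneg_nonneg scaleR_left_mono\<close>)
qed

section \<open>Order closures of norm bounded directed sets\<close>

lemma directed_inf_image:
  fixes f :: "'w::lattice"
  assumes "directed P" shows "directed (inf f ` P)"
  unfolding directed_def
proof (intro conjI ballI)
  show "inf f ` P \<noteq> {}" using assms by (simp add: directed_def)
  fix x y assume "x \<in> inf f ` P" "y \<in> inf f ` P"
  then obtain p q where pq: "p \<in> P" "q \<in> P" "x = inf f p" "y = inf f q" by blast
  then obtain z where z: "z \<in> P" "p \<le> z" "q \<le> z"
    using assms unfolding directed_def by blast
  then show "\<exists>z\<in>inf f ` P. x \<le> z \<and> y \<le> z"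
    unfolding pq by (intro bexI[of _ "inf f z"] conjI inf_mono) auto
qed

text \<open>A member \<open>f\<close> of the closure is the supremum in \<open>E\<close> of the
  directed set of all \<open>inf f p\<close>, whose norms are at most \<open>b\<close>; the
  demicontinuity estimate applies to this set.\<close>

lemma ocl_norm_le:
  assumes r: "\<And>P f c. \<lbrakk>P \<subseteq> E; \<And>p. p \<in> P \<Longrightarrow> 0 \<le> p \<and> N p \<le> c; directed P; lub_in E P f\<rbrakk>
      \<Longrightarrow> N f \<le> r * c"
    and P: "P \<subseteq> E" "\<And>p. p \<in> P \<Longrightarrow> 0 \<le> p \<and> N p \<le> b" "directed P" and f: "f \<in> ocl P"
  shows "N f \<le> r * b"
proof (rule r[OF _ _ directed_inf_image[OF P(3)] ocl_lub[OF f]])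
  note fE = ocl_mem[OF f] ocl_nonneg[OF f]
  show "inf f ` P \<subseteq> E" using P fE by auto
  show "0 \<le> p \<and> N p \<le> b" if "p \<in> inf f ` P" for p
  proof -
    obtain q where q: "q \<in> P" "p = inf f q" using \<open>p \<in> inf f ` P\<close> by blast
    then have "N p \<le> N q" using P fE by (auto intro!: norm_mono)
    then show ?thesis using q P(2)[OF q(1)] fE by auto
  qed
qed

lemma cut_ocl:
  assumes "demicontinuous_on E N"
    and P: "P \<subseteq> E" "\<And>p. p \<in> P \<Longrightarrow> 0 \<le> p \<and> N p \<le> b" "directed P"
  shows "ocl P \<in> cuts"
proof -
  obtain r where r: "\<And>P f c. \<lbrakk>P \<subseteq> E; \<And>p. p \<in> P \<Longrightarrow> 0 \<le> p \<and> N p \<le> c;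
      directed P; lub_in E P f\<rbrakk> \<Longrightarrow> N f \<le> r * c"
    using demicontinuous_onE[OF assms(1)] by metis
  show ?thesis
  proof (rule cutsI[where b = "r * b"])
    have "P \<subseteq> ocl P" using P by (intro ocl_superset) auto
    then show "ocl P \<noteq> {}" using P(3) by (auto simp: directed_def)
    show "N f \<le> r * b" if f: "f \<in> ocl P" for f
      using ocl_norm_le[OF r P f] .
  qed (use ocl_idem in \<open>auto simp: ocl_mem ocl_nonneg\<close>)
qed

text \<open>Sums and joins are handled together. As cuts are closed under suprema, a monotone
  \<open>h\<close> sends pairs to a directed set, and \<open>h a b \<le> a + b\<close> keeps that
  set norm bounded.\<close>

lemma cut_of_pairs:
  assumes "demicontinuous_on E N" "A \<in> cuts" "B \<in> cuts"
    and h: "\<And>a b. a \<in> A \<Longrightarrow> b \<in> B \<Longrightarrow> h a b \<in> E \<and> 0 \<le> h a b \<and> h a b \<le> a + b"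
    and mono: "\<And>a b a' b'. a \<le> a' \<Longrightarrow> b \<le> b' \<Longrightarrow> h a b \<le> h a' b'"
  shows "ocl {h a b | a b. a \<in> A \<and> b \<in> B} \<in> cuts"
proof -
  obtain s where s: "\<And>x. x \<in> A \<Longrightarrow> N x \<le> s" using cut_bounded[OF assms(2)] by blast
  obtain t where t: "\<And>x. x \<in> B \<Longrightarrow> N x \<le> t" using cut_bounded[OF assms(3)] by blast
  show ?thesis
  proof (rule cut_ocl[OF assms(1), where b = "s + t"])
    show "{h a b | a b. a \<in> A \<and> b \<in> B} \<subseteq> E" using h by auto
    fix p assume "p \<in> {h a b | a b. a \<in> A \<and> b \<in> B}"
    then obtain a b where ab: "a \<in> A" "b \<in> B" "p = h a b" by blast
    have E: "a \<in> E" "b \<in> E" using ab assms by (auto simp: cut_mem)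
    have "N p \<le> N (a + b)" using h[OF ab(1,2)] ab(3) E by (intro norm_mono) auto
    also have "\<dots> \<le> N a + N b" using E by (rule norm_add)
    also have "\<dots> \<le> s + t" using s t ab by (intro add_mono) auto
    finally show "0 \<le> p \<and> N p \<le> s + t" using h[OF ab(1,2)] ab(3) by simp
  next
    show "directed {h a b | a b. a \<in> A \<and> b \<in> B}"
      unfolding directed_def
    proof (intro conjI ballI)
      show "{h a b | a b. a \<in> A \<and> b \<in> B} \<noteq> {}"
        using cut_nonempty[OF assms(2)] cut_nonempty[OF assms(3)] by blast
      fix x y assume "x \<in> {h a b | a b. a \<in> A \<and> b \<in> B}" "y \<in> {h a b | a b. a \<in> A \<and> b \<in> B}"
      then obtain a b a' b' where *: "a \<in> A" "b \<in> B" "x = h a b" "a' \<in> A" "b' \<in> B" "y = h a' b'"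
        by blast
      have "sup a a' \<in> A" "sup b b' \<in> B" using * assms by (auto intro: cut_sup)
      then show "\<exists>z\<in>{h a b | a b. a \<in> A \<and> b \<in> B}. x \<le> z \<and> y \<le> z"
        using * by (intro bexI[of _ "h (sup a a') (sup b b')"]) (auto intro: mono)
    qed
  qed
qed

lemma cut_add_closed:
  assumes "demicontinuous_on E N" "A \<in> cuts" "B \<in> cuts"
  shows "cut_add A B \<in> cuts"
  unfolding cut_add_def using assms
  by (intro cut_of_pairs) (auto simp: cut_mem cut_nonneg add_mono)

text \<open>The join is the closure of all \<open>sup a b\<close>. Its compatibility with adding
  \<open>D\<close> rests on \<open>sup a b + d = sup (a + d) (b + d)\<close> and on the fact that
  the cut \<open>G\<close> is closed under suprema and under order closure.\<close>

lemma cut_join: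
  assumes "demicontinuous_on E N" and A: "A \<in> cuts" and B: "B \<in> cuts"
  obtains J where "J \<in> cuts"
    "\<And>D G. \<lbrakk>D \<in> cuts; G \<in> cuts\<rbrakk> \<Longrightarrow> cut_add J D \<subseteq> G \<longleftrightarrow> cut_add A D \<subseteq> G \<and> cut_add B D \<subseteq> G"
proof -
  define P where "P = {sup a b | a b. a \<in> A \<and> b \<in> B}"
  have J: "ocl P \<in> cuts"
    unfolding P_def using assms
    by (intro cut_of_pairs)
      (auto simp: cut_mem cut_nonneg add_increasing add_increasing2 intro: le_supI1 le_supI2)
  have PJ: "P \<subseteq> ocl P"
    using A B by (intro ocl_superset) (auto simp: P_def cut_mem cut_nonneg intro: le_supI1)
  have sub: "A \<subseteq> ocl P" "B \<subseteq> ocl P"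
  proof -
    show "A \<subseteq> ocl P"
    proof
      fix a assume a: "a \<in> A"
      have "sup a 0 \<in> P" using a zero_in_cut[OF B] by (auto simp: P_def)
      then show "a \<in> ocl P" using PJ cut_nonneg[OF A a] by (auto simp: sup_absorb1)
    qed
    show "B \<subseteq> ocl P"
    proof
      fix b assume b: "b \<in> B"
      have "sup 0 b \<in> P" using b zero_in_cut[OF A] by (auto simp: P_def)
      then show "b \<in> ocl P" using PJ cut_nonneg[OF B b] by (auto simp: sup_absorb2)
    qed
  qed
  show ?thesis
  proof (rule that[OF J])
    fix D G assume D: "D \<in> cuts" and G: "G \<in> cuts"
    show "cut_add (ocl P) D \<subseteq> G \<longleftrightarrow> cut_add A D \<subseteq> G \<and> cut_add B D \<subseteq> G" (is "?l \<longleftrightarrow> ?r")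
    proof
      assume ?l
      moreover have "cut_add A D \<subseteq> cut_add (ocl P) D" "cut_add B D \<subseteq> cut_add (ocl P) D"
        unfolding cut_add_def using sub by (intro ocl_mono; blast)+
      ultimately show ?r by blast
    next
      assume r: ?r
      show ?l
      proof (rule cut_add_subset[OF G])
        fix j d assume jd: "j \<in> ocl P" "d \<in> D"
        have "p + d \<in> G" if p: "p \<in> P" for p
        proof -
          obtain a b where ab: "a \<in> A" "b \<in> B" "p = sup a b" using p by (auto simp: P_def)
          have "a + d \<in> G" "b + d \<in> G"
            using r ab jd A B D by (auto intro: cut_addI)
          then have "sup (a + d) (b + d) \<in> G" using G by (intro cut_sup)
          then show ?thesis using ab by (simp add: add_sup_distrib_right)
        qed
        then have "j + d \<in> ocl G"
          using jd D by (intro ocl_add[OF jd(1)]) (auto simp: cut_mem cut_nonneg)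
        then show "j + d \<in> G" using G by (simp add: ocl_cut)
      qed
    qed
  qed
qed

lemma cuts_cone:
  assumes "demicontinuous_on E N"
  shows "cancellative_cone cuts cut_add {0} cut_scale (\<subseteq>)"
proof
  fix A B D assume A: "A \<in> cuts" and B: "B \<in> cuts"
  show "\<exists>J\<in>cuts. \<forall>D\<in>cuts. \<forall>G\<in>cuts. cut_add J D \<subseteq> G \<longleftrightarrow> cut_add A D \<subseteq> G \<and> cut_add B D \<subseteq> G"
    using cut_join[OF assms A B] by metis
  show "A \<subseteq> B \<Longrightarrow> \<exists>D\<in>cuts. B = cut_add A D"
    using cut_add_diff[OF A B] by metis
  show "cut_add A D \<subseteq> cut_add B D \<longleftrightarrow> A \<subseteq> B" if D: "D \<in> cuts"
  proof
    show "A \<subseteq> B" if "cut_add A D \<subseteq> cut_add B D"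
      using A B D that by (rule cut_add_cancel)
    show "cut_add A D \<subseteq> cut_add B D" if "A \<subseteq> B"
      unfolding cut_add_def using that by (intro ocl_mono) blast
  qed
  show "cut_add A B \<in> cuts" using assms A B by (rule cut_add_closed)
  show "cut_scale s A \<in> cuts" if "0 \<le> s" for s using A that by (rule cut_scale_closed)
  show "cut_add A B = cut_add B A" by (rule cut_add_commute)
  show "cut_add (cut_add A B) D = cut_add A (cut_add B D)" if "D \<in> cuts"
    using A B that by (rule cut_add_assoc)
  show "cut_add {0} A = A" using A by (rule cut_add_zero)
  show "{0} \<subseteq> A" using zero_in_cut[OF A] by simp
  show "cut_scale s (cut_add A B) = cut_add (cut_scale s A) (cut_scale s B)" if "0 \<le> s" for s
    using A B that by (rule cut_scale_add)
  show "cut_scale (s + t) A = cut_add (cut_scale s A) (cut_scale t A)" if "0 \<le> s" "0 \<le> t" for s t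
    using A that by (rule cut_add_scale)
qed (auto simp: zero_cut cut_scale_def image_image)

end

section \<open>Differences of a cancellative cone\<close>

text \<open>\<open>mk a b\<close> stands for the formal difference \<open>a - b\<close>.\<close>

locale cone_differences = cancellative_cone C add zero smul le
  for C :: "'c set" and add (infixl \<open>[+]\<close> 65) and zero smul and le (infix \<open>[\<le>]\<close> 50) +
  fixes mk :: "'c \<Rightarrow> 'c \<Rightarrow> 'g"
  assumes mk_eq_iff: "\<lbrakk>a \<in> C; b \<in> C; c \<in> C; d \<in> C\<rbrakk> \<Longrightarrow> mk a b = mk c d \<longleftrightarrow> a [+] d = c [+] b"
begin

lemmas cone_closed [simp] = cone_add_closed cone_zero_closed cone_smul_closed

lemma cone_left_comm: "\<lbrakk>a \<in> C; b \<in> C; c \<in> C\<rbrakk> \<Longrightarrow> a [+] (b [+] c) = b [+] (a [+] c)"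
  by (metis cone_assoc cone_comm)

lemmas cone_ac = cone_assoc cone_comm cone_left_comm

lemma cone_add_eq: "\<lbrakk>a \<in> C; b \<in> C; c \<in> C\<rbrakk> \<Longrightarrow> a [+] c = b [+] c \<longleftrightarrow> a = b"
  by (metis cone_add_le cone_antisym cone_refl)

lemma cone_zero_right: "a \<in> C \<Longrightarrow> a [+] zero = a"
  using cone_zero[of a] by (simp add: cone_comm)

lemma cone_smul_zero: "0 \<le> s \<Longrightarrow> smul s zero = zero"
  using cone_smul_add[of s zero zero] cone_add_eq[of zero "smul s zero" "smul s zero"]
  by (simp add: cone_zero)

lemma cone_zero_smul: "a \<in> C \<Longrightarrow> smul 0 a = zero"
  using cone_add_smul[of 0 0 a] cone_add_eq[of zero "smul 0 a" "smul 0 a"]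
  by (simp add: cone_zero)

lemma cone_smul_mono:
  assumes "a [\<le>] b" "a \<in> C" "b \<in> C" "0 \<le> s" shows "smul s a [\<le>] smul s b"
proof -
  obtain d where d: "d \<in> C" "b = a [+] d" using cone_diff assms by blast
  have "zero [+] smul s a [\<le>] smul s d [+] smul s a"
    using d assms by (simp only: cone_add_le cone_zero_le cone_closed)
  then show ?thesis using d assms by (simp add: cone_zero cone_smul_add cone_comm)
qed

definition differences :: "'g set"
  where "differences = {mk a b | a b. a \<in> C \<and> b \<in> C}"

text \<open>The operations on differences go through one chosen representation;
  \<open>diff_add_mk\<close>, \<open>diff_smul_mk\<close> and \<open>diff_le_mk\<close> show that
  the choice does not matter.\<close>

definition decomposition :: "'g \<Rightarrow> 'c \<times> 'c"
  where "decomposition x = (SOME p. fst p \<in> C \<and> snd p \<in> C \<and> x = mk (fst p) (snd p))"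

definition diff_add :: "'g \<Rightarrow> 'g \<Rightarrow> 'g"
  where "diff_add x y =
    (case decomposition x of (a, b) \<Rightarrow> case decomposition y of (c, d) \<Rightarrow> mk (a [+] c) (b [+] d))"

definition diff_smul :: "real \<Rightarrow> 'g \<Rightarrow> 'g"
  where "diff_smul s x = (case decomposition x of (a, b) \<Rightarrow>
    if 0 \<le> s then mk (smul s a) (smul s b) else mk (smul (- s) b) (smul (- s) a))"

definition diff_le :: "'g \<Rightarrow> 'g \<Rightarrow> bool"
  where "diff_le x y \<longleftrightarrow>
    (case decomposition x of (a, b) \<Rightarrow> case decomposition y of (c, d) \<Rightarrow> a [+] d [\<le>] c [+] b)"

lemma mk_mem [simp]: "a \<in> C \<Longrightarrow> b \<in> C \<Longrightarrow> mk a b \<in> differences"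
  by (auto simp: differences_def)

lemma differencesE:
  assumes "x \<in> differences" obtains a b where "a \<in> C" "b \<in> C" "x = mk a b"
  using assms by (auto simp: differences_def)

lemma decomposition_mk:
  assumes "a \<in> C" "b \<in> C"
  obtains a' b' where "decomposition (mk a b) = (a', b')" "a' \<in> C" "b' \<in> C" "a' [+] b = a [+] b'"
proof -
  let ?p = "decomposition (mk a b)"
  have "fst ?p \<in> C \<and> snd ?p \<in> C \<and> mk a b = mk (fst ?p) (snd ?p)"
    unfolding decomposition_def by (rule someI[of _ "(a, b)"]) (use assms in simp)
  then show ?thesis
    using that[of "fst ?p" "snd ?p"] assms mk_eq_iff[of a b "fst ?p" "snd ?p"] by simp
qed

lemma diff_add_mk:
  assumes "a \<in> C" "b \<in> C" "c \<in> C" "d \<in> C"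
  shows "diff_add (mk a b) (mk c d) = mk (a [+] c) (b [+] d)"
proof -
  obtain a' b' where 1: "decomposition (mk a b) = (a', b')" "a' \<in> C" "b' \<in> C" "a' [+] b = a [+] b'"
    using decomposition_mk assms by metis
  obtain c' d' where 2: "decomposition (mk c d) = (c', d')" "c' \<in> C" "d' \<in> C" "c' [+] d = c [+] d'"
    using decomposition_mk assms by metis
  have "(a' [+] c') [+] (b [+] d) = (a' [+] b) [+] (c' [+] d)"
    using assms 1(2,3) 2(2,3) by (simp add: cone_ac)
  also have "\<dots> = (a [+] c) [+] (b' [+] d')"
    unfolding 1 2 using assms 1(2,3) 2(2,3) by (simp add: cone_ac)
  finally show ?thesis
    using assms 1 2 by (simp add: diff_add_def mk_eq_iff)
qed

lemma diff_smul_mk: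
  assumes "a \<in> C" "b \<in> C"
  shows "diff_smul s (mk a b) =
    (if 0 \<le> s then mk (smul s a) (smul s b) else mk (smul (- s) b) (smul (- s) a))"
proof -
  obtain a' b' where 1: "decomposition (mk a b) = (a', b')" "a' \<in> C" "b' \<in> C" "a' [+] b = a [+] b'"
    using decomposition_mk assms by metis
  have *: "smul t a' [+] smul t b = smul t a [+] smul t b'" if "0 \<le> t" for t
    using that assms 1 by (simp flip: cone_smul_add)
  show ?thesis
  proof (cases "0 \<le> s")
    case True
    then show ?thesis using * assms 1 by (simp add: diff_smul_def mk_eq_iff)
  next
    case False
    then show ?thesis
      using *[of "- s"] assms 1 by (simp add: diff_smul_def mk_eq_iff) (metis cone_comm cone_smul_closed
        neg_0_le_iff_le nle_le)
  qed
qed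

lemma diff_le_mk:
  assumes "a \<in> C" "b \<in> C" "c \<in> C" "d \<in> C"
  shows "diff_le (mk a b) (mk c d) \<longleftrightarrow> a [+] d [\<le>] c [+] b"
proof -
  obtain a' b' where 1: "decomposition (mk a b) = (a', b')" "a' \<in> C" "b' \<in> C" "a' [+] b = a [+] b'"
    using decomposition_mk assms by metis
  obtain c' d' where 2: "decomposition (mk c d) = (c', d')" "c' \<in> C" "d' \<in> C" "c' [+] d = c [+] d'"
    using decomposition_mk assms by metis
  have "diff_le (mk a b) (mk c d) \<longleftrightarrow> a' [+] d' [\<le>] c' [+] b'"
    using 1 2 by (simp add: diff_le_def)
  also have "\<dots> \<longleftrightarrow> (a' [+] d') [+] (b [+] d) [\<le>] (c' [+] b') [+] (b [+] d)"
    using assms 1 2 by (simp add: cone_add_le)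
  also have "(a' [+] d') [+] (b [+] d) = (a' [+] b) [+] (d [+] d')"
    using assms 1(2,3) 2(2,3) by (simp add: cone_ac)
  also have "\<dots> = (a [+] d) [+] (b' [+] d')"
    unfolding 1 using assms 1(2,3) 2(2,3) by (simp add: cone_ac)
  also have "(c' [+] b') [+] (b [+] d) = (c' [+] d) [+] (b [+] b')"
    using assms 1(2,3) 2(2,3) by (simp add: cone_ac)
  also have "\<dots> = (c [+] b) [+] (b' [+] d')"
    unfolding 2 using assms 1(2,3) 2(2,3) by (simp add: cone_ac)
  also have "(a [+] d) [+] (b' [+] d') [\<le>] (c [+] b) [+] (b' [+] d') \<longleftrightarrow> a [+] d [\<le>] c [+] b"
    using assms 1 2 by (simp add: cone_add_le)
  finally show ?thesis .
qed

text \<open>The norm field is a placeholder. The norm of the completion is defined in terms of its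
  vector lattice structure and overwrites this field afterwards.\<close>

definition diff_lattice :: "'g normed_lattice"
  where "diff_lattice = \<lparr>carrier = differences, monoid.mult = (\<lambda>_ _. undefined), one = undefined,
    ring.zero = mk zero zero, add = diff_add, module.smult = diff_smul, vle = diff_le, vnorm = (\<lambda>_. 0)\<rparr>"

lemma diff_lattice_sel [simp]:
  "carrier diff_lattice = differences" "\<zero>\<^bsub>diff_lattice\<^esub> = mk zero zero"
  "x \<oplus>\<^bsub>diff_lattice\<^esub> y = diff_add x y" "s \<odot>\<^bsub>diff_lattice\<^esub> x = diff_smul s x"
  "x \<preceq>\<^bsub>diff_lattice\<^esub> y \<longleftrightarrow> diff_le x y"
  by (simp_all add: diff_lattice_def)

lemma diff_le_trans:
  assumes "diff_le x y" "diff_le y z" "x \<in> differences" "y \<in> differences" "z \<in> differences"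
  shows "diff_le x z"
proof -
  obtain a b where x: "a \<in> C" "b \<in> C" "x = mk a b" using assms by (elim differencesE)
  obtain c d where y: "c \<in> C" "d \<in> C" "y = mk c d" using assms by (elim differencesE)
  obtain e f where z: "e \<in> C" "f \<in> C" "z = mk e f" using assms by (elim differencesE)
  note C = x(1,2) y(1,2) z(1,2)
  have "(a [+] d) [+] f [\<le>] (c [+] b) [+] f"
    using assms(1) C by (simp add: x y diff_le_mk cone_add_le)
  moreover have "(c [+] f) [+] b [\<le>] (e [+] d) [+] b"
    using assms(2) C by (simp add: y z diff_le_mk cone_add_le)
  moreover have "(c [+] b) [+] f = (c [+] f) [+] b" using C by (simp add: cone_ac)
  ultimately have "(a [+] d) [+] f [\<le>] (e [+] d) [+] b"
    using C cone_trans[of "(a [+] d) [+] f" "(c [+] f) [+] b" "(e [+] d) [+] b"] by simp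
  moreover have "(a [+] d) [+] f = (a [+] f) [+] d" "(e [+] d) [+] b = (e [+] b) [+] d"
    using C by (simp_all add: cone_ac)
  ultimately show ?thesis using C by (simp add: x z diff_le_mk cone_add_le)
qed

text \<open>Over the common subtrahend \<open>b [+] d\<close>, the supremum of \<open>a - b\<close>
  and \<open>c - d\<close> is the join of \<open>a [+] d\<close> and \<open>c [+] b\<close>. An
  upper bound \<open>mk e f\<close> is tested by adding \<open>f\<close>, and this is what the
  translated form of \<open>cone_join\<close> provides.\<close>

lemma diff_sup_exists:
  assumes "x \<in> differences" "y \<in> differences"
  shows "\<exists>s\<in>differences. diff_le x s \<and> diff_le y s \<and>
    (\<forall>u\<in>differences. diff_le x u \<and> diff_le y u \<longrightarrow> diff_le s u)"
proof -
  obtain a b where x: "a \<in> C" "b \<in> C" "x = mk a b" using assms by (elim differencesE)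
  obtain c d where y: "c \<in> C" "d \<in> C" "y = mk c d" using assms by (elim differencesE)
  note C = x(1,2) y(1,2)
  obtain j where j: "j \<in> C" "\<And>e g. \<lbrakk>e \<in> C; g \<in> C\<rbrakk> \<Longrightarrow>
      j [+] e [\<le>] g \<longleftrightarrow> (a [+] d) [+] e [\<le>] g \<and> (c [+] b) [+] e [\<le>] g"
    using cone_join[of "a [+] d" "c [+] b"] C by (metis cone_closed(1))
  show ?thesis
  proof (intro bexI[of _ "mk j (b [+] d)"] conjI ballI impI)
    show "mk j (b [+] d) \<in> differences" using C j by simp
    have "(a [+] d) [+] b [\<le>] j [+] b" "(c [+] b) [+] d [\<le>] j [+] d"
      using j(2)[of b "j [+] b"] j(2)[of d "j [+] d"] C j(1) by (simp_all add: cone_refl)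
    moreover have "a [+] (b [+] d) = (a [+] d) [+] b" "c [+] (b [+] d) = (c [+] b) [+] d"
      using C by (simp_all add: cone_ac)
    ultimately show "diff_le x (mk j (b [+] d))" "diff_le y (mk j (b [+] d))"
      using C j(1) by (simp_all add: x y diff_le_mk)
    fix u assume u: "u \<in> differences" "diff_le x u \<and> diff_le y u"
    then obtain e f where ef: "e \<in> C" "f \<in> C" "u = mk e f" by (elim differencesE)
    have "(a [+] f) [+] d [\<le>] (e [+] b) [+] d" "(c [+] f) [+] b [\<le>] (e [+] d) [+] b"
      using u(2) C ef by (simp_all add: x y diff_le_mk cone_add_le)
    then have "j [+] f [\<le>] e [+] (b [+] d)"
      using C ef j(1) by (simp add: j(2)) (simp add: cone_ac)
    then show "diff_le (mk j (b [+] d)) u" using C ef j(1) by (simp add: diff_le_mk)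
  qed
qed

text \<open>Exchanging the entries of a formal difference is negation, so the infimum is the
  negative of the supremum of the negatives.\<close>

lemma diff_inf_exists:
  assumes "x \<in> differences" "y \<in> differences"
  shows "\<exists>s\<in>differences. diff_le s x \<and> diff_le s y \<and>
    (\<forall>u\<in>differences. diff_le u x \<and> diff_le u y \<longrightarrow> diff_le u s)"
proof -
  obtain a b where x: "a \<in> C" "b \<in> C" "x = mk a b" using assms by (elim differencesE)
  obtain c d where y: "c \<in> C" "d \<in> C" "y = mk c d" using assms by (elim differencesE)
  note C = x(1,2) y(1,2)
  obtain s where s: "s \<in> differences" "diff_le (mk b a) s" "diff_le (mk d c) s"
    "\<And>u. \<lbrakk>u \<in> differences; diff_le (mk b a) u; diff_le (mk d c) u\<rbrakk> \<Longrightarrow> diff_le s u"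
    using diff_sup_exists[of "mk b a" "mk d c"] C by auto
  obtain p q where pq: "p \<in> C" "q \<in> C" "s = mk p q" using s(1) by (elim differencesE)
  show ?thesis
  proof (intro bexI[of _ "mk q p"] conjI ballI impI)
    show "diff_le (mk q p) x" "diff_le (mk q p) y"
      using s(2,3) C pq by (simp_all add: x y diff_le_mk cone_comm)
    fix u assume u: "u \<in> differences" "diff_le u x \<and> diff_le u y"
    then obtain e f where ef: "e \<in> C" "f \<in> C" "u = mk e f" by (elim differencesE)
    have "diff_le s (mk f e)"
      using u(2) C ef pq by (intro s(4)) (simp_all add: x y diff_le_mk cone_comm)
    then show "diff_le u (mk q p)" using ef pq by (simp add: diff_le_mk cone_comm)
  qed (use pq in simp)
qed

lemma module_diff_lattice: "Module.module real_ring diff_lattice"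
proof (rule moduleI)
  show "cring real_ring" by (rule cring_from_type_algebra)
  show "abelian_group diff_lattice"
  proof (rule abelian_groupI)
    fix x assume "x \<in> carrier diff_lattice"
    then obtain a b where x: "a \<in> C" "b \<in> C" "x = mk a b" by (auto elim: differencesE)
    show "\<zero>\<^bsub>diff_lattice\<^esub> \<oplus>\<^bsub>diff_lattice\<^esub> x = x"
      using x by (simp add: diff_add_mk cone_zero)
    show "\<exists>y\<in>carrier diff_lattice. y \<oplus>\<^bsub>diff_lattice\<^esub> x = \<zero>\<^bsub>diff_lattice\<^esub>"
      using x by (intro bexI[of _ "mk b a"]) (simp_all add: diff_add_mk mk_eq_iff cone_zero
        cone_zero_right cone_comm)
  qed (auto elim!: differencesE simp: diff_add_mk cone_ac)
  fix x assume "x \<in> carrier diff_lattice"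
  then obtain a b where x: "a \<in> C" "b \<in> C" "x = mk a b" by (auto elim: differencesE)
  show "s \<odot>\<^bsub>diff_lattice\<^esub> x \<in> carrier diff_lattice" for s
    using x by (simp add: diff_smul_mk)
  show "\<one>\<^bsub>real_ring\<^esub> \<odot>\<^bsub>diff_lattice\<^esub> x = x"
    using x by (simp add: diff_smul_mk cone_one_smul)
  have mul: "diff_smul s (diff_smul t x) = diff_smul (s * t) x" for s t
    using x by (cases "0 \<le> s"; cases "0 \<le> t"; cases "s = 0"; cases "t = 0")
      (simp_all add: diff_smul_mk cone_smul_smul cone_zero_smul cone_smul_zero zero_le_mult_iff
        mult_nonpos_nonpos mk_eq_iff)
  then show "(s \<otimes>\<^bsub>real_ring\<^esub> t) \<odot>\<^bsub>diff_lattice\<^esub> x =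
      s \<odot>\<^bsub>diff_lattice\<^esub> (t \<odot>\<^bsub>diff_lattice\<^esub> x)" for s t
    by simp
  show "s \<odot>\<^bsub>diff_lattice\<^esub> (x \<oplus>\<^bsub>diff_lattice\<^esub> y) =
      s \<odot>\<^bsub>diff_lattice\<^esub> x \<oplus>\<^bsub>diff_lattice\<^esub> s \<odot>\<^bsub>diff_lattice\<^esub> y"
    if "y \<in> carrier diff_lattice" for s y
  proof -
    obtain c d where "c \<in> C" "d \<in> C" "y = mk c d" using \<open>y \<in> _\<close> by (auto elim: differencesE)
    then show ?thesis using x by (simp add: diff_smul_mk diff_add_mk cone_smul_add)
  qed
  have neg: "diff_smul (- s) x = mk (smul s b) (smul s a)" if "0 \<le> s" for s
    using that x by (cases "s = 0") (simp_all add: diff_smul_mk cone_zero_smul mk_eq_iff)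
  have pos: "diff_smul s x = mk (smul s a) (smul s b)" if "0 \<le> s" for s
    using that x by (simp add: diff_smul_mk)
  \<comment> \<open>The definition of \<open>diff_smul\<close> splits by sign. A formula valid for
    every representation of a scalar as a difference of nonnegative numbers turns additivity in the
    scalar into an identity of the cone, without cases for the signs of two scalars and of their
    sum.\<close>
  have dist: "diff_smul (s - t) x = mk (smul s a [+] smul t b) (smul s b [+] smul t a)"
    if st: "0 \<le> s" "0 \<le> t" for s t
  proof (cases "t \<le> s")
    case True
    then have s: "smul s c = smul (s - t) c [+] smul t c" if "c \<in> C" for c
      using cone_add_smul[of "s - t" t c] st that by simp
    show ?thesis
      using True st x pos[of "s - t"] by (simp add: mk_eq_iff s[OF x(1)] s[OF x(2)] cone_ac)
  next
    case False
    then have t: "smul t c = smul (t - s) c [+] smul s c" if "c \<in> C" for c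
      using cone_add_smul[of "t - s" s c] st that by simp
    show ?thesis
      using False st x neg[of "t - s"] by (simp add: mk_eq_iff t[OF x(1)] t[OF x(2)] cone_ac)
  qed
  have split: "diff_smul s x = mk (smul (max s 0) a [+] smul (max (- s) 0) b)
      (smul (max s 0) b [+] smul (max (- s) 0) a)" for s
  proof -
    have "max s 0 - max (- s) 0 = s" by (simp add: max_def)
    then show ?thesis
      using dist[OF max.cobounded2[of 0 s] max.cobounded2[of 0 "- s"]] by (simp only:)
  qed
  show "(s \<oplus>\<^bsub>real_ring\<^esub> t) \<odot>\<^bsub>diff_lattice\<^esub> x =
      s \<odot>\<^bsub>diff_lattice\<^esub> x \<oplus>\<^bsub>diff_lattice\<^esub> t \<odot>\<^bsub>diff_lattice\<^esub> x" for s t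
  proof -
    let ?p = "max s 0" and ?n = "max (- s) 0" and ?q = "max t 0" and ?m = "max (- t) 0"
    have "s + t = (?p + ?q) - (?n + ?m)" by (simp add: max_def)
    then have "diff_smul (s + t) x = mk (smul (?p + ?q) a [+] smul (?n + ?m) b)
        (smul (?p + ?q) b [+] smul (?n + ?m) a)"
      using dist[of "?p + ?q" "?n + ?m"] by simp
    also have "\<dots> = mk ((smul ?p a [+] smul ?n b) [+] (smul ?q a [+] smul ?m b))
        ((smul ?p b [+] smul ?n a) [+] (smul ?q b [+] smul ?m a))"
      using x by (simp add: cone_add_smul cone_ac)
    also have "\<dots> = diff_add (diff_smul s x) (diff_smul t x)"
      unfolding split using x by (simp add: diff_add_mk)
    finally show ?thesis by simp
  qed
qed

lemma vector_lattice_diff_lattice: "vector_lattice diff_lattice"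
proof (intro vector_lattice.intro module_diff_lattice)
  let ?L = "ord_of diff_lattice"
  have refl: "diff_le x x" if "x \<in> differences" for x
    using that by (elim differencesE) (simp add: diff_le_mk cone_refl)
  have antisym: "x = y" if "diff_le x y" "diff_le y x" "x \<in> differences" "y \<in> differences" for x y
    using that by (elim differencesE) (simp add: diff_le_mk mk_eq_iff cone_antisym)
  interpret partial_order ?L
    by unfold_locales (auto intro: refl antisym diff_le_trans)
  show "Lattice.lattice ?L"
  proof
    fix x y assume "x \<in> carrier ?L" "y \<in> carrier ?L"
    then have xy: "x \<in> differences" "y \<in> differences" by simp_all
    show "\<exists>s. least ?L s (Upper ?L {x, y})"
      using diff_sup_exists[OF xy] xy by (auto simp: least_def Upper_def)
    show "\<exists>s. greatest ?L s (Lower ?L {x, y})"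
      using diff_inf_exists[OF xy] xy by (auto simp: greatest_def Lower_def)
  qed
  show "vector_lattice_axioms diff_lattice"
  proof
    fix x y z
    assume *: "x \<in> carrier diff_lattice" "y \<in> carrier diff_lattice"
      "z \<in> carrier diff_lattice" "x \<preceq>\<^bsub>diff_lattice\<^esub> y"
    then have *: "x \<in> differences" "y \<in> differences" "z \<in> differences" "diff_le x y"
      by simp_all
    obtain a b where x: "a \<in> C" "b \<in> C" "x = mk a b" using * by (elim differencesE)
    obtain c d where y: "c \<in> C" "d \<in> C" "y = mk c d" using * by (elim differencesE)
    obtain e f where z: "e \<in> C" "f \<in> C" "z = mk e f" using * by (elim differencesE)
    note C = x(1,2) y(1,2) z(1,2)
    have "(a [+] d) [+] (e [+] f) [\<le>] (c [+] b) [+] (e [+] f)"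
      using *(4) C by (simp add: x y diff_le_mk cone_add_le)
    moreover have "(a [+] d) [+] (e [+] f) = (a [+] e) [+] (d [+] f)"
      "(c [+] b) [+] (e [+] f) = (c [+] e) [+] (b [+] f)"
      using C by (simp_all add: cone_ac)
    ultimately show "x \<oplus>\<^bsub>diff_lattice\<^esub> z \<preceq>\<^bsub>diff_lattice\<^esub> y \<oplus>\<^bsub>diff_lattice\<^esub> z"
      using C by (simp add: x y z diff_add_mk diff_le_mk)
  next
    fix s :: real and x
    assume *: "0 \<le> s" "x \<in> carrier diff_lattice"
      "\<zero>\<^bsub>diff_lattice\<^esub> \<preceq>\<^bsub>diff_lattice\<^esub> x"
    then obtain a b where x: "a \<in> C" "b \<in> C" "x = mk a b" by (auto elim: differencesE)
    then have "b [\<le>] a" using * by (simp add: diff_le_mk cone_zero cone_zero_right)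
    then show "\<zero>\<^bsub>diff_lattice\<^esub> \<preceq>\<^bsub>diff_lattice\<^esub> s \<odot>\<^bsub>diff_lattice\<^esub> x"
      using * x by (simp add: diff_le_mk diff_smul_mk cone_zero cone_zero_right cone_smul_mono)
  qed
qed

definition positive_difference :: "'c \<Rightarrow> 'g"
  where "positive_difference a = mk a zero"

lemma positive_difference:
  assumes "a \<in> C" "b \<in> C"
  shows "positive_difference a \<in> differences"
    and "diff_add (positive_difference a) (positive_difference b) = positive_difference (a [+] b)"
    and "0 \<le> s \<Longrightarrow> diff_smul s (positive_difference a) = positive_difference (smul s a)"
    and "diff_le (positive_difference a) (positive_difference b) \<longleftrightarrow> a [\<le>] b"
  using assms by (simp_all add: positive_difference_def diff_add_mk diff_smul_mk diff_le_mk
    cone_zero cone_zero_right cone_smul_zero)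

text \<open>\<open>cone_diff\<close> makes every nonnegative formal difference an element of the
  cone: passing to differences adds no positive elements.\<close>

lemma positive_differenceE:
  assumes "x \<in> differences" "diff_le (mk zero zero) x"
  obtains a where "a \<in> C" "x = positive_difference a"
proof -
  obtain a b where x: "a \<in> C" "b \<in> C" "x = mk a b" using assms by (elim differencesE)
  then have "b [\<le>] a" using assms(2) by (simp add: diff_le_mk cone_zero cone_zero_right)
  then obtain d where d: "d \<in> C" "a = b [+] d" using cone_diff x by blast
  have "x = positive_difference d"
    using x d by (simp add: positive_difference_def mk_eq_iff cone_zero_right cone_zero cone_comm)
  with d show ?thesis using that by blast
qed

end

section \<open>Representations of carrier-based lattices\<close>

locale lattice_representation = vector_lattice V
  for V :: "('a, 'm) vector_lattice_scheme" (structure) +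
  fixes rep :: "'a \<Rightarrow> 'v::real_vector_lattice"
  assumes rep_inj: "inj_on rep (carrier V)"
    and rep_add: "\<lbrakk>x \<in> carrier V; y \<in> carrier V\<rbrakk> \<Longrightarrow> rep (x \<oplus> y) = rep x + rep y"
    and rep_smult: "x \<in> carrier V \<Longrightarrow> rep (a \<odot> x) = a *\<^sub>R rep x"
    and rep_join: "\<lbrakk>x \<in> carrier V; y \<in> carrier V\<rbrakk> \<Longrightarrow> rep (vjoin V x y) = sup (rep x) (rep y)"
    and rep_meet: "\<lbrakk>x \<in> carrier V; y \<in> carrier V\<rbrakk> \<Longrightarrow> rep (vmeet V x y) = inf (rep x) (rep y)"
    and rep_le: "\<lbrakk>x \<in> carrier V; y \<in> carrier V\<rbrakk> \<Longrightarrow> rep x \<le> rep y \<longleftrightarrow> x \<preceq> y"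

lemma lattice_representation_exists:
  fixes V :: "'a normed_lattice"
  assumes "vector_lattice V"
  obtains rep :: "'a \<Rightarrow> 'a lattice_section" where "lattice_representation V rep"
proof -
  interpret vector_lattice V by fact
  \<comment> \<open>An element is placed in the coordinate of its own lattice and zero in all
    others, where every required identity concerns zeros only.\<close>
  define s where
    "s x = (\<lambda>W. if W = V then x else if vector_lattice W then \<zero>\<^bsub>W\<^esub> else undefined)" for x
  define rep where "rep x = Abs_lattice_section (s x)" for x
  have zero: "\<zero>\<^bsub>W\<^esub> \<in> carrier W" "\<zero>\<^bsub>W\<^esub> \<oplus>\<^bsub>W\<^esub> \<zero>\<^bsub>W\<^esub> = \<zero>\<^bsub>W\<^esub>" "a \<odot>\<^bsub>W\<^esub> \<zero>\<^bsub>W\<^esub> = \<zero>\<^bsub>W\<^esub>"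
      "\<zero>\<^bsub>W\<^esub> \<preceq>\<^bsub>W\<^esub> \<zero>\<^bsub>W\<^esub>" "vjoin W \<zero>\<^bsub>W\<^esub> \<zero>\<^bsub>W\<^esub> = \<zero>\<^bsub>W\<^esub>" "vmeet W \<zero>\<^bsub>W\<^esub> \<zero>\<^bsub>W\<^esub> = \<zero>\<^bsub>W\<^esub>"
    if "vector_lattice W" for W :: "'a normed_lattice" and a
  proof -
    interpret W: vector_lattice W by fact
    show "\<zero>\<^bsub>W\<^esub> \<in> carrier W" "\<zero>\<^bsub>W\<^esub> \<oplus>\<^bsub>W\<^esub> \<zero>\<^bsub>W\<^esub> = \<zero>\<^bsub>W\<^esub>" "a \<odot>\<^bsub>W\<^esub> \<zero>\<^bsub>W\<^esub> = \<zero>\<^bsub>W\<^esub>" "\<zero>\<^bsub>W\<^esub> \<preceq>\<^bsub>W\<^esub> \<zero>\<^bsub>W\<^esub>"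
      using W.smult_r_null[of a] by (simp_all add: W.vle_refl)
    show "vjoin W \<zero>\<^bsub>W\<^esub> \<zero>\<^bsub>W\<^esub> = \<zero>\<^bsub>W\<^esub>"
      by (intro W.vle_antisym[OF W.vjoin_least W.vjoin_upper(1)] W.vjoin_closed W.vle_refl
        W.M.zero_closed)
    show "vmeet W \<zero>\<^bsub>W\<^esub> \<zero>\<^bsub>W\<^esub> = \<zero>\<^bsub>W\<^esub>"
      by (intro W.vle_antisym[OF W.vmeet_lower(1) W.vmeet_greatest] W.vmeet_closed W.vle_refl
        W.M.zero_closed)
  qed
  have Rep: "Rep_lattice_section (rep x) W = s x W" if "x \<in> carrier V" for x W
  proof -
    have "if vector_lattice U then s x U \<in> carrier U else s x U = undefined" for U
      using that zero(1)[of U] assms by (cases "U = V") (simp_all add: s_def)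
    then have "s x \<in> {t. \<forall>U. if vector_lattice U then t U \<in> carrier U else t U = undefined}"
      by blast
    from Abs_lattice_section_inverse[OF this] show ?thesis by (simp only: rep_def)
  qed
  show ?thesis
  proof (rule that, intro lattice_representation.intro[OF assms] lattice_representation_axioms.intro)
    show "inj_on rep (carrier V)"
    proof (rule inj_onI)
      fix x y assume "x \<in> carrier V" "y \<in> carrier V" "rep x = rep y"
      then have "s x V = s y V" by (metis Rep)
      then show "x = y" by (simp add: s_def)
    qed
    fix x assume x: "x \<in> carrier V"
    show "rep (a \<odot>\<^bsub>V\<^esub> x) = a *\<^sub>R rep x" for a
      using x zero by (intro section_eqI) (simp add: Rep vsmult_closed section_rep s_def)
    fix y assume y: "y \<in> carrier V"
    show "rep (x \<oplus>\<^bsub>V\<^esub> y) = rep x + rep y"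
      using x y zero by (intro section_eqI) (simp add: Rep section_rep s_def)
    show "rep (vjoin V x y) = sup (rep x) (rep y)"
      using x y zero by (intro section_eqI) (simp add: Rep section_rep s_def vjoin_closed)
    show "rep (vmeet V x y) = inf (rep x) (rep y)"
      using x y zero by (intro section_eqI) (simp add: Rep section_rep s_def vmeet_closed)
    show "rep x \<le> rep y \<longleftrightarrow> x \<preceq>\<^bsub>V\<^esub> y"
      using x y zero assms unfolding less_eq_lattice_section.rep_eq
      by (auto simp: Rep s_def split: if_splits)
  qed
qed

context lattice_representation
begin

abbreviation img :: "'v set" where "img \<equiv> rep ` carrier V"

lemma rep_eq_iff: "\<lbrakk>x \<in> carrier V; y \<in> carrier V\<rbrakk> \<Longrightarrow> rep x = rep y \<longleftrightarrow> x = y"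
  using rep_inj by (auto simp: inj_on_eq_iff)

lemma rep_zero: "rep \<zero> = 0"
  using rep_add[of \<zero> \<zero>] by simp

lemma rep_minus:
  assumes "x \<in> carrier V" shows "rep (\<ominus> x) = - rep x"
proof -
  have "rep (\<ominus> x) + rep x = 0"
    using assms by (simp add: rep_zero M.l_neg flip: rep_add)
  then show ?thesis by (simp add: add_eq_0_iff2)
qed

lemma rep_diff: "\<lbrakk>x \<in> carrier V; y \<in> carrier V\<rbrakk> \<Longrightarrow> rep (x \<ominus> y) = rep x - rep y"
  by (simp add: M.minus_eq rep_add rep_minus)

lemma rep_abs: "x \<in> carrier V \<Longrightarrow> rep (vabs V x) = \<bar>rep x\<bar>"
  by (simp add: vabs_def rep_join rep_minus abs_lattice)

lemma rep_nonneg: "x \<in> carrier V \<Longrightarrow> 0 \<le> rep x \<longleftrightarrow> \<zero> \<preceq> x"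
  using rep_le[of \<zero> x] by (simp add: rep_zero)

lemma vabs_closed: "x \<in> carrier V \<Longrightarrow> vabs V x \<in> carrier V"
  by (simp add: vabs_def vjoin_closed)

lemma linear_sublattice_image: "linear_sublattice img"
proof
  show "0 \<in> img" using rep_zero M.zero_closed by (metis imageI)
  show "x + y \<in> img" if "x \<in> img" "y \<in> img" for x y
    using that by (auto simp flip: rep_add)
  show "a *\<^sub>R x \<in> img" if "x \<in> img" for a x
    using that by (auto simp: vsmult_closed simp flip: rep_smult)
  show "sup x y \<in> img" if "x \<in> img" "y \<in> img" for x y
    using that by (auto simp: vjoin_closed simp flip: rep_join)
qed

lemma up_directed_iff: "P \<subseteq> carrier V \<Longrightarrow> up_directed V P \<longleftrightarrow> directed (rep ` P)"
  unfolding up_directed_def directed_def by (simp add: rep_le subset_iff)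

lemma is_sup_iff:
  assumes "P \<subseteq> carrier V" "f \<in> carrier V"
  shows "is_sup V P f \<longleftrightarrow> lub_in img (rep ` P) (rep f)"
  using assms by (auto simp: is_sup_def least_def Upper_def lub_in_def rep_le subset_iff)

lemma is_inf_in_iff:
  assumes "P \<subseteq> D" "D \<subseteq> carrier V" "f \<in> D"
  shows "is_inf_in V D P f \<longleftrightarrow> glb_in (rep ` D) (rep ` P) (rep f)"
  using assms by (auto simp: is_inf_in_def greatest_def Lower_def glb_in_def rep_le subset_iff)

end

locale normed_representation = normed_lattice V + lattice_representation V rep
  for V :: "('a, 'm) normed_lattice_scheme" (structure) and rep :: "'a \<Rightarrow> 'v::real_vector_lattice"
begin

definition rep_norm :: "'v \<Rightarrow> real"
  where "rep_norm v = vnorm V (inv_into (carrier V) rep v)"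

lemma rep_norm: "x \<in> carrier V \<Longrightarrow> rep_norm (rep x) = vnorm V x"
  using rep_inj by (simp add: rep_norm_def)

lemma normed_sublattice: "normed_sublattice img rep_norm"
proof (intro normed_sublattice.intro linear_sublattice_image, unfold_locales)
  fix v w assume "v \<in> img" "w \<in> img"
  then obtain x y where xy: "x \<in> carrier V" "y \<in> carrier V" "v = rep x" "w = rep y" by auto
  show "rep_norm v = 0 \<longleftrightarrow> v = 0"
    using xy vnorm_eq_0_iff rep_eq_iff[of x \<zero>] by (simp add: rep_norm rep_zero)
  show "rep_norm (a *\<^sub>R v) = \<bar>a\<bar> * rep_norm v" for a
    using xy rep_norm[of "a \<odot> x"] by (simp add: rep_smult vsmult_closed vnorm_smult rep_norm)
  show "rep_norm (v + w) \<le> rep_norm v + rep_norm w"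
    using xy rep_norm[of "x \<oplus> y"] vnorm_triangle by (simp add: rep_add rep_norm)
  assume "\<bar>v\<bar> \<le> \<bar>w\<bar>"
  then have "vabs V x \<preceq> vabs V y" using xy by (simp add: vabs_closed flip: rep_abs rep_le)
  then show "rep_norm v \<le> rep_norm w"
    using xy vnorm_solid by (simp add: rep_norm)
qed

lemma positive_ball_eq: "positive_ball img rep_norm = rep ` pos_unit_ball V"
  by (auto simp: positive_ball_def pos_unit_ball_def rep_norm rep_nonneg)

lemma demicontinuous_iff: "demicontinuous V \<longleftrightarrow> demicontinuous_on img rep_norm"
proof -
  have "(\<forall>P f. P \<subseteq> pos_unit_ball V \<and> f \<in> carrier V \<and> increases_to V P f \<longrightarrow> vnorm V f \<le> r) \<longleftrightarrow>
    (\<forall>P f. P \<subseteq> positive_ball img rep_norm \<and> directed P \<and> lub_in img P f \<longrightarrow> rep_norm f \<le> r)"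
    (is "?l \<longleftrightarrow> ?r") for r
  proof
    assume l: ?l
    show ?r
    proof (intro allI impI, elim conjE)
      fix P f assume P: "P \<subseteq> positive_ball img rep_norm" "directed P" "lub_in img P f"
      then obtain Q where Q: "Q \<subseteq> pos_unit_ball V" "P = rep ` Q"
        unfolding positive_ball_eq by (rule_tac subset_imageE)
      obtain g where g: "g \<in> carrier V" "f = rep g" using P by (auto simp: lub_in_def)
      have "Q \<subseteq> carrier V" using Q by (auto simp: pos_unit_ball_def)
      then have "increases_to V Q g"
        using P Q g by (simp add: increases_to_def up_directed_iff is_sup_iff)
      then show "rep_norm f \<le> r" using l Q g by (simp add: rep_norm)
    qed
  next
    assume r: ?r
    show ?l
    proof (intro allI impI, elim conjE)
      fix P f assume P: "P \<subseteq> pos_unit_ball V" "f \<in> carrier V" "increases_to V P f"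
      have "P \<subseteq> carrier V" using P by (auto simp: pos_unit_ball_def)
      then have "directed (rep ` P)" "lub_in img (rep ` P) (rep f)"
        using P by (simp_all add: increases_to_def up_directed_iff is_sup_iff)
      moreover have "rep ` P \<subseteq> positive_ball img rep_norm"
        unfolding positive_ball_eq using P by blast
      ultimately have "rep_norm (rep f) \<le> r" using r by blast
      then show "vnorm V f \<le> r" using P by (simp add: rep_norm)
    qed
  qed
  then show ?thesis by (simp only: demicontinuous_def demicontinuous_on_def)
qed

lemma monotonically_complete_iff:
  "monotonically_complete V \<longleftrightarrow> monotonically_complete_on img rep_norm" (is "?l \<longleftrightarrow> ?r")
proof
  assume l: ?l
  show ?r
    unfolding monotonically_complete_on_def
  proof (intro allI impI, elim conjE)
    fix P assume P: "P \<subseteq> positive_ball img rep_norm" "directed P"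
    then obtain Q where Q: "Q \<subseteq> pos_unit_ball V" "P = rep ` Q"
      unfolding positive_ball_eq by (rule_tac subset_imageE)
    have "Q \<subseteq> carrier V" using Q by (auto simp: pos_unit_ball_def)
    then show "\<exists>f. lub_in img P f"
      using P Q l unfolding monotonically_complete_def by (metis up_directed_iff is_sup_iff)
  qed
next
  assume r: ?r
  show ?l
    unfolding monotonically_complete_def
  proof (intro allI impI, elim conjE)
    fix P assume P: "P \<subseteq> pos_unit_ball V" "up_directed V P"
    have PV: "P \<subseteq> carrier V" using P by (auto simp: pos_unit_ball_def)
    then have "directed (rep ` P)" using P by (simp add: up_directed_iff)
    moreover have "rep ` P \<subseteq> positive_ball img rep_norm"
      unfolding positive_ball_eq using P by blast
    ultimately obtain v where v: "lub_in img (rep ` P) v"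
      using r unfolding monotonically_complete_on_def by blast
    then obtain f where "f \<in> carrier V" "v = rep f" by (auto simp: lub_in_def)
    with v PV show "\<exists>f\<in>carrier V. is_sup V P f" by (auto simp: is_sup_iff)
  qed
qed

text \<open>For the completion constructed below, this leaves only monotone completeness to be
  verified.\<close>

lemma monotonically_complete_imp_banach_lattice:
  assumes "monotonically_complete V" shows "banach_lattice V"
proof
  interpret I: normed_sublattice img rep_norm by (rule normed_sublattice)
  have vdist: "vdist V x y = rep_norm (rep x - rep y)" if "x \<in> carrier V" "y \<in> carrier V" for x y
    using that rep_norm[of "x \<ominus> y"] by (simp add: vdist_def rep_diff)
  interpret Metric_space "carrier V" "vdist V"
  proof
    have commute: "rep_norm (rep x - rep y) = rep_norm (rep y - rep x)"
      if "x \<in> carrier V" "y \<in> carrier V" for x y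
      using that I.norm_minus[of "rep x - rep y"] by simp
    show "0 \<le> vdist V x y" for x y
      using vdist[of x y] I.norm_nonneg[of "rep x - rep y"] by (cases "x \<in> carrier V \<and> y \<in> carrier V")
        (auto simp: vdist_def)
    show "vdist V x y = vdist V y x" for x y
      using vdist[of x y] vdist[of y x] commute[of x y]
      by (cases "x \<in> carrier V \<and> y \<in> carrier V") (auto simp: vdist_def)
    fix x y assume xy: "x \<in> carrier V" "y \<in> carrier V"
    show "vdist V x y = 0 \<longleftrightarrow> x = y"
      using xy I.norm_eq_0[of "rep x - rep y"] by (simp add: vdist rep_eq_iff)
    show "vdist V x z \<le> vdist V x y + vdist V y z" if "z \<in> carrier V" for z
      using xy that I.norm_add[of "rep x - rep y" "rep y - rep z"] by (simp add: vdist)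
  qed
  show "mcomplete"
    unfolding mcomplete_def
  proof (intro allI impI)
    fix s assume s: "MCauchy s"
    then have sV: "s n \<in> carrier V" for n by (auto simp: MCauchy_def)
    obtain l where l: "l \<in> img" "\<And>e. e > 0 \<Longrightarrow> \<exists>M. \<forall>n\<ge>M. rep_norm (rep (s n) - l) < e"
    proof (rule I.monotonically_complete_imp_complete[of "\<lambda>n. rep (s n)"])
      show "monotonically_complete_on img rep_norm"
        using assms by (simp add: monotonically_complete_iff)
      show "\<exists>M. \<forall>m\<ge>M. \<forall>n\<ge>M. rep_norm (rep (s m) - rep (s n)) < e" if "e > 0" for e
        using s that sV unfolding MCauchy_def by (simp add: vdist)
    qed (use sV in auto)
    then obtain x where x: "x \<in> carrier V" "l = rep x" by auto
    have "limitin mtopology s x sequentially"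
      unfolding limit_metric_sequentially using x l(2) sV by (simp add: vdist)
    then show "\<exists>x. limitin mtopology s x sequentially" by blast
  qed
qed

end

text \<open>A norm that is first constructed on the represented lattice is moved back to the
  carrier. This is how the lattice of formal differences receives its actual norm.\<close>

lemma normed_lattice_update:
  fixes V :: "'a normed_lattice"
  assumes "lattice_representation V rep" "normed_sublattice (rep ` carrier V) N"
  defines "W \<equiv> V\<lparr>vnorm := \<lambda>x. N (rep x)\<rparr>"
  shows "normed_representation W rep"
    and "v \<in> rep ` carrier V \<Longrightarrow> normed_representation.rep_norm W rep v = N v"
proof -
  interpret V: lattice_representation V rep by fact
  interpret N: normed_sublattice "rep ` carrier V" N by fact
  have [simp]: "ord_of W = ord_of V" "carrier W = carrier V" "vnorm W x = N (rep x)" "vle W = vle V"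
    "\<zero>\<^bsub>W\<^esub> = \<zero>\<^bsub>V\<^esub>" "(\<oplus>\<^bsub>W\<^esub>) = (\<oplus>\<^bsub>V\<^esub>)" "(\<odot>\<^bsub>W\<^esub>) = (\<odot>\<^bsub>V\<^esub>)" for x
    by (simp_all add: W_def ord_of_def)
  have "abelian_group W"
    using V.M.abelian_group_axioms
    by (simp add: abelian_group_def abelian_monoid_def abelian_group_axioms_def)
  then have "Module.module real_ring W"
    using V.module_axioms by (intro moduleI) (auto simp: module_def module_axioms_def)
  then have "vector_lattice W"
    using V.vector_lattice_axioms by (simp add: vector_lattice_def vector_lattice_axioms_def)
  then have rep: "lattice_representation W rep"
    using V.lattice_representation_axioms
    by (simp add: lattice_representation_def lattice_representation_axioms_def)
  interpret W: lattice_representation W rep by (rule rep)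
  have "normed_lattice W"
  proof
    fix x assume x: "x \<in> carrier W"
    show "vnorm W x = 0 \<longleftrightarrow> x = \<zero>\<^bsub>W\<^esub>"
      using x N.norm_eq_0[of "rep x"] V.rep_eq_iff[of x "\<zero>\<^bsub>V\<^esub>"] by (simp add: V.rep_zero)
    show "vnorm W (a \<odot>\<^bsub>W\<^esub> x) = \<bar>a\<bar> * vnorm W x" for a
      using x by (simp add: V.rep_smult N.norm_scaleR)
    fix y assume y: "y \<in> carrier W"
    show "vnorm W (x \<oplus>\<^bsub>W\<^esub> y) \<le> vnorm W x + vnorm W y"
      using x y by (simp add: V.rep_add N.norm_add)
    assume "vabs W x \<preceq>\<^bsub>W\<^esub> vabs W y"
    then have "\<bar>rep x\<bar> \<le> \<bar>rep y\<bar>"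
      using x y W.rep_le[OF W.vabs_closed W.vabs_closed, of x y] by (simp add: W.rep_abs)
    then show "vnorm W x \<le> vnorm W y" using x y by (simp add: N.norm_solid)
  qed
  then show W: "normed_representation W rep" by (intro normed_representation.intro rep)
  interpret normed_representation W rep by (rule W)
  show "rep_norm v = N v" if "v \<in> rep ` carrier V"
    using that rep_norm by auto
qed

text \<open>\<open>T\<close> and \<open>J\<close> are one map seen before and after representation,
  in a commuting square; each notion of embedding and density is translated along this
  square.\<close>

locale embedding_representation =
  V: lattice_representation V rep + W: lattice_representation W rep'
  for V :: "('a, 'm) vector_lattice_scheme" and rep :: "'a \<Rightarrow> 'v::real_vector_lattice"
    and W :: "('b, 'n) vector_lattice_scheme" and rep' :: "'b \<Rightarrow> 'w::real_vector_lattice" +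
  fixes T :: "'a \<Rightarrow> 'b" and J :: "'v \<Rightarrow> 'w"
  assumes T_closed: "x \<in> carrier V \<Longrightarrow> T x \<in> carrier W"
    and rep_T: "x \<in> carrier V \<Longrightarrow> rep' (T x) = J (rep x)"
begin

lemma image_eq: "J ` V.img = rep' ` T ` carrier V"
  using rep_T by (auto simp: image_iff)

lemma lattice_embedding_iff:
  "lattice_embedding V W T \<longleftrightarrow> embedding_on V.img W.img J" (is "?l \<longleftrightarrow> ?r")
proof -
  have add: "T (x \<oplus>\<^bsub>V\<^esub> y) = T x \<oplus>\<^bsub>W\<^esub> T y \<longleftrightarrow> J (rep x + rep y) = J (rep x) + J (rep y)"
    if "x \<in> carrier V" "y \<in> carrier V" for x y
    using that T_closed by (simp flip: rep_T V.rep_add W.rep_add W.rep_eq_iff)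
  have smult: "T (a \<odot>\<^bsub>V\<^esub> x) = a \<odot>\<^bsub>W\<^esub> T x \<longleftrightarrow> J (a *\<^sub>R rep x) = a *\<^sub>R J (rep x)"
    if "x \<in> carrier V" for a x
    using that T_closed by (simp add: V.vsmult_closed W.vsmult_closed
      flip: rep_T V.rep_smult W.rep_smult W.rep_eq_iff)
  have join: "T (vjoin V x y) = vjoin W (T x) (T y) \<longleftrightarrow> J (sup (rep x) (rep y)) = sup (J (rep x)) (J (rep y))"
    if "x \<in> carrier V" "y \<in> carrier V" for x y
    using that T_closed by (simp add: V.vjoin_closed W.vjoin_closed
      flip: rep_T V.rep_join W.rep_join W.rep_eq_iff)
  have meet: "T (vmeet V x y) = vmeet W (T x) (T y) \<longleftrightarrow> J (inf (rep x) (rep y)) = inf (J (rep x)) (J (rep y))"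
    if "x \<in> carrier V" "y \<in> carrier V" for x y
    using that T_closed by (simp add: V.vmeet_closed W.vmeet_closed
      flip: rep_T V.rep_meet W.rep_meet W.rep_eq_iff)
  have inj: "inj_on T (carrier V) \<longleftrightarrow> inj_on J V.img"
    unfolding inj_on_def using T_closed
    by (simp add: V.rep_eq_iff W.rep_eq_iff flip: rep_T)
  show ?thesis
    unfolding lattice_embedding_def embedding_on_def join_pres_def meet_pres_def hom_def
    using add smult join meet inj T_closed V.ord.lattice_axioms W.ord.lattice_axioms
    by (auto simp: rep_T[symmetric])
qed

lemma vector_sublattice_image:
  assumes "lattice_embedding V W T" shows "vector_sublattice (T ` carrier V) W"
proof -
  have T: "T (x \<oplus>\<^bsub>V\<^esub> y) = T x \<oplus>\<^bsub>W\<^esub> T y" "T (a \<odot>\<^bsub>V\<^esub> x) = a \<odot>\<^bsub>W\<^esub> T x"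
      "T (vjoin V x y) = vjoin W (T x) (T y)" "T (vmeet V x y) = vmeet W (T x) (T y)"
    if "x \<in> carrier V" "y \<in> carrier V" for x y a
    using assms that by (auto simp: lattice_embedding_def join_pres_def meet_pres_def hom_def)
  have zero: "T \<zero>\<^bsub>V\<^esub> = \<zero>\<^bsub>W\<^esub>"
    using T(1)[of "\<zero>\<^bsub>V\<^esub>" "\<zero>\<^bsub>V\<^esub>"] T_closed[of "\<zero>\<^bsub>V\<^esub>"] by simp
  have minus: "T (\<ominus>\<^bsub>V\<^esub> x) = \<ominus>\<^bsub>W\<^esub> T x" if "x \<in> carrier V" for x
    using T(1)[of "\<ominus>\<^bsub>V\<^esub> x" x] that T_closed zero
    by (simp add: V.M.l_neg W.M.minus_equality)
  have "submodule (T ` carrier V) real_ring W"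
  proof (rule W.submoduleI)
    show "\<zero>\<^bsub>W\<^esub> \<in> T ` carrier V" using zero by (metis V.M.zero_closed imageI)
  qed (use T_closed in \<open>auto simp: V.vsmult_closed simp flip: minus T(1,2)\<close>)
  then show ?thesis
    unfolding vector_sublattice_def
    by (auto simp: V.vjoin_closed V.vmeet_closed simp flip: T(3,4))
qed

lemma order_dense_iff:
  assumes "lattice_embedding V W T"
  shows "order_dense_sublattice (T ` carrier V) W \<longleftrightarrow> order_dense_in (J ` V.img) W.img"
proof -
  have T: "T x \<in> carrier W" if "x \<in> carrier V" for x by (rule T_closed) fact
  have "order_dense_in (J ` V.img) W.img \<longleftrightarrow>
    (\<forall>g\<in>carrier W. 0 < rep' g \<longrightarrow> (\<exists>e\<in>carrier V. 0 < rep' (T e) \<and> rep' (T e) \<le> rep' g))"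
    by (simp add: order_dense_in_def image_eq)
  also have "\<dots> \<longleftrightarrow> (\<forall>g\<in>carrier W. \<zero>\<^bsub>W\<^esub> \<preceq>\<^bsub>W\<^esub> g \<and> g \<noteq> \<zero>\<^bsub>W\<^esub> \<longrightarrow>
      (\<exists>e\<in>T ` carrier V. \<zero>\<^bsub>W\<^esub> \<preceq>\<^bsub>W\<^esub> e \<and> e \<noteq> \<zero>\<^bsub>W\<^esub> \<and> e \<preceq>\<^bsub>W\<^esub> g))"
  proof -
    have pos: "0 < rep' g \<longleftrightarrow> \<zero>\<^bsub>W\<^esub> \<preceq>\<^bsub>W\<^esub> g \<and> g \<noteq> \<zero>\<^bsub>W\<^esub>" if "g \<in> carrier W" for g
      using that W.rep_nonneg[of g] W.rep_eq_iff[of g "\<zero>\<^bsub>W\<^esub>"]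
      by (auto simp: order.strict_iff_order W.rep_zero)
    show ?thesis using T by (simp add: pos W.rep_le conj_assoc)
  qed
  finally show ?thesis
    using vector_sublattice_image[OF assms] by (simp add: order_dense_sublattice_def)
qed

lemma regular_iff:
  assumes "lattice_embedding V W T"
  shows "regular_sublattice (T ` carrier V) W \<longleftrightarrow> regular_in (J ` V.img) W.img"
proof -
  let ?E = "T ` carrier V"
  have sub: "vector_sublattice ?E W" by (rule vector_sublattice_image[OF assms])
  have zero: "\<zero>\<^bsub>W\<^esub> \<in> ?E"
    using sub subgroup.one_closed[of ?E "add_monoid W"]
    by (auto simp: vector_sublattice_def submodule_def)
  have E: "?E \<subseteq> carrier W" using T_closed by auto
  have "regular_in (J ` V.img) W.img \<longleftrightarrow>
    (\<forall>P\<subseteq>rep' ` ?E. P \<noteq> {} \<and> glb_in (rep' ` ?E) P 0 \<longrightarrow> glb_in W.img P 0)"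
    unfolding regular_in_def image_eq by blast
  also have "\<dots> \<longleftrightarrow>
    (\<forall>P\<subseteq>?E. rep' ` P \<noteq> {} \<and> glb_in (rep' ` ?E) (rep' ` P) 0 \<longrightarrow> glb_in W.img (rep' ` P) 0)"
    by (rule all_subset_image)
  also have "\<dots> \<longleftrightarrow> (\<forall>P\<subseteq>?E. P \<noteq> {} \<and> is_inf_in W ?E P \<zero>\<^bsub>W\<^esub> \<longrightarrow> is_inf_in W (carrier W) P \<zero>\<^bsub>W\<^esub>)"
  proof (intro all_cong1 imp_cong refl)
    fix P assume P: "P \<subseteq> ?E"
    then have "P \<subseteq> carrier W" using E by blast
    then show "rep' ` P \<noteq> {} \<and> glb_in (rep' ` ?E) (rep' ` P) 0 \<longleftrightarrow> P \<noteq> {} \<and> is_inf_in W ?E P \<zero>\<^bsub>W\<^esub>"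
      "glb_in W.img (rep' ` P) 0 \<longleftrightarrow> is_inf_in W (carrier W) P \<zero>\<^bsub>W\<^esub>"
      using W.is_inf_in_iff[OF P E zero] W.is_inf_in_iff[OF _ subset_refl W.M.zero_closed, of P]
      by (simp_all add: W.rep_zero)
  qed
  finally show ?thesis
    using sub by (auto simp: regular_sublattice_def)
qed

end

section \<open>The completion and its norm\<close>

lemma abs_scaleR:
  fixes x :: "'v::real_vector_lattice"
  shows "\<bar>a *\<^sub>R x\<bar> = \<bar>a\<bar> *\<^sub>R \<bar>x\<bar>"
proof -
  have pos: "\<bar>b *\<^sub>R y\<bar> = b *\<^sub>R \<bar>y\<bar>" if "0 < b" for b and y :: 'v
    using scaleR_inf[OF that, of "- y" y] by (simp add: abs_lattice sup_eq_neg_inf inf_commute)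
  show ?thesis
    using pos[of a x] pos[of "- a" x] by (cases a "0 :: real" rule: linorder_cases) auto
qed

lemma directed_sums:
  fixes P Q :: "'v::ordered_ab_semigroup_add set"
  assumes "directed P" "directed Q"
  shows "directed {p + q | p q. p \<in> P \<and> q \<in> Q}"
  unfolding directed_def
proof (intro conjI ballI)
  show "{p + q | p q. p \<in> P \<and> q \<in> Q} \<noteq> {}" using assms unfolding directed_def by blast
  fix x y assume "x \<in> {p + q | p q. p \<in> P \<and> q \<in> Q}" "y \<in> {p + q | p q. p \<in> P \<and> q \<in> Q}"
  then obtain p q p' q' where *: "p \<in> P" "q \<in> Q" "x = p + q" "p' \<in> P" "q' \<in> Q" "y = p' + q'" by blast
  obtain s where s: "s \<in> P" "p \<le> s" "p' \<le> s" using assms * unfolding directed_def by blast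
  obtain t where t: "t \<in> Q" "q \<le> t" "q' \<le> t" using assms * unfolding directed_def by blast
  show "\<exists>z\<in>{p + q | p q. p \<in> P \<and> q \<in> Q}. x \<le> z \<and> y \<le> z"
    using s t * by (intro bexI[of _ "s + t"]) (auto intro: add_mono)
qed

text \<open>The norm is built from these properties of \<open>Y\<close> alone, without reference to
  cuts. \<open>bounded_below\<close> bounds the part of \<open>E\<close> below a point and makes the
  norm finite; \<open>lub_exists\<close> enters both the isometry on \<open>E\<close> and monotone
  completeness; \<open>dense\<close> excludes nonzero elements of norm zero.\<close>

locale order_dense_extension =
  normed_sublattice E N + embedding E Y J
  for E :: "'v::real_vector_lattice set" and N and Y :: "'w::real_vector_lattice set" and J +
  fixes r :: real
  assumes r_ge_1: "1 \<le> r"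
    and demicontinuous: "\<And>P f c. \<lbrakk>P \<subseteq> E; \<And>p. p \<in> P \<Longrightarrow> 0 \<le> p \<and> N p \<le> c; directed P; lub_in E P f\<rbrakk>
      \<Longrightarrow> N f \<le> r * c"
    and dense: "order_dense_in (J ` E) Y"
    and lub_below: "\<And>y. \<lbrakk>y \<in> Y; 0 \<le> y\<rbrakk> \<Longrightarrow> lub_in Y (J ` {f \<in> E. 0 \<le> f \<and> J f \<le> y}) y"
    and bounded_below: "\<And>y. \<lbrakk>y \<in> Y; 0 \<le> y\<rbrakk> \<Longrightarrow> \<exists>b. \<forall>f\<in>E. 0 \<le> f \<and> J f \<le> y \<longrightarrow> N f \<le> b"
    and lub_exists: "\<And>P b. \<lbrakk>P \<subseteq> E; \<And>p. p \<in> P \<Longrightarrow> 0 \<le> p \<and> N p \<le> b; directed P\<rbrakk>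
      \<Longrightarrow> \<exists>y. lub_in Y (J ` P) y"
begin

text \<open>The condition means that \<open>y\<close> is at most the supremum of the image of a
  directed set bounded by \<open>c\<close>. It is phrased through upper bounds, so no supremum has
  to be produced.\<close>

definition dominated :: "'w \<Rightarrow> real \<Rightarrow> bool"
  where "dominated y c \<longleftrightarrow> (\<exists>P\<subseteq>E. (\<forall>p\<in>P. 0 \<le> p \<and> N p \<le> c) \<and> directed P \<and>
    (\<forall>u\<in>Y. (\<forall>p\<in>P. J p \<le> u) \<longrightarrow> y \<le> u))"

text \<open>
  The gauge of the set of \<open>y\<close> with \<open>dominated \<bar>y\<bar> 1\<close> is a complete lattice norm on \<open>Y\<close> that is
  only equivalent to \<open>N\<close> on \<open>E\<close>. The infimal convolution of \<open>r\<close> times this gauge with \<open>N\<close>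
  restores the original norm on \<open>E\<close>.
\<close>

definition costs :: "'w \<Rightarrow> real set"
  where "costs y = {N f + r * c | f c. f \<in> E \<and> 0 \<le> f \<and> 0 \<le> c \<and> dominated (\<bar>y\<bar> - J f) c}"

definition extended_norm :: "'w \<Rightarrow> real"
  where "extended_norm y = Inf (costs y)"

lemma dominatedE:
  assumes "dominated y c"
  obtains P where "P \<subseteq> E" "\<And>p. p \<in> P \<Longrightarrow> 0 \<le> p \<and> N p \<le> c" "directed P"
    "\<And>u. u \<in> Y \<Longrightarrow> (\<And>p. p \<in> P \<Longrightarrow> J p \<le> u) \<Longrightarrow> y \<le> u"
proof -
  from assms obtain P where P: "P \<subseteq> E" "\<forall>p\<in>P. 0 \<le> p \<and> N p \<le> c" "directed P"
    "\<forall>u\<in>Y. (\<forall>p\<in>P. J p \<le> u) \<longrightarrow> y \<le> u"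
    unfolding dominated_def by (elim exE conjE)
  show ?thesis by (rule that[of P]) (use P in simp_all)
qed

lemma dominated_mono: "dominated z c \<Longrightarrow> y \<le> z \<Longrightarrow> dominated y c"
  unfolding dominated_def by (meson order_trans)

text \<open>The sums of the two directed sets serve for \<open>y + z\<close>. An upper bound
  \<open>u\<close> of them is treated one summand at a time: \<open>u - J q\<close> bounds the first
  image for each \<open>q\<close>, and therefore \<open>u - y\<close> bounds the second.\<close>

lemma dominated_add:
  assumes "dominated y c" "dominated z d" "y \<in> Y" "z \<in> Y"
  shows "dominated (y + z) (c + d)"
proof -
  obtain P where P: "P \<subseteq> E" "\<And>p. p \<in> P \<Longrightarrow> 0 \<le> p \<and> N p \<le> c" "directed P"
    "\<And>u. u \<in> Y \<Longrightarrow> (\<And>p. p \<in> P \<Longrightarrow> J p \<le> u) \<Longrightarrow> y \<le> u"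
    using dominatedE[OF assms(1)] by metis
  obtain Q where Q: "Q \<subseteq> E" "\<And>p. p \<in> Q \<Longrightarrow> 0 \<le> p \<and> N p \<le> d" "directed Q"
    "\<And>u. u \<in> Y \<Longrightarrow> (\<And>p. p \<in> Q \<Longrightarrow> J p \<le> u) \<Longrightarrow> z \<le> u"
    using dominatedE[OF assms(2)] by metis
  let ?R = "{p + q | p q. p \<in> P \<and> q \<in> Q}"
  have "?R \<subseteq> E" using P(1) Q(1) by (blast intro: add_mem)
  moreover have "0 \<le> s \<and> N s \<le> c + d" if s: "s \<in> ?R" for s
  proof -
    obtain p q where pq: "p \<in> P" "q \<in> Q" "s = p + q" using s by blast
    have "N s \<le> N p + N q" unfolding pq(3) using pq P(1) Q(1) by (intro norm_add) auto
    then show ?thesis using P(2)[OF pq(1)] Q(2)[OF pq(2)] pq(3) by simp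
  qed
  moreover have "directed ?R" using P Q by (intro directed_sums)
  moreover have "y + z \<le> u" if u: "u \<in> Y" "\<forall>s\<in>?R. J s \<le> u" for u
  proof -
    have le: "J p + J q \<le> u" if "p \<in> P" "q \<in> Q" for p q
    proof -
      have "J (p + q) \<le> u" using u that by blast
      then show ?thesis using that P(1) Q(1) by (simp add: emb_add subset_iff)
    qed
    have "y \<le> u - J q" if q: "q \<in> Q" for q
      using le[OF _ q] q Q(1) u by (intro P(4)) (auto simp: le_diff_eq)
    then have "J q \<le> u - y" if "q \<in> Q" for q
      using that by (metis add.commute le_diff_eq)
    then have "z \<le> u - y" using assms u by (intro Q(4)) auto
    then show ?thesis by (simp add: algebra_simps)
  qed
  ultimately show ?thesis unfolding dominated_def by (intro exI[of _ ?R]) simp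
qed

lemma dominated_nonpos: "y \<le> 0 \<Longrightarrow> dominated y 0"
  unfolding dominated_def by (intro exI[of _ "{0}"]) (auto simp: directed_def)

lemma dominated_scaleR:
  assumes "dominated y c" "0 < a"
  shows "dominated (a *\<^sub>R y) (a * c)"
proof -
  obtain P where P: "P \<subseteq> E" "\<And>p. p \<in> P \<Longrightarrow> 0 \<le> p \<and> N p \<le> c" "directed P"
    "\<And>u. u \<in> Y \<Longrightarrow> (\<And>p. p \<in> P \<Longrightarrow> J p \<le> u) \<Longrightarrow> y \<le> u"
    using dominatedE[OF assms(1)] by metis
  let ?R = "(*\<^sub>R) a ` P"
  have "?R \<subseteq> E" using P(1) by auto
  moreover have "\<forall>s\<in>?R. 0 \<le> s \<and> N s \<le> a * c"
    using P(1,2) assms(2) by (auto simp: scaleR_nonneg_nonneg norm_scaleR subset_iff)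
  moreover have "directed ?R" using P(3) assms(2) by (simp add: directed_scaleR)
  moreover have "a *\<^sub>R y \<le> u" if u: "u \<in> Y" "\<forall>s\<in>?R. J s \<le> u" for u
  proof -
    have "J p \<le> inverse a *\<^sub>R u" if p: "p \<in> P" for p
    proof -
      have "a *\<^sub>R J p \<le> u" using u(2) p P(1) by (auto simp: subset_iff simp flip: emb_scaleR)
      then show ?thesis using assms(2) by (simp add: pos_le_divideR_eq)
    qed
    then have "y \<le> inverse a *\<^sub>R u" using u by (intro P(4)) auto
    then show ?thesis using assms(2) by (simp add: pos_le_divideR_eq)
  qed
  ultimately show ?thesis unfolding dominated_def by (intro exI[of _ ?R]) simp
qed

lemma dominated_exists:
  assumes "y \<in> Y" obtains c where "0 \<le> c" "dominated y c"
proof -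
  have y: "pprt y \<in> Y" "0 \<le> pprt y" "y \<le> pprt y" using assms by (simp_all add: pprt_def)
  obtain b where b: "\<And>f. f \<in> E \<Longrightarrow> 0 \<le> f \<Longrightarrow> J f \<le> pprt y \<Longrightarrow> N f \<le> b"
    using bounded_below[OF y(1,2)] by blast
  let ?P = "{f \<in> E. 0 \<le> f \<and> J f \<le> pprt y}"
  have "directed ?P"
    unfolding directed_def
  proof (intro conjI ballI)
    have "0 \<in> ?P" using y by simp
    then show "?P \<noteq> {}" by blast
    show "\<exists>z\<in>?P. f \<le> z \<and> g \<le> z" if "f \<in> ?P" "g \<in> ?P" for f g
      using that by (intro bexI[of _ "sup f g"]) (auto simp: emb_sup intro: le_supI1)
  qed
  moreover have "\<forall>u\<in>Y. (\<forall>p\<in>?P. J p \<le> u) \<longrightarrow> y \<le> u"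
    using lub_below[OF y(1,2)] y(3) unfolding lub_in_def by (blast intro: order_trans)
  moreover have "\<forall>p\<in>?P. 0 \<le> p \<and> N p \<le> max 0 b" using b by (simp add: le_max_iff_disj)
  moreover have "?P \<subseteq> E" by blast
  ultimately have "dominated y (max 0 b)"
    unfolding dominated_def by (intro exI[of _ ?P] conjI)
  then show ?thesis by (intro that[of "max 0 b"]) simp_all
qed

text \<open>If \<open>J e\<close> is below the supremum of the image of \<open>P\<close>, so is
  \<open>J (pprt e)\<close>, because that supremum is nonnegative. By distributivity
  \<open>pprt e\<close> then lies in the order closure of \<open>P\<close> within \<open>E\<close>,
  where demicontinuity bounds its norm.\<close>

lemma dominated_embedding:
  assumes e: "e \<in> E" "dominated (J e) c"
  shows "N (pprt e) \<le> r * c"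
proof -
  obtain P where P: "P \<subseteq> E" "\<And>p. p \<in> P \<Longrightarrow> 0 \<le> p \<and> N p \<le> c" "directed P"
    "\<And>u. u \<in> Y \<Longrightarrow> (\<And>p. p \<in> P \<Longrightarrow> J p \<le> u) \<Longrightarrow> J e \<le> u"
    using dominatedE[OF assms(2)] by metis
  obtain z where z: "lub_in Y (J ` P) z" using lub_exists[OF P(1,2,3)] by blast
  obtain q where q: "q \<in> P" using P(3) by (auto simp: directed_def)
  have "0 \<le> J q" using q P(1,2) by (auto simp: emb_nonneg_iff)
  also have "J q \<le> z" using z q by (auto simp: lub_in_def)
  finally have "0 \<le> z" .
  moreover have "J e \<le> z" using z by (intro P(4)) (auto simp: lub_in_def)
  moreover have "J (pprt e) = sup (J e) 0" using e by (simp add: pprt_def emb_sup)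
  ultimately have ez: "J (pprt e) \<le> z" by simp
  have e': "pprt e \<in> E" using e by simp
  have "pprt e \<in> ocl P"
  proof (rule oclI)
    fix u assume u: "u \<in> E" "\<And>p. p \<in> P \<Longrightarrow> inf (pprt e) p \<le> u"
    have "inf (J (pprt e)) z \<le> J u"
    proof (rule inf_lub_le[OF Y.linear_sublattice_axioms z])
      fix s assume "s \<in> J ` P"
      then obtain p where p: "p \<in> P" "s = J p" by blast
      then show "inf (J (pprt e)) s \<le> J u"
        using u e' P(1) by (simp add: emb_le_iff subset_iff flip: emb_inf)
    qed (use e' u in auto)
    then show "pprt e \<le> u" using ez e' u by (simp add: inf_absorb1 emb_le_iff)
  qed (use e' in auto)
  then show ?thesis
  proof (rule ocl_norm_le[rotated -1])
    show "P \<subseteq> E" "directed P" by fact+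
    show "0 \<le> p \<and> N p \<le> c" if "p \<in> P" for p by (rule P(2)[OF that])
  qed (rule demicontinuous)
qed

lemma costsI:
  "\<lbrakk>f \<in> E; 0 \<le> f; 0 \<le> c; dominated (\<bar>y\<bar> - J f) c\<rbrakk> \<Longrightarrow> N f + r * c \<in> costs y"
  by (auto simp: costs_def)

lemma costs_nonneg: "s \<in> costs y \<Longrightarrow> 0 \<le> s"
  using r_ge_1 norm_nonneg by (auto simp: costs_def)

lemma costs_nonempty: "y \<in> Y \<Longrightarrow> costs y \<noteq> {}"
  using dominated_exists[of "\<bar>y\<bar>"] costsI[of 0 _ y] by (metis Y.abs_mem diff_zero emb_0 empty_iff
    order_refl zero_mem)

lemma extended_norm_le: "s \<in> costs y \<Longrightarrow> extended_norm y \<le> s"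
  unfolding extended_norm_def by (intro cInf_lower bdd_belowI[of _ 0] costs_nonneg)

lemma extended_norm_ge: "y \<in> Y \<Longrightarrow> (\<And>s. s \<in> costs y \<Longrightarrow> m \<le> s) \<Longrightarrow> m \<le> extended_norm y"
  unfolding extended_norm_def by (intro cInf_greatest costs_nonempty)

text \<open>The choice \<open>f = \<bar>e\<bar>\<close>, \<open>c = 0\<close> gives one inequality.
  For the other, \<open>\<bar>e\<bar> \<le> f + pprt (\<bar>e\<bar> - f)\<close>, and the norm of
  the last term is at most \<open>r * c\<close>: the weight \<open>r\<close> in \<open>costs\<close>
  pays exactly for it.\<close>

lemma extended_norm_embedding:
  assumes e: "e \<in> E" shows "extended_norm (J e) = N e"
proof (rule antisym)
  have "N \<bar>e\<bar> + r * 0 \<in> costs (J e)"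
    using e by (intro costsI) (simp_all add: emb_abs dominated_nonpos)
  then show "extended_norm (J e) \<le> N e" using extended_norm_le e by (simp add: norm_abs)
  show "N e \<le> extended_norm (J e)"
  proof (rule extended_norm_ge)
    fix s assume "s \<in> costs (J e)"
    then obtain f c where fc: "s = N f + r * c" "f \<in> E" "0 \<le> f" "0 \<le> c" "dominated (\<bar>J e\<bar> - J f) c"
      by (auto simp: costs_def)
    then have "dominated (J (\<bar>e\<bar> - f)) c" using e by (simp add: emb_diff emb_abs)
    then have "N (pprt (\<bar>e\<bar> - f)) \<le> r * c" using e fc by (intro dominated_embedding) simp_all
    moreover have "N \<bar>e\<bar> \<le> N (f + pprt (\<bar>e\<bar> - f))"
    proof (rule norm_mono)
      have "\<bar>e\<bar> - f \<le> pprt (\<bar>e\<bar> - f)" by (simp add: pprt_def)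
      then show "\<bar>e\<bar> \<le> f + pprt (\<bar>e\<bar> - f)" by (simp add: algebra_simps)
    qed (use e fc in auto)
    moreover have "N (f + pprt (\<bar>e\<bar> - f)) \<le> N f + N (pprt (\<bar>e\<bar> - f))"
      using e fc by (intro norm_add) auto
    ultimately show "N e \<le> s" using e fc by (simp add: norm_abs)
  qed (use e in simp)
qed

lemma extended_norm_solid:
  "\<lbrakk>x \<in> Y; y \<in> Y; \<bar>x\<bar> \<le> \<bar>y\<bar>\<rbrakk> \<Longrightarrow> extended_norm x \<le> extended_norm y"
  by (rule extended_norm_ge, simp, rule extended_norm_le)
    (auto simp: costs_def intro: dominated_mono diff_right_mono)

lemma extended_norm_add:
  assumes "x \<in> Y" "y \<in> Y"
  shows "extended_norm (x + y) \<le> extended_norm x + extended_norm y"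
proof -
  have sum: "extended_norm (x + y) \<le> s + t" if "s \<in> costs x" "t \<in> costs y" for s t
  proof -
    obtain f c where fc: "s = N f + r * c" "f \<in> E" "0 \<le> f" "0 \<le> c" "dominated (\<bar>x\<bar> - J f) c"
      using \<open>s \<in> costs x\<close> by (auto simp: costs_def)
    obtain g d where gd: "t = N g + r * d" "g \<in> E" "0 \<le> g" "0 \<le> d" "dominated (\<bar>y\<bar> - J g) d"
      using \<open>t \<in> costs y\<close> by (auto simp: costs_def)
    have "dominated ((\<bar>x\<bar> - J f) + (\<bar>y\<bar> - J g)) (c + d)"
      using assms fc gd by (intro dominated_add) auto
    moreover have "\<bar>x + y\<bar> - J (f + g) \<le> (\<bar>x\<bar> - J f) + (\<bar>y\<bar> - J g)"
      using abs_triangle_ineq[of x y] fc gd by (simp add: emb_add algebra_simps)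
    ultimately have "dominated (\<bar>x + y\<bar> - J (f + g)) (c + d)" by (rule dominated_mono)
    then have "N (f + g) + r * (c + d) \<in> costs (x + y)" using fc gd by (intro costsI) auto
    then have "extended_norm (x + y) \<le> N (f + g) + r * (c + d)" by (rule extended_norm_le)
    also have "\<dots> \<le> s + t" using norm_add[OF fc(2) gd(2)] fc gd by (simp add: algebra_simps)
    finally show ?thesis .
  qed
  have "extended_norm (x + y) - t \<le> extended_norm x" if "t \<in> costs y" for t
    using sum[OF _ that] assms by (intro extended_norm_ge) (auto simp: algebra_simps)
  then have "extended_norm (x + y) - extended_norm x \<le> extended_norm y"
    using assms by (intro extended_norm_ge) (auto simp: algebra_simps)
  then show ?thesis by simp
qed

lemma extended_norm_0: "extended_norm 0 = 0"
  using extended_norm_embedding[of 0] by simp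

text \<open>One inequality for all nonzero scalars is enough, since it also applies to the inverse
  scalar.\<close>

lemma extended_norm_scaleR:
  assumes y: "y \<in> Y" shows "extended_norm (a *\<^sub>R y) = \<bar>a\<bar> * extended_norm y"
proof (cases "a = 0")
  case False
  have le: "extended_norm (b *\<^sub>R z) \<le> \<bar>b\<bar> * extended_norm z" if "z \<in> Y" "b \<noteq> 0" for b z
  proof -
    have "extended_norm (b *\<^sub>R z) / \<bar>b\<bar> \<le> extended_norm z"
    proof (rule extended_norm_ge[OF \<open>z \<in> Y\<close>])
      fix s assume "s \<in> costs z"
      then obtain f c where fc: "s = N f + r * c" "f \<in> E" "0 \<le> f" "0 \<le> c" "dominated (\<bar>z\<bar> - J f) c"
        by (auto simp: costs_def)
      have "dominated (\<bar>b\<bar> *\<^sub>R (\<bar>z\<bar> - J f)) (\<bar>b\<bar> * c)"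
        using fc that by (intro dominated_scaleR) auto
      then have "dominated (\<bar>b *\<^sub>R z\<bar> - J (\<bar>b\<bar> *\<^sub>R f)) (\<bar>b\<bar> * c)"
        using fc by (simp add: abs_scaleR emb_scaleR scaleR_diff_right)
      then have "N (\<bar>b\<bar> *\<^sub>R f) + r * (\<bar>b\<bar> * c) \<in> costs (b *\<^sub>R z)"
        using fc by (intro costsI) (auto simp: scaleR_nonneg_nonneg)
      then have "extended_norm (b *\<^sub>R z) \<le> \<bar>b\<bar> * s"
        using extended_norm_le fc by (fastforce simp: norm_scaleR algebra_simps)
      then show "extended_norm (b *\<^sub>R z) / \<bar>b\<bar> \<le> s"
        using that by (simp add: field_simps)
    qed
    then show ?thesis using that by (simp add: field_simps)
  qed
  have "extended_norm (inverse a *\<^sub>R a *\<^sub>R y) \<le> \<bar>inverse a\<bar> * extended_norm (a *\<^sub>R y)"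
    using y False by (intro le) auto
  then have "\<bar>a\<bar> * extended_norm y \<le> extended_norm (a *\<^sub>R y)"
    using False by (simp add: field_simps abs_inverse)
  then show ?thesis using le[OF y False] by simp
qed (simp add: extended_norm_0)

text \<open>Below \<open>\<bar>y\<bar>\<close> for a nonzero \<open>y\<close> there is a nonzero
  positive element of \<open>E\<close>, on which the extended norm is \<open>N\<close>.\<close>

lemma extended_norm_eq_0:
  assumes y: "y \<in> Y" shows "extended_norm y = 0 \<longleftrightarrow> y = 0"
proof
  assume 0: "extended_norm y = 0"
  show "y = 0"
  proof (rule ccontr)
    assume "y \<noteq> 0"
    then obtain e where e: "e \<in> E" "0 < J e" "J e \<le> \<bar>y\<bar>"
      using dense y unfolding order_dense_in_def by (metis Y.abs_mem imageE zero_less_abs_iff)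
    have "N e = extended_norm (J e)" using e by (simp add: extended_norm_embedding)
    also have "\<dots> \<le> extended_norm y" using e y by (intro extended_norm_solid) auto
    finally have "e = 0" using 0 e norm_eq_0 norm_nonneg[of e] by simp
    then show False using e by simp
  qed
qed (simp add: extended_norm_0)

lemma normed_sublattice_extension: "normed_sublattice Y extended_norm"
  by unfold_locales (simp_all add: extended_norm_eq_0 extended_norm_scaleR extended_norm_add
    extended_norm_solid)

text \<open>\<open>Q\<close> is replaced by the set \<open>P\<close> of positive elements of
  \<open>E\<close> below some member of \<open>Q\<close>. As the extended norm restricts to
  \<open>N\<close>, \<open>P\<close> lies in the unit ball of \<open>E\<close> and has a supremum in
  \<open>Y\<close>. Each member of \<open>Q\<close> is the supremum of the part of \<open>P\<close>
  below it, so that supremum also serves for \<open>Q\<close>.\<close>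

lemma monotonically_complete_extension: "monotonically_complete_on Y extended_norm"
  unfolding monotonically_complete_on_def
proof (intro allI impI, elim conjE)
  fix Q assume Q: "Q \<subseteq> positive_ball Y extended_norm" "directed Q"
  have Y: "q \<in> Y" "0 \<le> q" "extended_norm q \<le> 1" if "q \<in> Q" for q
    using that Q by (auto simp: positive_ball_def)
  define P where "P = {f \<in> E. 0 \<le> f \<and> (\<exists>q\<in>Q. J f \<le> q)}"
  have "N f \<le> 1" if f: "f \<in> P" for f
  proof -
    obtain q where q: "q \<in> Q" "J f \<le> q" "f \<in> E" "0 \<le> f" using f by (auto simp: P_def)
    have "N f = extended_norm (J f)" using q by (simp add: extended_norm_embedding)
    also have "\<dots> \<le> extended_norm q"
      using q Y by (intro extended_norm_solid) (auto simp: emb_nonneg_iff)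
    also have "\<dots> \<le> 1" using q Y by simp
    finally show ?thesis .
  qed
  moreover have "directed P"
    unfolding directed_def
  proof (intro conjI ballI)
    obtain q where "q \<in> Q" using Q by (auto simp: directed_def)
    then have "0 \<in> P" using Y by (auto simp: P_def)
    then show "P \<noteq> {}" by blast
    fix f g assume "f \<in> P" "g \<in> P"
    then obtain p q where *: "p \<in> Q" "q \<in> Q" "J f \<le> p" "J g \<le> q" "f \<in> E" "g \<in> E" "0 \<le> f" "0 \<le> g"
      by (auto simp: P_def)
    obtain s where s: "s \<in> Q" "p \<le> s" "q \<le> s" using Q(2) * unfolding directed_def by blast
    have "J (sup f g) \<le> s" using * s by (auto simp: emb_sup)
    then have "sup f g \<in> P" using * s by (auto simp: P_def intro: le_supI1)
    then show "\<exists>z\<in>P. f \<le> z \<and> g \<le> z" by (rule bexI[rotated]) simp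
  qed
  moreover have "P \<subseteq> E" "\<And>p. p \<in> P \<Longrightarrow> 0 \<le> p" by (simp_all add: P_def subset_iff)
  ultimately obtain y where y: "lub_in Y (J ` P) y"
    using lub_exists[of P 1] by blast
  have "lub_in Y Q y"
    unfolding lub_in_def
  proof (intro conjI ballI impI)
    show "y \<in> Y" using y by (simp add: lub_in_def)
    fix q assume q: "q \<in> Q"
    then have "lub_in Y (J ` {f \<in> E. 0 \<le> f \<and> J f \<le> q}) q" using Y by (intro lub_below)
    moreover have "\<forall>p\<in>J ` {f \<in> E. 0 \<le> f \<and> J f \<le> q}. p \<le> y"
      using y q by (auto simp: lub_in_def P_def)
    ultimately show "q \<le> y" using y by (auto simp: lub_in_def)
  next
    fix u assume u: "u \<in> Y" "\<forall>q\<in>Q. q \<le> u"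
    have "\<forall>p\<in>J ` P. p \<le> u" using u by (auto simp: P_def intro: order_trans)
    then show "y \<le> u" using y u by (auto simp: lub_in_def)
  qed
  then show "\<exists>f. lub_in Y Q f" by blast
qed

end

text \<open>\<open>k\<close> identifies the cone of cuts with the positive cone of \<open>Y\<close>,
  so that the properties of the extension are read off from cuts, independently of how differences
  are encoded.\<close>

locale cut_completion =
  normed_sublattice E N + Y: linear_sublattice Y
  for E :: "'v::real_vector_lattice set" and N and Y :: "'w::real_vector_lattice set" +
  fixes k :: "'v set \<Rightarrow> 'w"
  assumes demicontinuous: "demicontinuous_on E N"
    and k_mem: "A \<in> cuts \<Longrightarrow> k A \<in> Y"
    and k_add: "\<lbrakk>A \<in> cuts; B \<in> cuts\<rbrakk> \<Longrightarrow> k (cut_add A B) = k A + k B"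
    and k_scale: "\<lbrakk>A \<in> cuts; 0 \<le> a\<rbrakk> \<Longrightarrow> k (cut_scale a A) = a *\<^sub>R k A"
    and k_le: "\<lbrakk>A \<in> cuts; B \<in> cuts\<rbrakk> \<Longrightarrow> k A \<le> k B \<longleftrightarrow> A \<subseteq> B"
    and k_surj: "\<lbrakk>y \<in> Y; 0 \<le> y\<rbrakk> \<Longrightarrow> \<exists>A\<in>cuts. y = k A"
begin

definition completion_map :: "'v \<Rightarrow> 'w"
  where "completion_map = linear_extension (\<lambda>f. k (principal_cut f))"

lemma k_0: "k {0} = 0"
  using k_scale[OF zero_cut, of 0] by (simp add: cut_scale_0 zero_cut)

lemmas completion_map_props = linear_extension[of E Y "\<lambda>f. k (principal_cut f)",
  OF linear_sublattice_axioms Y.linear_sublattice_axioms, folded completion_map_def]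

lemma principal_props:
  "x \<in> E \<Longrightarrow> 0 \<le> x \<Longrightarrow> k (principal_cut x) \<in> Y"
  "\<lbrakk>x \<in> E; y \<in> E; 0 \<le> x; 0 \<le> y\<rbrakk> \<Longrightarrow>
    k (principal_cut (x + y)) = k (principal_cut x) + k (principal_cut y)"
  "\<lbrakk>x \<in> E; 0 \<le> x; 0 \<le> a\<rbrakk> \<Longrightarrow> k (principal_cut (a *\<^sub>R x)) = a *\<^sub>R k (principal_cut x)"
  by (simp_all add: k_mem principal_cut k_add k_scale flip: principal_cut_add principal_cut_scale)

lemmas completion_map = completion_map_props[OF principal_props]

lemma completion_map_nonneg_iff:
  assumes "x \<in> E" shows "0 \<le> completion_map x \<longleftrightarrow> 0 \<le> x"
proof -
  have x: "pprt x \<in> E" "- nprt x \<in> E" "0 \<le> pprt x" "0 \<le> - nprt x" using assms by simp_all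
  have "0 \<le> completion_map x \<longleftrightarrow> k (principal_cut (- nprt x)) \<le> k (principal_cut (pprt x))"
    by (simp add: completion_map_def linear_extension_def)
  also have "\<dots> \<longleftrightarrow> - nprt x \<in> principal_cut (pprt x)"
    using x by (simp only: k_le principal_cut principal_cut_subset_iff)
  also have "\<dots> \<longleftrightarrow> - nprt x \<le> pprt x" using x by (simp add: principal_cut_def)
  also have "\<dots> \<longleftrightarrow> 0 \<le> x"
    unfolding diff_ge_0_iff_ge[of "pprt x" "- nprt x", symmetric] by (simp flip: prts)
  finally show ?thesis .
qed

lemma completion_map_le_iff:
  assumes "f \<in> E" "0 \<le> f" "A \<in> cuts"
  shows "completion_map f \<le> k A \<longleftrightarrow> f \<in> A"
  using assms completion_map(4)[of f] by (simp add: k_le principal_cut principal_cut_subset_iff)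

text \<open>An upper bound of the image is nonnegative because \<open>P\<close> is nonempty, hence
  it comes from a cut; a cut that contains \<open>P\<close> contains \<open>ocl P\<close>.\<close>

lemma completion_map_lub:
  assumes P: "P \<subseteq> E" "\<And>p. p \<in> P \<Longrightarrow> 0 \<le> p" "P \<noteq> {}" and A: "ocl P \<in> cuts"
  shows "lub_in Y (completion_map ` P) (k (ocl P))"
  unfolding lub_in_def
proof (intro conjI ballI impI)
  show "k (ocl P) \<in> Y" by (rule k_mem[OF A])
  have "P \<subseteq> ocl P" using P by (intro ocl_superset) auto
  then show "p \<le> k (ocl P)" if "p \<in> completion_map ` P" for p
    using that P A by (auto simp: completion_map_le_iff subset_iff)
  fix u assume u: "u \<in> Y" "\<forall>p\<in>completion_map ` P. p \<le> u"
  obtain p where p: "p \<in> P" using P(3) by blast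
  then have "0 \<le> completion_map p" "completion_map p \<le> u"
    using P u by (auto simp: completion_map_nonneg_iff subset_iff)
  then have "0 \<le> u" by (rule order_trans)
  then obtain B where B: "B \<in> cuts" "u = k B" using k_surj u by blast
  then have "P \<subseteq> B" using u P by (auto simp: completion_map_le_iff subset_iff)
  then have "ocl P \<subseteq> B" using B by (intro ocl_subset_cut)
  then show "k (ocl P) \<le> u" using A B by (simp add: k_le)
qed

text \<open>A nonzero positive element comes from a cut other than \<open>{0}\<close>, and any
  nonzero member of that cut gives the required element below it.\<close>

lemma completion_map_dense: "order_dense_in (completion_map ` E) Y"
  unfolding order_dense_in_def
proof (intro ballI impI)
  fix y assume y: "y \<in> Y" "0 < y"
  then obtain A where A: "A \<in> cuts" "y = k A" using k_surj[OF y(1) order.strict_implies_order] by blast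
  have "A \<noteq> {0}" using A y k_0 by auto
  then obtain f where f: "f \<in> A" "f \<noteq> 0" using cut_nonempty[OF A(1)] by blast
  have fE: "f \<in> E" "0 \<le> f" using A f by (auto simp: cut_mem cut_nonneg)
  have "completion_map (- f) = - completion_map f" using completion_map(3)[of f "- 1"] fE by simp
  then have "completion_map f \<noteq> 0"
    using fE f(2) completion_map_nonneg_iff[of "- f"] by auto
  moreover have "0 \<le> completion_map f" using fE by (simp add: completion_map_nonneg_iff)
  ultimately have "0 < completion_map f" by (metis order.not_eq_order_implies_strict)
  moreover have "completion_map f \<le> y" using A f fE by (simp add: completion_map_le_iff)
  ultimately show "\<exists>e\<in>completion_map ` E. 0 < e \<and> e \<le> y" using fE by blast
qed

lemma completion_map_embedding_on: "embedding_on E Y completion_map"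
  by (rule embedding_on_if_nonneg_iff) (simp_all add: linear_sublattice_axioms
    Y.linear_sublattice_axioms completion_map(1,2,3) completion_map_nonneg_iff completion_map_dense)

lemma order_dense_extension:
  obtains r where "order_dense_extension E N Y completion_map r"
proof -
  obtain r where r: "1 \<le> r" "\<And>P f c. \<lbrakk>P \<subseteq> E; \<And>p. p \<in> P \<Longrightarrow> 0 \<le> p \<and> N p \<le> c;
      directed P; lub_in E P f\<rbrakk> \<Longrightarrow> N f \<le> r * c"
    using demicontinuous by (rule demicontinuous_onE) blast
  show ?thesis
  proof (rule that[of r], unfold_locales)
    show "1 \<le> r" by fact
    show "N f \<le> r * c" if "P \<subseteq> E" "\<And>p. p \<in> P \<Longrightarrow> 0 \<le> p \<and> N p \<le> c" "directed P" "lub_in E P f"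
      for P f c using that by (rule r(2))
    show "embedding_on E Y completion_map" by (rule completion_map_embedding_on)
    show "order_dense_in (completion_map ` E) Y" by (rule completion_map_dense)
    fix y assume y: "y \<in> Y" "0 \<le> y"
    then obtain A where A: "A \<in> cuts" "y = k A" using k_surj by blast
    have eq: "{f \<in> E. 0 \<le> f \<and> completion_map f \<le> y} = A"
      using A by (auto simp: completion_map_le_iff cut_mem cut_nonneg)
    show "lub_in Y (completion_map ` {f \<in> E. 0 \<le> f \<and> completion_map f \<le> y}) y"
      unfolding eq using completion_map_lub[of A] A by (simp add: ocl_cut cut_nonempty cut_nonneg
        cut_mem subset_iff)
    show "\<exists>b. \<forall>f\<in>E. 0 \<le> f \<and> completion_map f \<le> y \<longrightarrow> N f \<le> b"
    proof -
      obtain b where "\<And>a. a \<in> A \<Longrightarrow> N a \<le> b" using cut_bounded[OF A(1)] by blast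
      then show ?thesis using eq by blast
    qed
  next
    fix P b assume P: "P \<subseteq> E" "\<And>p. p \<in> P \<Longrightarrow> 0 \<le> p \<and> N p \<le> b" "directed P"
    then have "ocl P \<in> cuts" using demicontinuous by (intro cut_ocl)
    then have "lub_in Y (completion_map ` P) (k (ocl P))"
      using P by (intro completion_map_lub) (auto simp: directed_def)
    then show "\<exists>y. lub_in Y (completion_map ` P) y" by blast
  qed
qed

end

section \<open>The characterization of demicontinuity\<close>

text \<open>Equivalence classes of pairs would be sets of pairs and need a larger type. Each class
  \<open>S a b\<close> is instead represented by one chosen member, encoded by \<open>j\<close>; by
  cancellation, classes that share a member belong to equal differences.\<close>

lemma (in cancellative_cone) formal_differences_exist:
  fixes j :: "'c \<Rightarrow> 'd"
  assumes j: "inj_on j C"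
  obtains mk :: "'c \<Rightarrow> 'c \<Rightarrow> 'd \<times> 'd" where "cone_differences C add zero smul le mk"
proof -
  have cancel: "a = b" if "a [+] c = b [+] c" "a \<in> C" "b \<in> C" "c \<in> C" for a b c
    using that by (metis cone_add_le cone_antisym cone_refl)
  have swap: "a [+] b [+] c = a [+] c [+] b" if "a \<in> C" "b \<in> C" "c \<in> C" for a b c
    using that by (metis cone_assoc cone_comm)
  define S where "S a b = {p \<in> C \<times> C. fst p [+] b = a [+] snd p}" for a b
  define mk where "mk a b = map_prod j j (SOME p. p \<in> S a b)" for a b
  have S_some: "(SOME p. p \<in> S a b) \<in> S a b" if "a \<in> C" "b \<in> C" for a b
    by (rule someI[of _ "(a, b)"]) (use that in \<open>simp add: S_def\<close>)
  have S_mono: "S a b \<subseteq> S c d" if "a [+] d = c [+] b" "a \<in> C" "b \<in> C" "c \<in> C" "d \<in> C" for a b c d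
  proof
    fix p assume "p \<in> S a b"
    then have p: "fst p \<in> C" "snd p \<in> C" "fst p [+] b = a [+] snd p" by (auto simp: S_def)
    have "fst p [+] d [+] b = a [+] snd p [+] d" using p that by (simp add: swap[of _ d b])
    also have "\<dots> = c [+] b [+] snd p" using p that by (simp add: swap[of a _ d])
    also have "\<dots> = c [+] snd p [+] b" using p that by (simp add: swap)
    finally have eq: "fst p [+] d [+] b = c [+] snd p [+] b" .
    have "fst p [+] d = c [+] snd p"
      using p(1,2) that(2-) by (intro cancel[OF eq]) (simp_all add: cone_add_closed)
    then show "p \<in> S c d" using p by (auto simp: S_def mem_Times_iff)
  qed
  have "cone_differences C add zero smul le mk"
  proof (intro cone_differences.intro cancellative_cone_axioms cone_differences_axioms.intro)
    fix a b c d assume C: "a \<in> C" "b \<in> C" "c \<in> C" "d \<in> C"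
    show "mk a b = mk c d \<longleftrightarrow> a [+] d = c [+] b"
    proof
      assume "a [+] d = c [+] b"
      then have "S a b = S c d" using C by (intro equalityI S_mono) simp_all
      then show "mk a b = mk c d" by (simp add: mk_def)
    next
      assume eq: "mk a b = mk c d"
      define p q where "p = (SOME p. p \<in> S a b)" and "q = (SOME p. p \<in> S c d)"
      have "p \<in> S a b" "q \<in> S c d"
        unfolding p_def q_def using C by (intro S_some; simp)+
      then have p: "fst p \<in> C" "snd p \<in> C" "fst p [+] b = a [+] snd p"
        and q: "fst q \<in> C" "snd q \<in> C" "fst q [+] d = c [+] snd q"
        by (auto simp: S_def)
      have "map_prod j j p = map_prod j j q"
        using eq by (simp only: mk_def p_def q_def)
      then have "p = q"
        using p(1,2) q(1,2) j by (simp add: prod_eq_iff inj_on_eq_iff)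
      then have "a [+] snd p [+] d = c [+] snd p [+] b"
        using p q C by (metis swap)
      then have eq: "a [+] d [+] snd p = c [+] b [+] snd p"
        using p C by (metis swap)
      show "a [+] d = c [+] b"
        using p(1,2) C by (intro cancel[OF eq]) (simp_all add: cone_add_closed)
    qed
  qed
  then show ?thesis by (rule that)
qed

lemma monotonically_complete_on_cong:
  assumes "\<And>y. y \<in> Y \<Longrightarrow> N y = M y"
  shows "monotonically_complete_on Y N \<longleftrightarrow> monotonically_complete_on Y M"
proof -
  have "positive_ball Y N = positive_ball Y M" using assms by (auto simp: positive_ball_def)
  then show ?thesis by (simp add: monotonically_complete_on_def)
qed

section \<open>Transfer of the results to the original lattices\<close>

lemma normed_representation_exists:
  fixes V :: "'a normed_lattice"
  assumes "normed_lattice V"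
  obtains rep :: "'a \<Rightarrow> 'a lattice_section" where "normed_representation V rep"
  using assms lattice_representation_exists[of V]
  by (metis normed_lattice.axioms(1) normed_representation.intro)

locale normed_embedding_representation =
  F: normed_representation F rep + G: normed_representation G rep' +
  embedding_representation F rep G rep' T J
  for F :: "('a, 'm) normed_lattice_scheme" and rep :: "'a \<Rightarrow> 'v::real_vector_lattice"
    and G :: "('b, 'n) normed_lattice_scheme" and rep' :: "'b \<Rightarrow> 'w::real_vector_lattice" and T J
begin

lemma isomorphic_embedding_iff:
  "isomorphic_embedding F G T \<longleftrightarrow> embedding_on F.img G.img J \<and>
    (\<exists>C. \<forall>x\<in>F.img. G.rep_norm (J x) \<le> C * F.rep_norm x) \<and>
    (\<exists>c>0. \<forall>x\<in>F.img. c * F.rep_norm x \<le> G.rep_norm (J x))"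
  unfolding isomorphic_embedding_def lattice_embedding_iff
  by (simp add: F.rep_norm G.rep_norm T_closed flip: rep_T)

end

lemma normed_embedding_representation_exists:
  fixes G :: "'b normed_lattice" and rep :: "'a \<Rightarrow> 'v::real_vector_lattice"
  assumes "normed_representation F rep" "normed_lattice G" "lattice_embedding F G T"
  obtains rep' :: "'b \<Rightarrow> 'b lattice_section" and J where "normed_embedding_representation F rep G rep' T J"
proof -
  interpret F: normed_representation F rep by fact
  obtain rep' :: "'b \<Rightarrow> 'b lattice_section" where G: "normed_representation G rep'"
    using normed_representation_exists[OF assms(2)] .
  then interpret G: normed_representation G rep' .
  show ?thesis
  proof (rule that, intro normed_embedding_representation.intro embedding_representation.intro
      embedding_representation_axioms.intro)
    show "T x \<in> carrier G" if "x \<in> carrier F" for x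
      using assms(3) that by (auto simp: lattice_embedding_def hom_def)
    show "rep' (T x) = (rep' \<circ> T \<circ> inv_into (carrier F) rep) (rep x)" if "x \<in> carrier F" for x
      using that F.rep_inj by simp
  qed (fact assms G F.lattice_representation_axioms G.lattice_representation_axioms)+
qed

lemma embeds_isomorphically_regular_imp_demicontinuous:
  fixes F :: "'a normed_lattice"
  assumes F: "normed_lattice F" and "embeds_isomorphically_regular TYPE('g) F"
  shows "demicontinuous F"
proof -
  obtain G :: "'g normed_lattice" and T where G: "mc_banach_lattice G"
    and T: "isomorphic_embedding F G T" "regular_sublattice (T ` carrier F) G"
    using assms(2) by (auto simp: embeds_isomorphically_regular_def)
  obtain rep :: "'a \<Rightarrow> 'a lattice_section" where rep: "normed_representation F rep"
    using normed_representation_exists[OF F] .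
  have "normed_lattice G" "lattice_embedding F G T"
    using G T by (simp_all add: mc_banach_lattice_def banach_lattice.axioms isomorphic_embedding_def)
  then obtain rep' :: "'g \<Rightarrow> 'g lattice_section" and J
    where "normed_embedding_representation F rep G rep' T J"
    by (rule normed_embedding_representation_exists[OF rep])
  then interpret normed_embedding_representation F rep G rep' T J .
  obtain C c where J: "embedding_on F.img G.img J"
    "\<And>x. x \<in> F.img \<Longrightarrow> G.rep_norm (J x) \<le> C * F.rep_norm x"
    "0 < c" "\<And>x. x \<in> F.img \<Longrightarrow> c * F.rep_norm x \<le> G.rep_norm (J x)"
    using T(1) unfolding isomorphic_embedding_iff by blast
  have "regular_in (J ` F.img) G.img"
    using T regular_iff by (simp add: isomorphic_embedding_def)
  moreover have "monotonically_complete_on G.img G.rep_norm"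
    using G by (simp add: mc_banach_lattice_def G.monotonically_complete_iff)
  ultimately have "demicontinuous_on F.img F.rep_norm"
    using regular_imp_demicontinuous_on[OF F.normed_sublattice G.normed_sublattice J(1) _ _ J(2,3,4)]
    by blast
  then show ?thesis by (simp add: F.demicontinuous_iff)
qed

lemma order_dense_imp_regular_sublattice:
  fixes F :: "'a normed_lattice" and G :: "'g normed_lattice"
  assumes F: "normed_lattice F" and G: "normed_lattice G" and T: "lattice_embedding F G T"
    and dense: "order_dense_sublattice (T ` carrier F) G"
  shows "regular_sublattice (T ` carrier F) G"
proof -
  obtain rep :: "'a \<Rightarrow> 'a lattice_section" where "normed_representation F rep"
    using normed_representation_exists[OF F] .
  then obtain rep' :: "'g \<Rightarrow> 'g lattice_section" and J
    where "normed_embedding_representation F rep G rep' T J"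
    using normed_embedding_representation_exists G T by blast
  then interpret normed_embedding_representation F rep G rep' T J .
  have "J ` F.img \<subseteq> G.img" using T_closed image_eq by auto
  then have "regular_in (J ` F.img) G.img"
    using order_dense_imp_regular[OF G.linear_sublattice_image] dense order_dense_iff[OF T] by blast
  then show ?thesis using regular_iff[OF T] by simp
qed

lemma isometric_imp_isomorphic_embedding:
  "isometric_embedding F G T \<Longrightarrow> isomorphic_embedding F G T"
  unfolding isometric_embedding_def isomorphic_embedding_def
  by (intro conjI exI[of _ "1::real"]) auto

lemma isometric_order_dense_imp_isomorphic_regular:
  fixes F :: "'a normed_lattice"
  assumes "normed_lattice F" "embeds_isometrically_order_dense TYPE('g) F"
  shows "embeds_isomorphically_regular TYPE('g) F"
proof -
  obtain G :: "'g normed_lattice" and T where G: "mc_banach_lattice G" "isometric_embedding F G T"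
      "order_dense_sublattice (T ` carrier F) G"
    using assms(2) by (auto simp: embeds_isometrically_order_dense_def)
  then have "regular_sublattice (T ` carrier F) G"
    by (intro order_dense_imp_regular_sublattice assms)
      (simp_all add: mc_banach_lattice_def banach_lattice.axioms isometric_embedding_def)
  then show ?thesis
    using G isometric_imp_isomorphic_embedding unfolding embeds_isomorphically_regular_def by blast
qed

lemma demicontinuous_imp_isometric_order_dense:
  fixes F :: "'a normed_lattice"
  assumes F: "normed_lattice F" and demi: "demicontinuous F"
  shows "embeds_isometrically_order_dense TYPE('a set \<times> 'a set) F"
proof -
  obtain rep :: "'a \<Rightarrow> 'a lattice_section" where "normed_representation F rep"
    using normed_representation_exists[OF F] .
  then interpret F: normed_representation F rep .
  interpret E: normed_sublattice F.img F.rep_norm by (rule F.normed_sublattice)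
  have demi': "demicontinuous_on F.img F.rep_norm" using demi by (simp add: F.demicontinuous_iff)
  interpret cone: cancellative_cone E.cuts E.cut_add "{0}" E.cut_scale "(\<subseteq>)"
    by (rule E.cuts_cone[OF demi'])
  \<comment> \<open>Cuts consist of represented elements. Pulled back to the carrier they become
    sets over \<open>'a\<close>, which keeps the formal differences in pairs of such sets.\<close>
  have inv: "inj_on (inv_into (carrier F) rep) F.img" by (rule inj_on_inv_into) simp
  have "inj_on ((`) (inv_into (carrier F) rep)) E.cuts"
  proof (rule inj_onI)
    fix A B assume "A \<in> E.cuts" "B \<in> E.cuts"
    then have "A \<subseteq> F.img" "B \<subseteq> F.img" using E.cut_mem by auto
    then show "inv_into (carrier F) rep ` A = inv_into (carrier F) rep ` B \<Longrightarrow> A = B"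
      using inj_on_image_eq_iff[OF inv] by blast
  qed
  then obtain mk :: "_ \<Rightarrow> _ \<Rightarrow> 'a set \<times> 'a set"
    where "cone_differences E.cuts E.cut_add {0} E.cut_scale (\<subseteq>) mk"
    using cone.formal_differences_exist by blast
  then interpret D: cone_differences E.cuts E.cut_add "{0}" E.cut_scale "(\<subseteq>)" mk .
  let ?D = D.diff_lattice
  obtain rep' :: "'a set \<times> 'a set \<Rightarrow> ('a set \<times> 'a set) lattice_section"
    where rep': "lattice_representation ?D rep'"
    using lattice_representation_exists[OF D.vector_lattice_diff_lattice] .
  then interpret V: lattice_representation ?D rep' .
  interpret cut_completion F.img F.rep_norm V.img "\<lambda>A. rep' (D.positive_difference A)"
  proof (intro cut_completion.intro E.normed_sublattice_axioms V.linear_sublattice_image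
      cut_completion_axioms.intro demi')
    fix A B assume A: "A \<in> E.cuts"
    note pd = D.positive_difference
    show "rep' (D.positive_difference A) \<in> V.img" using pd(1)[OF A A] by simp
    show "rep' (D.positive_difference (E.cut_scale a A)) = a *\<^sub>R rep' (D.positive_difference A)"
      if "0 \<le> a" for a
      using V.rep_smult[of "D.positive_difference A" a] pd(1,3)[OF A A] that by simp
    assume B: "B \<in> E.cuts"
    show "rep' (D.positive_difference (E.cut_add A B)) =
        rep' (D.positive_difference A) + rep' (D.positive_difference B)"
      using V.rep_add[of "D.positive_difference A" "D.positive_difference B"]
        pd(1)[OF A A] pd(1)[OF B B] pd(2)[OF A B] by simp
    show "rep' (D.positive_difference A) \<le> rep' (D.positive_difference B) \<longleftrightarrow> A \<subseteq> B"
      using V.rep_le[of "D.positive_difference A" "D.positive_difference B"]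
        pd(1)[OF A A] pd(1)[OF B B] pd(4)[OF A B] by simp
  next
    fix y assume "y \<in> V.img" "0 \<le> y"
    then obtain x where x: "x \<in> D.differences" "y = rep' x" "D.diff_le (mk {0} {0}) x"
      using V.rep_nonneg by auto
    then show "\<exists>A\<in>E.cuts. y = rep' (D.positive_difference A)"
      using D.positive_differenceE by metis
  qed
  obtain r where "order_dense_extension F.img F.rep_norm V.img completion_map r"
    using order_dense_extension .
  then interpret X: order_dense_extension F.img F.rep_norm V.img completion_map r .
  define G where "G = ?D\<lparr>vnorm := \<lambda>x. X.extended_norm (rep' x)\<rparr>"
  have G: "normed_representation G rep'"
    and norm: "\<And>v. v \<in> V.img \<Longrightarrow> normed_representation.rep_norm G rep' v = X.extended_norm v"
    using normed_lattice_update[OF rep' X.normed_sublattice_extension] by (simp_all add: G_def)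
  interpret G: normed_representation G rep' by (rule G)
  have car: "carrier G = carrier ?D" by (simp add: G_def)
  have "monotonically_complete G"
    using X.monotonically_complete_extension monotonically_complete_on_cong[of V.img G.rep_norm X.extended_norm, OF norm]
    by (simp add: G.monotonically_complete_iff car)
  then have mc: "mc_banach_lattice G"
    by (simp add: mc_banach_lattice_def G.monotonically_complete_imp_banach_lattice)
  define T where "T x = inv_into (carrier G) rep' (completion_map (rep x))" for x
  have img: "completion_map (rep x) \<in> rep' ` carrier G" if "x \<in> carrier F" for x
    using X.emb_mem[of "rep x"] that by (simp add: car del: D.diff_lattice_sel)
  interpret normed_embedding_representation F rep G rep' T completion_map
  proof (intro normed_embedding_representation.intro embedding_representation.intro
      embedding_representation_axioms.intro)
    show "T x \<in> carrier G" "rep' (T x) = completion_map (rep x)" if "x \<in> carrier F" for x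
      using img[OF that] by (simp_all add: T_def inv_into_into f_inv_into_f)
  qed (fact G F.normed_representation_axioms F.lattice_representation_axioms
      G.lattice_representation_axioms)+
  have emb: "lattice_embedding F G T"
    using completion_map_embedding_on by (simp add: lattice_embedding_iff car)
  have "vnorm G (T x) = vnorm F x" if x: "x \<in> carrier F" for x
  proof -
    have "vnorm G (T x) = G.rep_norm (completion_map (rep x))"
      using x by (simp add: T_closed G.rep_norm flip: rep_T)
    also have "\<dots> = X.extended_norm (completion_map (rep x))"
      using x by (intro norm X.emb_mem imageI)
    also have "\<dots> = vnorm F x"
      using x X.extended_norm_embedding[of "rep x"] by (simp add: F.rep_norm)
    finally show ?thesis .
  qed
  then have "isometric_embedding F G T" using emb by (simp add: isometric_embedding_def)
  moreover have "order_dense_sublattice (T ` carrier F) G"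
    using order_dense_iff[OF emb] completion_map_dense by (simp add: car)
  ultimately show ?thesis
    using mc unfolding embeds_isometrically_order_dense_def by blast
qed

lemma mc_banach_lattice_unique:
  fixes F :: "'a normed_lattice" and G\<^sub>1 :: "'g normed_lattice" and G\<^sub>2 :: "'h normed_lattice"
  assumes F: "normed_lattice F"
    and G1: "mc_banach_lattice G\<^sub>1" "isomorphic_embedding F G\<^sub>1 T\<^sub>1"
      "order_dense_sublattice (T\<^sub>1 ` carrier F) G\<^sub>1"
    and G2: "mc_banach_lattice G\<^sub>2" "isomorphic_embedding F G\<^sub>2 T\<^sub>2"
      "order_dense_sublattice (T\<^sub>2 ` carrier F) G\<^sub>2"
  obtains S where "normed_lattice_isomorphism G\<^sub>1 G\<^sub>2 S" "\<And>f. f \<in> carrier F \<Longrightarrow> S (T\<^sub>1 f) = T\<^sub>2 f"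
proof -
  have lat: "normed_lattice G\<^sub>1" "normed_lattice G\<^sub>2" "lattice_embedding F G\<^sub>1 T\<^sub>1" "lattice_embedding F G\<^sub>2 T\<^sub>2"
    using G1 G2 by (simp_all add: mc_banach_lattice_def banach_lattice.axioms isomorphic_embedding_def)
  obtain rep :: "'a \<Rightarrow> 'a lattice_section" where rep: "normed_representation F rep"
    using normed_representation_exists[OF F] .
  obtain rep1 :: "'g \<Rightarrow> 'g lattice_section" and J1
    where "normed_embedding_representation F rep G\<^sub>1 rep1 T\<^sub>1 J1"
    using normed_embedding_representation_exists[OF rep lat(1,3)] .
  then interpret E1: normed_embedding_representation F rep G\<^sub>1 rep1 T\<^sub>1 J1 .
  obtain rep2 :: "'h \<Rightarrow> 'h lattice_section" and J2
    where "normed_embedding_representation F rep G\<^sub>2 rep2 T\<^sub>2 J2"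
    using normed_embedding_representation_exists[OF rep lat(2,4)] .
  then interpret E2: normed_embedding_representation F rep G\<^sub>2 rep2 T\<^sub>2 J2 .
  interpret E: normed_sublattice E1.F.img E1.F.rep_norm by (rule E1.F.normed_sublattice)
  obtain c1 C1 where J1: "embedding_on E1.F.img E1.G.img J1"
    "\<And>x. x \<in> E1.F.img \<Longrightarrow> E1.G.rep_norm (J1 x) \<le> C1 * E1.F.rep_norm x"
    "0 < c1" "\<And>x. x \<in> E1.F.img \<Longrightarrow> c1 * E1.F.rep_norm x \<le> E1.G.rep_norm (J1 x)"
    using G1(2) unfolding E1.isomorphic_embedding_iff by blast
  obtain c2 C2 where J2: "embedding_on E1.F.img E2.G.img J2"
    "\<And>x. x \<in> E1.F.img \<Longrightarrow> E2.G.rep_norm (J2 x) \<le> C2 * E1.F.rep_norm x"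
    "0 < c2" "\<And>x. x \<in> E1.F.img \<Longrightarrow> c2 * E1.F.rep_norm x \<le> E2.G.rep_norm (J2 x)"
    using G2(2) unfolding E2.isomorphic_embedding_iff by blast
  \<comment> \<open>The comparison assumes nonnegative upper constants, whereas the definition of an
    isomorphic embedding allows any real \<open>C\<close>.\<close>
  have pos: "C * E1.F.rep_norm x \<le> max 0 C * E1.F.rep_norm x" if "x \<in> E1.F.img" for C x
    using E.norm_nonneg[OF that] by (intro mult_right_mono) auto
  interpret dense_completions E1.F.img E1.F.rep_norm E1.G.img E1.G.rep_norm J1
    E2.G.img E2.G.rep_norm J2 c1 "max 0 C1" c2 "max 0 C2"
  proof (intro dense_completions.intro dense_completions_axioms.intro embedding.intro
      embedding_axioms.intro E1.F.normed_sublattice E1.G.normed_sublattice E2.G.normed_sublattice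
      E1.F.linear_sublattice_image E1.G.linear_sublattice_image E2.G.linear_sublattice_image
      J1(1,3,4) J2(1,3,4))
    show "monotonically_complete_on E1.G.img E1.G.rep_norm"
      using G1 by (simp add: mc_banach_lattice_def E1.G.monotonically_complete_iff)
    show "monotonically_complete_on E2.G.img E2.G.rep_norm"
      using G2 by (simp add: mc_banach_lattice_def E2.G.monotonically_complete_iff)
    show "order_dense_in (J1 ` E1.F.img) E1.G.img"
      using E1.order_dense_iff lat G1 by blast
    show "order_dense_in (J2 ` E1.F.img) E2.G.img"
      using E2.order_dense_iff lat G2 by blast
    show "E1.G.rep_norm (J1 x) \<le> max 0 C1 * E1.F.rep_norm x" if "x \<in> E1.F.img" for x
      using J1(2)[OF that] pos[OF that, of C1] by linarith
    show "E2.G.rep_norm (J2 x) \<le> max 0 C2 * E1.F.rep_norm x" if "x \<in> E1.F.img" for x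
      using J2(2)[OF that] pos[OF that, of C2] by linarith
  qed simp_all
  define S where "S g = inv_into (carrier G\<^sub>2) rep2 (transfer_map (rep1 g))" for g
  have img: "transfer_map (rep1 g) \<in> E2.G.img" if "g \<in> carrier G\<^sub>1" for g
    using transfer_map_surj that by blast
  interpret S: normed_embedding_representation G\<^sub>1 rep1 G\<^sub>2 rep2 S transfer_map
  proof (intro normed_embedding_representation.intro embedding_representation.intro
      embedding_representation_axioms.intro)
    show "S g \<in> carrier G\<^sub>2" "rep2 (S g) = transfer_map (rep1 g)" if "g \<in> carrier G\<^sub>1" for g
      using img[OF that] by (simp_all add: S_def inv_into_into f_inv_into_f)
  qed (fact E1.G.normed_representation_axioms E2.G.normed_representation_axioms
      E1.G.lattice_representation_axioms E2.G.lattice_representation_axioms)+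
  have "isomorphic_embedding G\<^sub>1 G\<^sub>2 S"
    unfolding S.isomorphic_embedding_iff
    using transfer_map_embedding_on transfer_map_bounded transfer_map_bounded_below by metis
  moreover have "S ` carrier G\<^sub>1 = carrier G\<^sub>2"
  proof -
    have "rep2 ` S ` carrier G\<^sub>1 = rep2 ` carrier G\<^sub>2"
      using S.image_eq transfer_map_surj by simp
    moreover have "S ` carrier G\<^sub>1 \<subseteq> carrier G\<^sub>2" using S.T_closed by auto
    ultimately show ?thesis using inj_on_image_eq_iff[OF E2.G.rep_inj] by blast
  qed
  moreover have "S (T\<^sub>1 f) = T\<^sub>2 f" if f: "f \<in> carrier F" for f
  proof -
    have "rep2 (S (T\<^sub>1 f)) = rep2 (T\<^sub>2 f)"
      using f by (simp add: S.rep_T E1.T_closed E1.rep_T E2.rep_T transfer_map_embedding)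
    then show ?thesis using f S.T_closed E1.T_closed E2.T_closed by (simp add: E2.G.rep_eq_iff)
  qed
  ultimately show ?thesis using that by (auto simp: normed_lattice_isomorphism_def)
qed

theorem corollary6p5:
  fixes F :: "'a normed_lattice"
  assumes "normed_lattice F"
  shows
    "(demicontinuous F \<longleftrightarrow> embeds_isometrically_order_dense TYPE('a set \<times> 'a set) F) \<and>
     (demicontinuous F \<longleftrightarrow> embeds_isomorphically_regular TYPE('a set \<times> 'a set) F) \<and>
     (embeds_isometrically_order_dense TYPE('g) F \<longrightarrow> demicontinuous F) \<and>
     (embeds_isomorphically_regular TYPE('g) F \<longrightarrow> demicontinuous F) \<and>
     (\<forall>(G\<^sub>1 :: 'g normed_lattice) (G\<^sub>2 :: 'h normed_lattice) T\<^sub>1 T\<^sub>2.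
        mc_banach_lattice G\<^sub>1 \<and> isomorphic_embedding F G\<^sub>1 T\<^sub>1 \<and>
        order_dense_sublattice (T\<^sub>1 ` carrier F) G\<^sub>1 \<and>
        mc_banach_lattice G\<^sub>2 \<and> isomorphic_embedding F G\<^sub>2 T\<^sub>2 \<and>
        order_dense_sublattice (T\<^sub>2 ` carrier F) G\<^sub>2 \<longrightarrow>
        (\<exists>S. normed_lattice_isomorphism G\<^sub>1 G\<^sub>2 S \<and> (\<forall>f\<in>carrier F. S (T\<^sub>1 f) = T\<^sub>2 f)))"
proof (intro conjI allI impI)
  note regular = embeds_isomorphically_regular_imp_demicontinuous[OF assms]
  note dense = isometric_order_dense_imp_isomorphic_regular[OF assms]
  note complete = demicontinuous_imp_isometric_order_dense[OF assms]
  show "demicontinuous F \<longleftrightarrow> embeds_isometrically_order_dense TYPE('a set \<times> 'a set) F"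
    using regular dense complete by blast
  show "demicontinuous F \<longleftrightarrow> embeds_isomorphically_regular TYPE('a set \<times> 'a set) F"
    using regular dense complete by blast
  show "demicontinuous F" if "embeds_isometrically_order_dense TYPE('g) F"
    using that regular dense by blast
  show "demicontinuous F" if "embeds_isomorphically_regular TYPE('g) F"
    using that by (rule regular)
  fix G\<^sub>1 :: "'g normed_lattice" and G\<^sub>2 :: "'h normed_lattice" and T\<^sub>1 T\<^sub>2
  assume "mc_banach_lattice G\<^sub>1 \<and> isomorphic_embedding F G\<^sub>1 T\<^sub>1 \<and>
    order_dense_sublattice (T\<^sub>1 ` carrier F) G\<^sub>1 \<and>
    mc_banach_lattice G\<^sub>2 \<and> isomorphic_embedding F G\<^sub>2 T\<^sub>2 \<and>
    order_dense_sublattice (T\<^sub>2 ` carrier F) G\<^sub>2"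
  then show "\<exists>S. normed_lattice_isomorphism G\<^sub>1 G\<^sub>2 S \<and> (\<forall>f\<in>carrier F. S (T\<^sub>1 f) = T\<^sub>2 f)"
    using mc_banach_lattice_unique[OF assms, of G\<^sub>1 T\<^sub>1 G\<^sub>2 T\<^sub>2] by metis
qed

end
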